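(* Let $X_{ij}$ and $Y_{ij}$, $1\le i\le j<\infty$, be triangular arrays of real random variables with $\mathbb{E}X_{ij}=\mathbb{E}Y_{ij}=0$ and $\mathbb{E}X_{ij}^2=\mathbb{E}Y_{ij}^2=\sigma_{ij}^2$; let $X_{ji}=X_{ij}$, $Y_{ji}=Y_{ij}$ (and $\sigma_{ji}=\sigma_{ij}$) for $i<j$, and let $\mathbf{X}_n=\{X_{ij}\}_{i,j=1}^n$ and $\mathbf{Y}_n=\{Y_{ij}\}_{i,j=1}^n$. Assume that the random matrices $\mathbf{X}_n$ and $\mathbf{Y}_n$ are independent of each other, and that the elements $Y_{ij}$, $1\le i\le j\le n$, of $\mathbf{Y}_n$ are independent Gaussian random variables. Suppose that: (a) $\mathbb{E}(X_{ij}\mid \mathfrak{F}^{(i,j)})=0$ for all $n$ and all $1\le i\le j\le n$; (b) $\displaystyle \frac{1}{n^2}\sum_{i,j=1}^n \mathbb{E}\left|\mathbb{E}(X_{ij}^2\mid\mathfrak{F}^{(i,j)})-\sigma_{ij}^2\right|\to 0$ as $n\to\infty$; (c) for every fixed $\tau>0$, $\displaystyle \frac{1}{n^2}\sum_{i,j=1}^n \mathbb{E}|X_{ij}|^2\,\mathbf{1}(|X_{ij}|\ge \tau\sqrt{n})\to 0$ and $\displaystyle \frac{1}{n^2}\sum_{i,j=1}^n \mathbb{E}|Y_{ij}|^2\,\mathbf{1}(|Y_{ij}|\ge \tau\sqrt{n})\to 0$ as $n\to\infty$; (d) $\displaystyle \frac1n\sum_{i=1}^n |B_i^2-1|\to 0$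 as $n\to\infty$, where $B_i^2:=\frac1n\sum_{j=1}^n\sigma_{ij}^2$. Then $$L(F^{\mathbf{X}_n},F^{\mathbf{Y}_n})\to 0\quad\text{as } n\to\infty,$$ where $L$ denotes the Lévy distance.
   Context: All random variables are defined on a common probability space. $\mathbf{1}(B)$ denotes the indicator of an event $B$. The $\sigma$-algebras (depending on $n$) are $\mathfrak{F}^{(i,j)}:=\sigma\{X_{kl}:1\le k\le l\le n,\ (k,l)\ne(i,j)\}$ for $1\le i\le j\le n$, and $\mathfrak{F}^{(j,i)}:=\mathfrak{F}^{(i,j)}$. The quantity $B_i\ge0$ depends on $n$. For a real symmetric random $n\times n$ matrix $\mathbf{M}_n$, let $\lambda_1\le\dots\le\lambda_n$ be the eigenvalues of $n^{-1/2}\mathbf{M}_n$, let $\mathcal{F}^{\mathbf{M}_n}(x)=\frac1n\sum_{i=1}^n\mathbf{1}(\lambda_i\le x)$, and let $F^{\mathbf{M}_n}(x):=\mathbb{E}\,\mathcal{F}^{\mathbf{M}_n}(x)$. The Lévy distance between distribution functions $F_1$ and $F_2$ is $L(F_1,F_2)=\inf\{\varepsilon>0: F_1(x-\varepsilon)-\varepsilon\le F_2(x)\le F_1(x+\varepsilon)+\varepsilon \text{ for all } x\in\mathbb{R}\}$. *)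

theory Defs
  imports "HOL-Probability.Probability" "Jordan_Normal_Form.Char_Poly"
begin

text \<open>Arrays of random variables are indexed from 1, as in the usual matrix notation;
  the matrix type indexes from 0, hence the shift in \<open>arr_matrix\<close>.\<close>

text \<open>The \<open>\<sigma>\<close>-algebra generated by all entries on or above the diagonal of the leading
  \<open>n \<times> n\<close> block except the one at position \<open>{i, j}\<close>; symmetric in \<open>i\<close> and \<open>j\<close>.\<close>

definition others_sigma ::
  "'a measure \<Rightarrow> (nat \<Rightarrow> nat \<Rightarrow> 'a \<Rightarrow> real) \<Rightarrow> nat \<Rightarrow> nat \<Rightarrow> nat \<Rightarrow> 'a measure" where
  "others_sigma M X n i j =
     sigma (space M)
       {X k l -` A \<inter> space M | k l A.
          1 \<le> k \<and> k \<le> l \<and> l \<le> n \<and> (k, l) \<noteq> (min i j, max i j) \<and> A \<in> sets borel}"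

text \<open>Gaussian random variables, including the degenerate ones of variance zero, which the
  library's normal density does not cover.\<close>

definition gaussian_rv :: "'a measure \<Rightarrow> ('a \<Rightarrow> real) \<Rightarrow> bool" where
  "gaussian_rv M Y \<longleftrightarrow>
     Y \<in> borel_measurable M \<and>
     (\<exists>\<mu>. (AE \<omega> in M. Y \<omega> = \<mu>) \<or>
          (\<exists>s>0. distributed M lborel Y (\<lambda>x. ennreal (normal_density \<mu> s x))))"

definition random_matrix ::
  "(nat \<Rightarrow> nat \<Rightarrow> 'a \<Rightarrow> real) \<Rightarrow> nat \<Rightarrow> 'a \<Rightarrow> nat \<times> nat \<Rightarrow> real" where
  "random_matrix X n \<omega> = (\<lambda>(i, j) \<in> {1..n} \<times> {1..n}. X i j \<omega>)"

definition matrix_space :: "nat \<Rightarrow> (nat \<times> nat \<Rightarrow> real) measure" where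
  "matrix_space n = PiM ({1..n} \<times> {1..n}) (\<lambda>_. borel)"

definition arr_matrix :: "nat \<Rightarrow> (nat \<times> nat \<Rightarrow> real) \<Rightarrow> real mat" where
  "arr_matrix n a = Matrix.mat n n (\<lambda>(i, j). a (Suc i, Suc j))"

text \<open>The real eigenvalues in increasing order, repeated by algebraic multiplicity. For a real
  symmetric \<open>n \<times> n\<close> matrix all eigenvalues are real, so this list has length \<open>n\<close>.\<close>

definition sorted_eigenvalues :: "real mat \<Rightarrow> real list" where
  "sorted_eigenvalues A = sorted_list_of_multiset (proots (char_poly A))"

definition emp_spectral_cdf :: "nat \<Rightarrow> (nat \<times> nat \<Rightarrow> real) \<Rightarrow> real \<Rightarrow> real" where
  "emp_spectral_cdf n a x =
     (let eigs = sorted_eigenvalues ((1 / sqrt (real n)) \<cdot>\<^sub>m arr_matrix n a)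
      in (1 / real n) * (\<Sum>i=1..n. of_bool (eigs ! (i - 1) \<le> x)))"

definition mean_spectral_cdf ::
  "'a measure \<Rightarrow> (nat \<Rightarrow> nat \<Rightarrow> 'a \<Rightarrow> real) \<Rightarrow> nat \<Rightarrow> real \<Rightarrow> real" where
  "mean_spectral_cdf M X n x = (\<integral>\<omega>. emp_spectral_cdf n (random_matrix X n \<omega>) x \<partial>M)"

definition levy_dist :: "(real \<Rightarrow> real) \<Rightarrow> (real \<Rightarrow> real) \<Rightarrow> real" where
  "levy_dist F G =
     Inf {\<epsilon>. \<epsilon> > 0 \<and> (\<forall>x. F (x - \<epsilon>) - \<epsilon> \<le> G x \<and> G x \<le> F (x + \<epsilon>) + \<epsilon>)}"

end

theory Submission
  imports Defs "Jordan_Normal_Form.Schur_Decomposition" "HOL-Real_Asymp.Real_Asymp"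
begin

text \<open>The imaginary part of the normalised resolvent trace at \<open>z = u + iv\<close> is, up to the factor
  \<open>\<pi>\<close>, the density at \<open>u\<close> of the empirical spectral distribution convolved with the Cauchy law of
  scale \<open>v\<close>. Replacing the entries of \<open>X\<close> by those of \<open>Y\<close> one symmetric pair at a time, the
  resolvent expansion gives a second-order Taylor formula whose coefficients depend on the other
  entries only. The linear terms vanish in expectation by (a) and by independence, the quadratic
  terms agree up to the error in (b), and the remainders are controlled by (c). The resulting bound
  is uniform in \<open>u\<close>, so it can be integrated over a bounded interval; the mass outside it is
  controlled by the second moments, which (d) keeps bounded. Finally, convolution with a Cauchy law
  of small scale moves a distribution function only slightly in the Levy sense.\<close>

section \<open>Resolvents of real symmetric matrices\<close>

text \<open>Swapping one pair leaves a mixed array. Since (a) and (b) condition on X entries only,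
  the Y matrix is frozen by Fubini, as independence of the two matrices permits; the Taylor
  coefficient, taken where the swapped entry is 0, is then a bounded function of the other X
  entries, against which the conditional hypotheses can be tested. The same is done for Y with X
  frozen. Entries are not truncated. A cubic remainder alone would call for third moments, so a
  quadratic bound is kept beside it and the choice between them is made at
  \<open>|x| = \<tau> sqrt n\<close>. A perturbation touches at most two entries, so traces are
  bounded without a factor n, and each swap carries the weight 1 / n^2 of (b) and (c). The cubic
  side leaves a term proportional to \<tau> that survives the limit in n, hence the order of
  choices: smoothing scale v and cutoff K from the target accuracy, then \<tau> depending on both,
  and n last. The empirical distribution function is defined through a sorted list of roots; its
  measurability too is drawn from resolvents, as a limit of integrals of their traces.\<close>

definition mat_trace :: "'a::comm_monoid_add mat \<Rightarrow> 'a" where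
  "mat_trace A = (\<Sum>i<dim_row A. A $$ (i, i))"

lemma index_mult_mat_sum:
  assumes "A \<in> carrier_mat n m" "B \<in> carrier_mat m k" "i < n" "j < k"
  shows "(A * B) $$ (i, j) = (\<Sum>l<m. A $$ (i, l) * B $$ (l, j))"
  using assms by (auto simp: scalar_prod_def lessThan_atLeast0 intro!: sum.cong)

lemma index_mult_mat_vec_sum:
  assumes "A \<in> carrier_mat n m" "v \<in> carrier_vec m" "i < n"
  shows "vec_index (A *\<^sub>v v) i = (\<Sum>l<m. A $$ (i, l) * vec_index v l)"
  using assms by (auto simp: scalar_prod_def lessThan_atLeast0 intro!: sum.cong)

lemma mat_trace_mult:
  assumes "A \<in> carrier_mat n m" "B \<in> carrier_mat m n"
  shows "mat_trace (A * B) = (\<Sum>i<n. \<Sum>l<m. A $$ (i, l) * B $$ (l, i))"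
proof -
  have "dim_row (A * B) = n" using assms by auto
  then show ?thesis unfolding mat_trace_def
    using index_mult_mat_sum[OF assms] by auto
qed

lemma mat_trace_mult_comm:
  fixes A :: "'a::comm_semiring_0 mat"
  assumes "A \<in> carrier_mat n m" "B \<in> carrier_mat m n"
  shows "mat_trace (A * B) = mat_trace (B * A)"
  unfolding mat_trace_mult[OF assms] mat_trace_mult[OF assms(2,1)]
  by (subst sum.swap) (simp add: mult.commute)

lemma mat_trace_add:
  "A \<in> carrier_mat n n \<Longrightarrow> B \<in> carrier_mat n n \<Longrightarrow> mat_trace (A + B) = mat_trace A + mat_trace B"
  by (auto simp: mat_trace_def sum.distrib)

lemma mat_trace_smult:
  fixes A :: "'a::comm_semiring_0 mat"
  shows "A \<in> carrier_mat n n \<Longrightarrow> mat_trace (c \<cdot>\<^sub>m A) = c * mat_trace A"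
  by (auto simp: mat_trace_def sum_distrib_left)

lemma mat_trace_similar:
  fixes A :: "'a::comm_ring_1 mat"
  assumes "similar_mat_wit A B P Q"
  shows "mat_trace A = mat_trace B"
proof -
  define n where "n = dim_row A"
  have c: "A \<in> carrier_mat n n" "B \<in> carrier_mat n n" "P \<in> carrier_mat n n" "Q \<in> carrier_mat n n"
    "P * Q = 1\<^sub>m n" "Q * P = 1\<^sub>m n" "A = P * B * Q"
    using similar_mat_witD[OF n_def assms] by blast+
  have "mat_trace A = mat_trace (Q * (P * B))"
    unfolding c(7) using c(2-4) by (intro mat_trace_mult_comm[of _ n n]) auto
  also have "Q * (P * B) = Q * P * B" using c(2-4) by (metis assoc_mult_mat)
  finally show ?thesis using c(2,6) by simp
qed

section \<open>Euclidean norm and operator bounds of complex matrices\<close>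

definition vnorm :: "complex Matrix.vec \<Rightarrow> real" where
  "vnorm v = L2_set (\<lambda>i. cmod (vec_index v i)) {..<dim_vec v}"

lemma vnorm_nonneg: "0 \<le> vnorm v"
  by (simp add: vnorm_def L2_set_nonneg)

lemma vnorm_square: "(vnorm v)\<^sup>2 = (\<Sum>i<dim_vec v. (cmod (vec_index v i))\<^sup>2)"
  by (simp add: vnorm_def L2_set_def sum_nonneg)

lemma cmod_index_le_vnorm: "i < dim_vec v \<Longrightarrow> cmod (vec_index v i) \<le> vnorm v"
  unfolding vnorm_def by (intro member_le_L2_set) auto

lemma vnorm_unit: "i < n \<Longrightarrow> vnorm (unit_vec n i) = 1"
  by (simp add: vnorm_def L2_set_def unit_vec_def if_distrib[of "\<lambda>x. (cmod x)\<^sup>2"] cong: if_cong)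

text \<open>An upper bound for the operator norm stated as a relation: no supremum has to be shown
  finite, and the dimension and \<open>0 \<le> c\<close> travel with the bound, so that bounds
  multiply along products.\<close>

definition op_bounded :: "nat \<Rightarrow> real \<Rightarrow> complex mat \<Rightarrow> bool" where
  "op_bounded n c A \<longleftrightarrow>
     A \<in> carrier_mat n n \<and> 0 \<le> c \<and> (\<forall>v\<in>carrier_vec n. vnorm (A *\<^sub>v v) \<le> c * vnorm v)"

lemma op_bounded_mult:
  assumes "op_bounded n c A" "op_bounded n d B"
  shows "op_bounded n (c * d) (A * B)"
  unfolding op_bounded_def
proof (intro conjI ballI)
  show "A * B \<in> carrier_mat n n" "0 \<le> c * d"
    using assms by (auto simp: op_bounded_def)
  fix v :: "complex Matrix.vec" assume v: "v \<in> carrier_vec n"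
  have car: "A \<in> carrier_mat n n" "B \<in> carrier_mat n n" using assms by (auto simp: op_bounded_def)
  then have Bv: "B *\<^sub>v v \<in> carrier_vec n" using v by auto
  have "vnorm (A * B *\<^sub>v v) = vnorm (A *\<^sub>v (B *\<^sub>v v))"
    using assoc_mult_mat_vec[OF car v] by simp
  also have "\<dots> \<le> c * vnorm (B *\<^sub>v v)" using assms Bv by (auto simp: op_bounded_def)
  also have "\<dots> \<le> c * (d * vnorm v)" using assms v by (auto simp: op_bounded_def intro!: mult_left_mono)
  finally show "vnorm (A * B *\<^sub>v v) \<le> c * d * vnorm v" by (simp add: mult.assoc)
qed

lemma op_bounded_entry:
  assumes "op_bounded n c A" "i < n" "j < n"
  shows "cmod (A $$ (i, j)) \<le> c"
proof -
  have A: "A \<in> carrier_mat n n" using assms by (auto simp: op_bounded_def)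
  have "vec_index (A *\<^sub>v unit_vec n j) i = A $$ (i, j)"
    using A assms by (simp)
  then have "cmod (A $$ (i, j)) \<le> vnorm (A *\<^sub>v unit_vec n j)"
    using cmod_index_le_vnorm[of i "A *\<^sub>v unit_vec n j"] A assms by auto
  also have "\<dots> \<le> c * vnorm (unit_vec n j)"
    using assms by (auto simp: op_bounded_def)
  finally show ?thesis using vnorm_unit[OF assms(3)] by simp
qed

text \<open>The direction in which a symmetric matrix moves when one entry and its mirror image
  change together. For \<open>i = j\<close> it holds a single 1, not a 2, matching the one entry on
  the diagonal.\<close>

definition sym_unit :: "nat \<Rightarrow> nat \<Rightarrow> nat \<Rightarrow> complex mat" where
  "sym_unit n i j = Matrix.mat n n (\<lambda>(k, l). of_bool ((k = i \<and> l = j) \<or> (k = j \<and> l = i)))"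

lemma sym_unit_carrier [simp]: "sym_unit n i j \<in> carrier_mat n n"
  by (simp add: sym_unit_def)

lemma sym_unit_mult_vec:
  assumes "v \<in> carrier_vec n" "i < n" "j < n" "k < n"
  shows "vec_index (sym_unit n i j *\<^sub>v v) k
       = (if k = i then vec_index v j else if k = j then vec_index v i else 0)"
proof -
  have "vec_index (sym_unit n i j *\<^sub>v v) k = (\<Sum>l<n. sym_unit n i j $$ (k, l) * vec_index v l)"
    using assms by (intro index_mult_mat_vec_sum) auto
  also have "\<dots> = (\<Sum>l<n. if l = (if k = i then j else i) then
      (if k = i \<or> k = j then vec_index v l else 0) else 0)"
    using assms by (intro sum.cong) (auto simp: sym_unit_def)
  also have "\<dots> = (if k = i then vec_index v j else if k = j then vec_index v i else 0)"
    using assms by (subst sum.delta) auto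
  finally show ?thesis .
qed

text \<open>Apart from killing the other coordinates, the matrix exchanges coordinates
  \<open>i\<close> and \<open>j\<close>; the image is dominated coordinatewise by the permuted
  vector, whose norm is that of \<open>v\<close>.\<close>

lemma op_bounded_sym_unit:
  assumes "i < n" "j < n"
  shows "op_bounded n 1 (sym_unit n i j)"
  unfolding op_bounded_def
proof (intro conjI ballI)
  fix v :: "complex Matrix.vec" assume v: "v \<in> carrier_vec n"
  let ?w = "sym_unit n i j *\<^sub>v v" and ?p = "Transposition.transpose i j"
  have d: "dim_vec ?w = n" "dim_vec v = n" using v by (auto simp: sym_unit_def)
  have "(vnorm ?w)\<^sup>2 = (\<Sum>k<n. (cmod (vec_index ?w k))\<^sup>2)" unfolding vnorm_square d ..
  also have "\<dots> \<le> (\<Sum>k<n. (cmod (vec_index v (?p k)))\<^sup>2)"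
    using sym_unit_mult_vec[OF v assms]
    by (intro sum_mono) (auto simp: Transposition.transpose_def)
  also have "\<dots> = (\<Sum>k<n. (cmod (vec_index v k))\<^sup>2)"
    using assms by (intro sum.reindex_bij_betw[of ?p "{..<n}" "{..<n}" "\<lambda>k. (cmod (vec_index v k))\<^sup>2"])
      (auto simp: bij_betw_def inj_on_def Transposition.transpose_def image_def split: if_splits)
  also have "\<dots> = (vnorm v)\<^sup>2" unfolding vnorm_square d ..
  finally show "vnorm ?w \<le> 1 * vnorm v" using power2_le_imp_le[OF _ vnorm_nonneg] by simp
qed auto

text \<open>Only the entries of \<open>A\<close> at \<open>(i, j)\<close> and \<open>(j, i)\<close>
  enter the trace. A bound by dimension times operator norm would lose a factor \<open>n\<close>,
  which the sum over all swaps could not absorb.\<close>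

lemma cmod_trace_mult_sym_unit_le:
  assumes "op_bounded n c A" "i < n" "j < n"
  shows "cmod (mat_trace (A * sym_unit n i j)) \<le> 2 * c"
proof -
  have A: "A \<in> carrier_mat n n" "0 \<le> c" using assms by (auto simp: op_bounded_def)
  have "mat_trace (A * sym_unit n i j) = (\<Sum>k<n. \<Sum>l<n. A $$ (k, l) * sym_unit n i j $$ (l, k))"
    using A by (intro mat_trace_mult) auto
  \<comment> \<open>Column \<open>k\<close> of the unit matrix has at most one nonzero entry, in row
    \<open>j\<close> for \<open>k = i\<close> and in row \<open>i\<close> for \<open>k = j\<close>;
    this form exposes it to \<open>sum.delta\<close>.\<close>
  also have "\<dots> = (\<Sum>k<n. \<Sum>l<n. if l = (if k = i then j else i) then
      (if k = i \<or> k = j then A $$ (k, l) else 0) else 0)"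
    using assms by (intro sum.cong) (auto simp: sym_unit_def)
  also have "\<dots> = (\<Sum>k<n. if k = i then A $$ (i, j) else if k = j then A $$ (j, i) else 0)"
    using assms by (intro sum.cong refl, subst sum.delta) auto
  also have "\<dots> = (\<Sum>k\<in>{i,j}. if k = i then A $$ (i, j) else if k = j then A $$ (j, i) else 0)"
    using assms by (intro sum.mono_neutral_right) auto
  finally have "cmod (mat_trace (A * sym_unit n i j))
      \<le> (\<Sum>k\<in>{i,j}. cmod (if k = i then A $$ (i, j) else if k = j then A $$ (j, i) else 0))"
    by (simp only: norm_sum)
  also have "\<dots> \<le> (\<Sum>k\<in>{i,j}. c)"
    using assms by (intro sum_mono) (auto intro!: op_bounded_entry)
  also have "\<dots> \<le> 2 * c" using A by (cases "i = j") auto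
  finally show ?thesis .
qed

lemma cmod_scalar_prod_le:
  "cmod (\<Sum>i<dim_vec v. cnj (vec_index v i) * vec_index w i) \<le> vnorm v * vnorm w"
  if "dim_vec v = dim_vec w"
proof -
  have "cmod (\<Sum>i<dim_vec v. cnj (vec_index v i) * vec_index w i)
      \<le> (\<Sum>i<dim_vec v. \<bar>cmod (vec_index v i)\<bar> * \<bar>cmod (vec_index w i)\<bar>)"
    by (rule order.trans[OF norm_sum]) (simp add: norm_mult)
  also have "\<dots> \<le> vnorm v * vnorm w"
    unfolding vnorm_def that by (rule L2_set_mult_ineq)
  finally show ?thesis .
qed

definition shift_mat :: "real mat \<Rightarrow> complex \<Rightarrow> complex mat" where
  "shift_mat A z = map_mat complex_of_real A - z \<cdot>\<^sub>m 1\<^sub>m (dim_row A)"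

text \<open>The inverse by Cramer's rule. This form is defined for every \<open>z\<close> and makes
  the entries rational functions of the entries of \<open>A\<close>, from which measurability
  follows; the inverse identities require a nonzero determinant and come separately.\<close>

definition resolvent :: "real mat \<Rightarrow> complex \<Rightarrow> complex mat" where
  "resolvent A z = (1 / det (shift_mat A z)) \<cdot>\<^sub>m adj_mat (shift_mat A z)"

lemma shift_mat_carrier: "A \<in> carrier_mat n n \<Longrightarrow> shift_mat A z \<in> carrier_mat n n"
  by (auto simp: shift_mat_def)

lemma resolvent_carrier: "A \<in> carrier_mat n n \<Longrightarrow> resolvent A z \<in> carrier_mat n n"
  by (auto simp: resolvent_def adj_mat(1)[OF shift_mat_carrier])

definition sym_mat :: "'a mat \<Rightarrow> bool" where
  "sym_mat A \<longleftrightarrow> transpose_mat A = A"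

lemma sym_mat_index: "sym_mat A \<Longrightarrow> A \<in> carrier_mat n n \<Longrightarrow> i < n \<Longrightarrow> j < n \<Longrightarrow> A $$ (i, j) = A $$ (j, i)"
  unfolding sym_mat_def by (metis index_transpose_mat(1) carrier_matD)

text \<open>The quadratic form of a real symmetric matrix is real, so only the shift contributes to the
  imaginary part of \<open>\<langle>v, (A - z) v\<rangle>\<close>.\<close>

lemma shift_mat_lower_bound:
  assumes A: "A \<in> carrier_mat n n" "sym_mat A" and z: "Im z > 0" and v: "v \<in> carrier_vec n"
  shows "Im z * vnorm v \<le> vnorm (shift_mat A z *\<^sub>v v)"
proof -
  let ?w = "shift_mat A z *\<^sub>v v" and ?v = "\<lambda>i. vec_index v i"
  let ?q = "\<Sum>i<n. \<Sum>j<n. cnj (?v i) * complex_of_real (A $$ (i, j)) * ?v j"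
  have "cnj ?q = (\<Sum>i<n. \<Sum>j<n. ?v i * complex_of_real (A $$ (i, j)) * cnj (?v j))" by simp
  also have "\<dots> = (\<Sum>j<n. \<Sum>i<n. ?v i * complex_of_real (A $$ (i, j)) * cnj (?v j))"
    by (rule sum.swap)
  also have "\<dots> = ?q"
    using sym_mat_index[OF A(2,1)] by (intro sum.cong refl) (simp add: mult_ac)
  finally have "cnj ?q = ?q" .
  moreover have "cnj q = q \<Longrightarrow> Im q = 0" for q by (simp add: complex_eq_iff)
  ultimately have "Im ?q = 0" by blast
  have w: "vec_index ?w i = (\<Sum>j<n. complex_of_real (A $$ (i, j)) * ?v j) - z * ?v i" if "i < n" for i
  proof -
    have "vec_index ?w i = (\<Sum>j<n. shift_mat A z $$ (i, j) * ?v j)"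
      using that A v by (intro index_mult_mat_vec_sum[OF shift_mat_carrier[OF A(1)]])
    also have "\<dots> = (\<Sum>j<n. complex_of_real (A $$ (i, j)) * ?v j - (if j = i then z * ?v j else 0))"
      using A that by (intro sum.cong) (auto simp: shift_mat_def left_diff_distrib)
    finally show ?thesis using that by (simp add: sum_subtractf)
  qed
  have "(\<Sum>i<n. cnj (?v i) * vec_index ?w i) = (\<Sum>i<n. (\<Sum>j<n. cnj (?v i) * complex_of_real (A $$ (i, j)) * ?v j) - z * (cnj (?v i) * ?v i))"
    by (intro sum.cong refl) (simp add: w right_diff_distrib sum_distrib_left mult_ac)
  also have "\<dots> = ?q - z * (\<Sum>i<n. cnj (?v i) * ?v i)"
    by (simp add: sum_subtractf sum_distrib_left)
  also have "(\<Sum>i<n. cnj (?v i) * ?v i) = complex_of_real ((vnorm v)\<^sup>2)"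
    using v unfolding vnorm_square of_real_sum complex_norm_square by (simp only: carrier_vecD mult.commute)
  finally have eq: "(\<Sum>i<n. cnj (?v i) * vec_index ?w i) = ?q - z * complex_of_real ((vnorm v)\<^sup>2)" .
  have "Im z * (vnorm v)\<^sup>2 = \<bar>Im (\<Sum>i<n. cnj (?v i) * vec_index ?w i)\<bar>"
    using \<open>Im ?q = 0\<close> z unfolding eq by (simp add: abs_mult del: of_real_power)
  also have "\<dots> \<le> cmod (\<Sum>i<n. cnj (?v i) * vec_index ?w i)" by (rule abs_Im_le_cmod)
  also have "\<dots> \<le> vnorm v * vnorm ?w"
    using cmod_scalar_prod_le[of v ?w] v A by (auto simp: shift_mat_def)
  finally have "vnorm v * (Im z * vnorm v) \<le> vnorm v * vnorm ?w"
    by (simp add: power2_eq_square mult_ac)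
  then show ?thesis
    using vnorm_nonneg[of v] vnorm_nonneg[of ?w] by (cases "vnorm v = 0") (auto simp: mult_le_cancel_left)
qed

text \<open>A kernel vector would contradict the lower bound \<open>Im z * vnorm v\<close> for the
  norm of its image.\<close>

lemma det_shift_mat_nonzero:
  assumes A: "A \<in> carrier_mat n n" "sym_mat A" and z: "Im z > 0"
  shows "det (shift_mat A z) \<noteq> 0"
proof
  assume "det (shift_mat A z) = 0"
  then obtain v where v: "v \<in> carrier_vec n" "v \<noteq> 0\<^sub>v n" "shift_mat A z *\<^sub>v v = 0\<^sub>v n"
    using det_0_iff_vec_prod_zero[OF shift_mat_carrier[OF A(1)]] by blast
  have "vnorm v \<le> 0"
    using shift_mat_lower_bound[OF A z v(1)] z unfolding v(3)
    by (simp add: vnorm_def L2_set_def mult_le_0_iff)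
  then have "vec_index v i = 0" if "i < n" for i
    using cmod_index_le_vnorm[of i v] that v(1) by (auto dest: order.trans)
  then show False using v by (auto simp: vec_eq_iff)
qed

lemma resolvent_inverse:
  assumes A: "A \<in> carrier_mat n n" "sym_mat A" and z: "Im z > 0"
  shows "resolvent A z * shift_mat A z = 1\<^sub>m n" "shift_mat A z * resolvent A z = 1\<^sub>m n"
proof -
  note H = det_shift_mat_nonzero[OF assms] adj_mat[OF shift_mat_carrier[OF A(1), of z]]
    shift_mat_carrier[OF A(1), of z]
  show "resolvent A z * shift_mat A z = 1\<^sub>m n" "shift_mat A z * resolvent A z = 1\<^sub>m n"
    unfolding resolvent_def using H
    by (simp_all add: mult_smult_assoc_mat[of _ n n _ n] mult_smult_distrib[of _ n n _ n])
      (auto simp: mat_eq_iff)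
qed

text \<open>The lower bound for the shifted matrix is applied to
  \<open>resolvent A z *\<^sub>v v\<close>, whose image is \<open>v\<close>.\<close>

lemma op_bounded_resolvent:
  assumes A: "A \<in> carrier_mat n n" "sym_mat A" and z: "Im z > 0"
  shows "op_bounded n (1 / Im z) (resolvent A z)"
  unfolding op_bounded_def
proof (intro conjI ballI)
  fix v :: "complex Matrix.vec" assume v: "v \<in> carrier_vec n"
  have Rv: "resolvent A z *\<^sub>v v \<in> carrier_vec n"
    by (rule mult_mat_vec_carrier[OF resolvent_carrier[OF A(1)] v])
  have "shift_mat A z *\<^sub>v (resolvent A z *\<^sub>v v) = v"
    using assoc_mult_mat_vec[OF shift_mat_carrier[OF A(1)] resolvent_carrier[OF A(1)] v, of z z]
      resolvent_inverse(2)[OF assms] v by (metis one_mult_mat_vec)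
  then have "Im z * vnorm (resolvent A z *\<^sub>v v) \<le> vnorm v"
    using shift_mat_lower_bound[OF A z Rv] by simp
  then show "vnorm (resolvent A z *\<^sub>v v) \<le> 1 / Im z * vnorm v"
    using z by (simp add: field_simps)
next
  show "resolvent A z \<in> carrier_mat n n" by (rule resolvent_carrier[OF A(1)])
qed (use z in simp)

section \<open>Perturbation of the resolvent trace and spectral identities\<close>

text \<open>The second resolvent identity, obtained by inserting \<open>shift_mat B z\<close>
  between the two resolvents. With the resolvent of \<open>B\<close> on the left, iteration keeps it
  in front and produces only resolvents of \<open>A\<close> behind it.\<close>

lemma resolvent_perturb:
  assumes A: "A \<in> carrier_mat n n" "sym_mat A" and B: "B \<in> carrier_mat n n" "sym_mat B"
    and z: "Im z > 0" and E: "E \<in> carrier_mat n n"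
    and AB: "shift_mat B z = shift_mat A z + t \<cdot>\<^sub>m E"
  shows "resolvent A z = resolvent B z + t \<cdot>\<^sub>m (resolvent B z * (E * resolvent A z))"
proof -
  let ?R = "resolvent A z" and ?S = "resolvent B z" and ?H = "shift_mat A z"
  note c = resolvent_carrier[OF A(1), of z] resolvent_carrier[OF B(1), of z]
    shift_mat_carrier[OF A(1), of z] E
  have "?R = ?S * shift_mat B z * ?R"
    using resolvent_inverse(1)[OF B z] c by simp
  also have "\<dots> = ?S * ((?H + t \<cdot>\<^sub>m E) * ?R)"
    unfolding AB using c by (intro assoc_mult_mat[of _ n n _ n _ n]) auto
  also have "(?H + t \<cdot>\<^sub>m E) * ?R = 1\<^sub>m n + t \<cdot>\<^sub>m (E * ?R)"
    using c resolvent_inverse(2)[OF A z]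
    by (subst add_mult_distrib_mat[of _ n n _ _ n]) (auto simp: mult_smult_assoc_mat[of _ n n _ n])
  also have "?S * \<dots> = ?S + t \<cdot>\<^sub>m (?S * (E * ?R))"
    using c by (subst mult_add_distrib_mat[of _ n n _ n]) (auto simp: mult_smult_distrib[of _ n n _ n])
  finally show ?thesis .
qed

text \<open>With S the resolvent of \<open>B\<close>, iterating the resolvent identity gives tr S =
  tr R - t tr(R F) + t^2 tr(R F F) - t^3 tr(S F F F). The last two conclusions bound the same
  remainder: quadratically, by stopping one step earlier, for large \<open>t\<close>, and cubically
  for small \<open>t\<close>.\<close>

lemma resolvent_trace_taylor:
  assumes A: "A \<in> carrier_mat n n" "sym_mat A" and B: "B \<in> carrier_mat n n" "sym_mat B"
    and z: "Im z > 0" and ij: "i < n" "j < n"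
    and AB: "shift_mat B z = shift_mat A z + complex_of_real t \<cdot>\<^sub>m sym_unit n i j"
  defines "R \<equiv> resolvent A z" and "F \<equiv> sym_unit n i j * resolvent A z"
  shows "cmod (mat_trace (R * F)) \<le> 2 / Im z ^ 2"
    and "cmod (mat_trace (R * F * F)) \<le> 2 / Im z ^ 3"
    and "cmod (mat_trace (resolvent B z) - mat_trace R + complex_of_real t * mat_trace (R * F) - complex_of_real (t\<^sup>2) * mat_trace (R * F * F))
           \<le> 4 * t\<^sup>2 / Im z ^ 3"
    and "cmod (mat_trace (resolvent B z) - mat_trace R + complex_of_real t * mat_trace (R * F) - complex_of_real (t\<^sup>2) * mat_trace (R * F * F))
           \<le> 2 * \<bar>t\<bar> ^ 3 / Im z ^ 4"
proof -
  let ?S = "resolvent B z" and ?E = "sym_unit n i j" and ?v = "1 / Im z"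
  have c [simp]: "R \<in> carrier_mat n n" "?S \<in> carrier_mat n n" "F \<in> carrier_mat n n" "?E \<in> carrier_mat n n"
    using resolvent_carrier[OF A(1), of z] resolvent_carrier[OF B(1), of z]
    unfolding R_def F_def by (auto intro: mult_carrier_mat[OF sym_unit_carrier])
  have cm [simp]: "P * F \<in> carrier_mat n n" if "P \<in> carrier_mat n n" for P using that c(3) by auto
  have bR: "op_bounded n ?v R" unfolding R_def by (rule op_bounded_resolvent[OF A z])
  have bS: "op_bounded n ?v ?S" by (rule op_bounded_resolvent[OF B z])
  have bF: "op_bounded n ?v F"
    using op_bounded_mult[OF op_bounded_sym_unit[OF ij] bR] by (simp add: F_def R_def)
  \<comment> \<open>By cyclicity the trace of P E R is that of R P E, with the unit matrix last, so
    the dimension-free bound applies.\<close>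
  have tr: "cmod (mat_trace (P * F)) \<le> 2 * (?v * d)" if "op_bounded n d P" for P d
  proof -
    have P: "P \<in> carrier_mat n n" using that by (simp add: op_bounded_def)
    have "P * F = P * ?E * R" using P c unfolding F_def R_def by (metis assoc_mult_mat)
    then have "mat_trace (P * F) = mat_trace (R * (P * ?E))"
      using P by (metis c(1,4) mat_trace_mult_comm mult_carrier_mat)
    also have "R * (P * ?E) = R * P * ?E" using P c by (metis assoc_mult_mat)
    finally show ?thesis
      using cmod_trace_mult_sym_unit_le[OF op_bounded_mult[OF bR that] ij] by simp
  qed
  \<comment> \<open>The resolvent identity multiplied by \<open>Q\<close> under the trace; it is
    used for the identity matrix, \<open>F\<close> and \<open>F * F\<close>.\<close>
  have step: "mat_trace (R * Q) = mat_trace (?S * Q) + t * mat_trace (?S * F * Q)"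
    if Q: "Q \<in> carrier_mat n n" for Q
  proof -
    have "R = ?S + complex_of_real t \<cdot>\<^sub>m (?S * F)"
      unfolding R_def F_def by (rule resolvent_perturb[OF A B z c(4) AB])
    then have "R * Q = (?S + complex_of_real t \<cdot>\<^sub>m (?S * F)) * Q" by simp
    also have "\<dots> = ?S * Q + complex_of_real t \<cdot>\<^sub>m (?S * F * Q)"
      using c Q by (subst add_mult_distrib_mat[of _ n n _ _ n]) (auto simp: mult_smult_assoc_mat[of _ n n _ n])
    also have "mat_trace \<dots> = mat_trace (?S * Q) + t * mat_trace (?S * F * Q)"
      using mult_carrier_mat[OF c(2) Q] mult_carrier_mat[OF cm[OF c(2)] Q]
      by (simp add: mat_trace_add[of _ n] mat_trace_smult[of _ n])
    finally show ?thesis .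
  qed
  have s0: "mat_trace R = mat_trace ?S + t * mat_trace (?S * F)"
    using step[of "1\<^sub>m n"] right_mult_one_mat[OF cm[OF c(2)]] c(1,2) by simp
  have s1: "mat_trace (R * F) = mat_trace (?S * F) + t * mat_trace (?S * F * F)"
    using step[of F] c(3) by simp
  have s2: "mat_trace (R * F * F) = mat_trace (?S * F * F) + t * mat_trace (?S * F * F * F)"
    using step[of "F * F"] c by (simp add: assoc_mult_mat[of _ n n _ n _ n])
  let ?rem = "mat_trace ?S - mat_trace R + complex_of_real t * mat_trace (R * F) - complex_of_real (t\<^sup>2) * mat_trace (R * F * F)"
  \<comment> \<open>Eliminating the terms of order zero and one leaves a difference of two traces,
    each bounded independently of \<open>t\<close>.\<close>
  have r2: "?rem = complex_of_real (t\<^sup>2) * (mat_trace (?S * F * F) - mat_trace (R * F * F))"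
    using s0 s1 by (simp add: algebra_simps power2_eq_square)
  \<comment> \<open>One more use of the identity extracts a further factor \<open>t\<close> from
    that difference.\<close>
  have r3: "?rem = - (complex_of_real (t ^ 3) * mat_trace (?S * F * F * F))"
    unfolding r2 using s2 by (simp add: algebra_simps power2_eq_square power3_eq_cube)
  note b2 = tr[OF op_bounded_mult[OF bR bF]] tr[OF op_bounded_mult[OF bS bF]]
  show "cmod (mat_trace (R * F)) \<le> 2 / Im z ^ 2"
    using tr[OF bR] by (simp add: power2_eq_square)
  show b: "cmod (mat_trace (R * F * F)) \<le> 2 / Im z ^ 3"
    using b2(1) by (simp add: power3_eq_cube)
  have b': "cmod (mat_trace (?S * F * F)) \<le> 2 / Im z ^ 3"
    using b2(2) by (simp add: power3_eq_cube)
  have "cmod ?rem = t\<^sup>2 * cmod (mat_trace (?S * F * F) - mat_trace (R * F * F))"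
    unfolding r2 by (simp add: norm_mult norm_power)
  also have "\<dots> \<le> t\<^sup>2 * (2 / Im z ^ 3 + 2 / Im z ^ 3)"
    using b b' by (intro mult_left_mono order.trans[OF norm_triangle_ineq4] add_mono) auto
  finally show "cmod ?rem \<le> 4 * t\<^sup>2 / Im z ^ 3" by (simp add: mult.commute)
  have "cmod ?rem = \<bar>t\<bar> ^ 3 * cmod (mat_trace (?S * F * F * F))"
    unfolding r3 by (simp add: norm_mult norm_power)
  also have "\<dots> \<le> \<bar>t\<bar> ^ 3 * (2 / Im z ^ 4)"
    using tr[OF op_bounded_mult[OF op_bounded_mult[OF bS bF] bF]]
    by (intro mult_left_mono) (auto simp: eval_nat_numeral)
  finally show "cmod ?rem \<le> 2 * \<bar>t\<bar> ^ 3 / Im z ^ 4" by (simp add: mult.commute)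
qed

section \<open>Eigenvalues and traces through triangularisation\<close>

lemma upper_triangular_inverse_diag:
  fixes T :: "'a::field mat"
  assumes T: "T \<in> carrier_mat n n" "upper_triangular T" and U: "U \<in> carrier_mat n n"
    and TU: "T * U = 1\<^sub>m n" and nz: "\<And>i. i < n \<Longrightarrow> T $$ (i, i) \<noteq> 0" and i: "i < n"
  shows "U $$ (i, i) = 1 / T $$ (i, i)"
proof -
  have row: "(\<Sum>l\<in>{k..<n}. T $$ (k, l) * U $$ (l, j)) = of_bool (k = j)" if "k < n" "j < n" for k j
  proof -
    have "of_bool (k = j) = (T * U) $$ (k, j)" using that by (simp add: TU)
    also have "\<dots> = (\<Sum>l<n. T $$ (k, l) * U $$ (l, j))" by (rule index_mult_mat_sum[OF T(1) U that])
    also have "\<dots> = (\<Sum>l\<in>{k..<n}. T $$ (k, l) * U $$ (l, j))"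
      using T that by (intro sum.mono_neutral_right) (auto simp: upper_triangular_def)
    finally show ?thesis ..
  qed
  \<comment> \<open>\<open>U\<close> is upper triangular: induction on \<open>n - k\<close> climbs
    from the bottom row, each row using that the entries of column \<open>j\<close> below it
    vanish.\<close>
  have low: "U $$ (k, j) = 0" if "j < k" "k < n" for j k
    using that
  proof (induction "n - k" arbitrary: k rule: less_induct)
    case less
    have "(\<Sum>l\<in>{k..<n}. T $$ (k, l) * U $$ (l, j)) = T $$ (k, k) * U $$ (k, j)"
      using less by (subst sum.mono_neutral_right[of _ "{k}"]) auto
    then show ?case using row[of k j] nz[of k] less.prems by auto
  qed
  have "(\<Sum>l\<in>{i..<n}. T $$ (i, l) * U $$ (l, i)) = T $$ (i, i) * U $$ (i, i)"
    using i low by (subst sum.mono_neutral_right[of _ "{i}"]) auto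
  then show ?thesis using row[OF i i] nz[OF i] by (auto simp: field_simps)
qed

lemma upper_triangular_square_diag:
  fixes T :: "'a::field mat"
  assumes T: "T \<in> carrier_mat n n" "upper_triangular T" and i: "i < n"
  shows "(T * T) $$ (i, i) = (T $$ (i, i))\<^sup>2"
proof -
  have "(T * T) $$ (i, i) = (\<Sum>l<n. T $$ (i, l) * T $$ (l, i))"
    by (rule index_mult_mat_sum[OF T(1) T(1) i i])
  also have "\<dots> = (\<Sum>l\<in>{i}. T $$ (i, l) * T $$ (l, i))"
  proof (intro sum.mono_neutral_right ballI)
    fix l assume "l \<in> {..<n} - {i}"
    then show "T $$ (i, l) * T $$ (l, i) = 0"
      using T i by (cases "l < i") (auto simp: upper_triangular_def)
  qed (use i in auto)
  finally show ?thesis by (simp add: power2_eq_square)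
qed

text \<open>An eigenvector for a root in the open upper half plane would lie in the kernel of the
  shifted matrix. Roots of a real polynomial come in conjugate pairs, so the lower half plane is
  excluded as well.\<close>

lemma char_poly_root_real:
  fixes A :: "real mat"
  assumes A: "A \<in> carrier_mat n n" "sym_mat A"
    and r: "poly (char_poly (map_mat complex_of_real A)) w = 0"
  shows "w \<in> \<real>"
proof -
  have pos: False if "Im w > 0" and r: "poly (char_poly (map_mat complex_of_real A)) w = 0" for w
  proof -
    have "eigenvalue (map_mat complex_of_real A) w"
      using r A eigenvalue_root_char_poly[of "map_mat complex_of_real A" n w] by auto
    then obtain v where v: "v \<in> carrier_vec n" "v \<noteq> 0\<^sub>v n" "map_mat complex_of_real A *\<^sub>v v = w \<cdot>\<^sub>v v"
      using A unfolding eigenvalue_def eigenvector_def by auto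
    have "shift_mat A w *\<^sub>v v = map_mat complex_of_real A *\<^sub>v v - (w \<cdot>\<^sub>m 1\<^sub>m n) *\<^sub>v v"
      using A v unfolding shift_mat_def by (simp add: minus_mult_distrib_mat_vec[of _ n n])
    also have "\<dots> = 0\<^sub>v n" using v by (auto simp: vec_eq_iff v(3))
    finally have "det (shift_mat A w) = 0"
      using det_0_iff_vec_prod_zero[OF shift_mat_carrier[OF A(1)], of w] v by blast
    then show False using det_shift_mat_nonzero[OF A that(1)] by simp
  qed
  have "poly (char_poly (map_mat complex_of_real A)) (cnj w) = cnj (poly (char_poly (map_mat complex_of_real A)) w)"
    using A by (simp add: of_real_hom.char_poly_hom[of _ n] flip: poly_cnj_real)
  then have "\<not> Im w > 0" "\<not> Im (cnj w) > 0" using pos r by fastforce+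
  then show ?thesis by (simp add: complex_is_Real_iff)
qed

lemma map_poly_of_real_prod_list:
  "map_poly complex_of_real (prod_list ps) = prod_list (map (map_poly complex_of_real) ps)"
proof -
  interpret h: map_poly_inj_idom_hom complex_of_real ..
  show ?thesis by (rule h.hom_prod_list)
qed

lemma map_poly_of_real_inj: "map_poly complex_of_real p = map_poly complex_of_real q \<Longrightarrow> p = q"
  by (simp add: poly_eq_iff coeff_map_poly)

text \<open>Over the complex numbers the polynomial splits into \<open>n\<close> linear factors; all
  roots are real, so the factorisation is the image of a real one, and the embedding of polynomials
  is injective.\<close>

lemma char_poly_real_split:
  fixes A :: "real mat"
  assumes A: "A \<in> carrier_mat n n" "sym_mat A"
  obtains rs where "char_poly A = (\<Prod>r\<leftarrow>rs. [:- r, 1:])" "length rs = n"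
proof -
  let ?C = "map_mat complex_of_real A"
  obtain as where as: "char_poly ?C = (\<Prod>a\<leftarrow>as. [:- a, 1:])" "length as = n"
    using char_poly_factorized[of ?C n] A by auto
  have "poly (char_poly ?C) a = 0" if "a \<in> set as" for a
    using that unfolding as(1) by (induction as) auto
  then have "a \<in> \<real>" if "a \<in> set as" for a
    using char_poly_root_real[OF A] that by blast
  then have re: "as = map complex_of_real (map Re as)"
    by (auto simp: comp_def intro!: map_idI[symmetric])
  have "map_poly complex_of_real (char_poly A) = char_poly ?C"
    using A by (simp add: of_real_hom.char_poly_hom)
  also have "\<dots> = (\<Prod>a\<leftarrow>map complex_of_real (map Re as). [:- a, 1:])"
    unfolding as(1) using re by simp
  also have "\<dots> = map_poly complex_of_real (\<Prod>r\<leftarrow>map Re as. [:- r, 1:])"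
    by (simp add: map_poly_of_real_prod_list comp_def)
  finally have "char_poly A = (\<Prod>r\<leftarrow>map Re as. [:- r, 1:])"
    using map_poly_of_real_inj by blast
  then show thesis using that[of "map Re as"] as(2) by simp
qed

lemma proots_linear_factors: "proots (\<Prod>r\<leftarrow>rs. [:- r, 1:]) = mset (rs :: real list)"
proof (induction rs)
  case (Cons r rs)
  have "(\<Prod>r\<leftarrow>rs. [:- r, 1:]) \<noteq> 0" by (auto simp: prod_list_zero_iff)
  then show ?case using Cons by (simp add: proots_mult del: mult_pCons_left)
qed simp

text \<open>Full length is what gives \<open>sorted_eigenvalues A ! i\<close> a meaning for every
  \<open>i < n\<close>. It holds because the real polynomial splits completely, so its multiset of
  roots has \<open>n\<close> elements.\<close>

lemma sorted_eigenvalues_char_poly: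
  fixes A :: "real mat"
  assumes A: "A \<in> carrier_mat n n" "sym_mat A"
  shows "length (sorted_eigenvalues A) = n"
    and "char_poly A = (\<Prod>r\<leftarrow>sorted_eigenvalues A. [:- r, 1:])"
proof -
  obtain rs where rs: "char_poly A = (\<Prod>r\<leftarrow>rs. [:- r, 1:])" "length rs = n"
    using char_poly_real_split[OF A] .
  have m: "mset (sorted_eigenvalues A) = mset rs"
    by (simp add: sorted_eigenvalues_def rs(1) proots_linear_factors)
  then show "length (sorted_eigenvalues A) = n" using rs(2) by (metis size_mset)
  have "mset (map (\<lambda>r. [:- r, 1:]) (sorted_eigenvalues A)) = mset (map (\<lambda>r. [:- r, 1:]) rs)"
    using m by simp
  then show "char_poly A = (\<Prod>r\<leftarrow>sorted_eigenvalues A. [:- r, 1:])"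
    unfolding rs(1) by (metis prod_mset_prod_list)
qed

text \<open>Triangular form suffices because only traces are read off, and the Schur decomposition
  lets the diagonal be prescribed in sorted order.\<close>

lemma sorted_eigenvalues_triangularize:
  fixes A :: "real mat"
  assumes A: "A \<in> carrier_mat n n" "sym_mat A"
  obtains T P Q where "similar_mat_wit (map_mat complex_of_real A) T P Q" "upper_triangular T"
    "\<And>i. i < n \<Longrightarrow> T $$ (i, i) = complex_of_real (sorted_eigenvalues A ! i)"
proof -
  let ?C = "map_mat complex_of_real A" and ?es = "map complex_of_real (sorted_eigenvalues A)"
  have "char_poly ?C = map_poly complex_of_real (char_poly A)"
    using A by (simp add: of_real_hom.char_poly_hom)
  also have "\<dots> = (\<Prod>a\<leftarrow>?es. [:- a, 1:])"
    unfolding sorted_eigenvalues_char_poly(2)[OF A] by (simp add: map_poly_of_real_prod_list comp_def)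
  finally have cp: "char_poly ?C = (\<Prod>a\<leftarrow>?es. [:- a, 1:])" .
  obtain T P Q where "schur_decomposition ?C ?es = (T, P, Q)" by (metis surj_pair)
  from schur_decomposition[OF _ cp this, of n]
  have w: "similar_mat_wit ?C T P Q" "upper_triangular T" "diag_mat T = ?es" using A by auto
  have "T \<in> carrier_mat n n" using similar_mat_witD2(5)[OF _ w(1)] A by auto
  then have "T $$ (i, i) = complex_of_real (sorted_eigenvalues A ! i)" if "i < n" for i
    using that w(3) sorted_eigenvalues_char_poly(1)[OF A]
    by (auto simp: diag_mat_def list_eq_iff_nth_eq)
  then show thesis using that w by blast
qed

text \<open>The trace of the square is computed from the triangular diagonal and from the entries;
  symmetry turns \<open>A $$ (i, j) * A $$ (j, i)\<close> into a square.\<close>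

lemma sum_sorted_eigenvalues_square:
  fixes A :: "real mat"
  assumes A: "A \<in> carrier_mat n n" "sym_mat A"
  shows "(\<Sum>i<n. (sorted_eigenvalues A ! i)\<^sup>2) = (\<Sum>i<n. \<Sum>j<n. (A $$ (i, j))\<^sup>2)"
proof -
  let ?C = "map_mat complex_of_real A"
  obtain T P Q where w: "similar_mat_wit ?C T P Q" "upper_triangular T"
    "\<And>i. i < n \<Longrightarrow> T $$ (i, i) = complex_of_real (sorted_eigenvalues A ! i)"
    using sorted_eigenvalues_triangularize[OF A] by metis
  have C: "?C \<in> carrier_mat n n" using A by auto
  have T: "T \<in> carrier_mat n n" using similar_mat_witD2(5)[OF C w(1)] .
  have "mat_trace (?C * ?C) = mat_trace (T * T)"
    using similar_mat_wit_pow[OF w(1), of 2] C T by (intro mat_trace_similar) (simp add: numeral_2_eq_2)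
  also have "\<dots> = (\<Sum>i<n. (complex_of_real (sorted_eigenvalues A ! i))\<^sup>2)"
    using T upper_triangular_square_diag[OF T w(2)] w(3) by (simp add: mat_trace_def)
  finally have "mat_trace (?C * ?C) = complex_of_real (\<Sum>i<n. (sorted_eigenvalues A ! i)\<^sup>2)" by simp
  moreover have "mat_trace (?C * ?C) = complex_of_real (\<Sum>i<n. \<Sum>j<n. (A $$ (i, j))\<^sup>2)"
    unfolding mat_trace_mult[OF C C] using sym_mat_index[OF A(2,1)] A(1)
    by (auto simp: power2_eq_square intro!: sum.cong)
  ultimately show ?thesis by (metis of_real_eq_iff)
qed

text \<open>Conjugation by \<open>P\<close> turns the shifted matrix into the triangular
  \<open>S\<close>; the conjugated resolvent \<open>U\<close> inverts \<open>S\<close>, so its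
  diagonal consists of reciprocals, and conjugation preserves the trace.\<close>

lemma trace_resolvent_eigenvalues:
  assumes A: "A \<in> carrier_mat n n" "sym_mat A" and z: "Im z > 0"
  shows "mat_trace (resolvent A z) = (\<Sum>i<n. 1 / (complex_of_real (sorted_eigenvalues A ! i) - z))"
proof -
  let ?C = "map_mat complex_of_real A" and ?R = "resolvent A z" and ?H = "shift_mat A z"
  obtain T P Q where w: "similar_mat_wit ?C T P Q" "upper_triangular T"
    "\<And>i. i < n \<Longrightarrow> T $$ (i, i) = complex_of_real (sorted_eigenvalues A ! i)"
    using sorted_eigenvalues_triangularize[OF A] by metis
  have C: "?C \<in> carrier_mat n n" using A by auto
  note D = similar_mat_witD2[OF C w(1)]
  note R = resolvent_carrier[OF A(1), of z] and H = shift_mat_carrier[OF A(1), of z]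
  define S where "S = T - z \<cdot>\<^sub>m 1\<^sub>m n"
  have S: "S \<in> carrier_mat n n" "upper_triangular S"
    using D(5) w(2) by (auto simp: S_def upper_triangular_def)
  have Si: "S $$ (i, i) = complex_of_real (sorted_eigenvalues A ! i) - z" if "i < n" for i
    using w(3)[OF that] D(5) that by (simp add: S_def)
  have nz: "S $$ (i, i) \<noteq> 0" if "i < n" for i
    using z unfolding Si[OF that] by (auto simp: complex_eq_iff)
  have "P * S = ?H * P"
  proof -
    have "P * S = P * T - P * (z \<cdot>\<^sub>m 1\<^sub>m n)"
      unfolding S_def using D(4-7) by (intro mult_minus_distrib_mat) auto
    also have "P * T = ?C * P"
    proof -
      have "?C * P = P * T * (Q * P)"
        unfolding D(3) using D(4-7) by (intro assoc_mult_mat) auto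
      then show ?thesis using D(1,2,4-7) by simp
    qed
    also have "P * (z \<cdot>\<^sub>m 1\<^sub>m n) = (z \<cdot>\<^sub>m 1\<^sub>m n) * P"
      using D(6) by (simp add: mult_smult_distrib[of _ n n _ n] mult_smult_assoc_mat[of _ n n _ n])
    also have "?C * P - (z \<cdot>\<^sub>m 1\<^sub>m n) * P = (?C - z \<cdot>\<^sub>m 1\<^sub>m n) * P"
      using D(6) C by (intro minus_mult_distrib_mat[symmetric]) auto
    also have "?C - z \<cdot>\<^sub>m 1\<^sub>m n = ?H" using A by (simp add: shift_mat_def)
    finally show ?thesis .
  qed
  define U where "U = Q * ?R * P"
  have U: "U \<in> carrier_mat n n" unfolding U_def using D(5-7) R by auto
  have "U * S = Q * ?R * (P * S)" unfolding U_def using D(5-7) R S by (intro assoc_mult_mat) auto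
  also have "\<dots> = Q * ?R * ?H * P" unfolding \<open>P * S = ?H * P\<close> using D(5-7) R H by (intro assoc_mult_mat[symmetric]) auto
  also have "Q * ?R * ?H = Q" using D(5-7) R H resolvent_inverse(1)[OF A z] by (simp add: assoc_mult_mat[of _ n n _ n _ n])
  finally have "U * S = 1\<^sub>m n" using D(1,2,4-7) by simp
  then have SU: "S * U = 1\<^sub>m n" by (rule mat_mult_left_right_inverse[OF U S(1)])
  have "mat_trace U = mat_trace (P * (Q * ?R))"
    unfolding U_def using D(5-7) R by (intro mat_trace_mult_comm[of _ n n]) auto
  also have "P * (Q * ?R) = P * Q * ?R" using D(5-7) R by (intro assoc_mult_mat[symmetric]) auto
  finally have "mat_trace ?R = mat_trace U" using D(1) R by simp
  also have "\<dots> = (\<Sum>i<n. U $$ (i, i))" using U by (simp add: mat_trace_def)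
  also have "\<dots> = (\<Sum>i<n. 1 / (complex_of_real (sorted_eigenvalues A ! i) - z))"
    using upper_triangular_inverse_diag[OF S U SU nz] Si by (intro sum.cong) auto
  finally show ?thesis .
qed

section \<open>Matrices built from arrays\<close>

definition mat_measurable :: "'b measure \<Rightarrow> nat \<Rightarrow> ('b \<Rightarrow> complex mat) \<Rightarrow> bool" where
  "mat_measurable N n A \<longleftrightarrow> (\<forall>w. A w \<in> carrier_mat n n) \<and>
     (\<forall>i<n. \<forall>j<n. (\<lambda>w. A w $$ (i, j)) \<in> borel_measurable N)"

lemma mat_measurable_det:
  assumes "mat_measurable N n A"
  shows "(\<lambda>w. det (A w)) \<in> borel_measurable N"
proof -
  have "A w \<in> carrier_mat n n" for w using assms by (simp add: mat_measurable_def)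
  then have "det (A w) = (\<Sum>p\<in>{p. p permutes {0..<n}}. signof p * (\<Prod>i = 0..<n. A w $$ (i, p i)))" for w
    by (rule det_def')
  moreover have "(\<lambda>w. A w $$ (i, p i)) \<in> borel_measurable N" if "p permutes {0..<n}" "i \<in> {0..<n}" for p i
    using assms that permutes_in_image[OF that(1), of i] by (auto simp: mat_measurable_def)
  ultimately show ?thesis
    by (subst measurable_cong)
      (auto intro!: borel_measurable_sum borel_measurable_times borel_measurable_prod)
qed

lemma mat_measurable_mult:
  assumes "mat_measurable N n A" "mat_measurable N n B"
  shows "mat_measurable N n (\<lambda>w. A w * B w)"
  unfolding mat_measurable_def
proof (intro conjI allI impI)
  have c: "A w \<in> carrier_mat n n" "B w \<in> carrier_mat n n" for w
    using assms by (auto simp: mat_measurable_def)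
  show "A w * B w \<in> carrier_mat n n" for w using c[of w] by (rule mult_carrier_mat)
  fix i j assume ij: "i < n" "j < n"
  show "(\<lambda>w. (A w * B w) $$ (i, j)) \<in> borel_measurable N"
    unfolding index_mult_mat_sum[OF c ij] using assms ij
    by (intro borel_measurable_sum borel_measurable_times) (auto simp: mat_measurable_def)
qed

lemma mat_measurable_smult:
  assumes "f \<in> borel_measurable N" "mat_measurable N n A"
  shows "mat_measurable N n (\<lambda>w. f w \<cdot>\<^sub>m A w)"
  unfolding mat_measurable_def
proof (intro conjI allI impI)
  have c: "A w \<in> carrier_mat n n" for w using assms by (auto simp: mat_measurable_def)
  show "f w \<cdot>\<^sub>m A w \<in> carrier_mat n n" for w using c by auto
  fix i j assume ij: "i < n" "j < n"
  then have "(f w \<cdot>\<^sub>m A w) $$ (i, j) = f w * A w $$ (i, j)" for w using c[of w] by auto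
  then show "(\<lambda>w. (f w \<cdot>\<^sub>m A w) $$ (i, j)) \<in> borel_measurable N"
    using assms ij by (auto simp: mat_measurable_def intro!: borel_measurable_times)
qed

lemma mat_measurable_trace:
  assumes "mat_measurable N n A"
  shows "(\<lambda>w. mat_trace (A w)) \<in> borel_measurable N"
proof -
  have "mat_trace (A w) = (\<Sum>i<n. A w $$ (i, i))" for w
    using assms by (auto simp: mat_measurable_def mat_trace_def)
  then show ?thesis using assms by (auto simp: mat_measurable_def intro!: borel_measurable_sum)
qed

lemma mat_measurable_adj_mat:
  assumes "mat_measurable N n A"
  shows "mat_measurable N n (\<lambda>w. adj_mat (A w))"
  unfolding mat_measurable_def
proof (intro conjI allI impI)
  have c: "A w \<in> carrier_mat n n" for w using assms by (auto simp: mat_measurable_def)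
  show "adj_mat (A w) \<in> carrier_mat n n" for w by (rule adj_mat(1)[OF c])
  fix i j assume ij: "i < n" "j < n"
  have del: "mat_measurable N (n - 1) (\<lambda>w. mat_delete (A w) j i)"
    unfolding mat_measurable_def
  proof (intro conjI allI impI)
    show "mat_delete (A w) j i \<in> carrier_mat (n - 1) (n - 1)" for w by (rule mat_delete_carrier[OF c])
    fix k l assume kl: "k < n - 1" "l < n - 1"
    have "mat_delete (A w) j i $$ (k, l) = A w $$ (if k < j then k else Suc k, if l < i then l else Suc l)" for w
      using c[of w] kl by (auto simp: mat_delete_def)
    then show "(\<lambda>w. mat_delete (A w) j i $$ (k, l)) \<in> borel_measurable N"
      using assms kl ij by (auto simp: mat_measurable_def)
  qed
  have "adj_mat (A w) $$ (i, j) = (-1) ^ (j + i) * det (mat_delete (A w) j i)" for w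
    using c[of w] ij by (auto simp: adj_mat_def cofactor_def)
  then show "(\<lambda>w. adj_mat (A w) $$ (i, j)) \<in> borel_measurable N"
    using mat_measurable_det[OF del] by simp
qed

text \<open>\<open>z\<close> may vary with the sample point: joint measurability in the outcome and
  the real part of \<open>z\<close> is what Fubini will ask for. Cramer's rule reduces the claim to
  determinants, which are polynomials in the entries.\<close>

lemma mat_measurable_resolvent:
  fixes A :: "'b \<Rightarrow> real mat"
  assumes A: "\<And>w. A w \<in> carrier_mat n n"
    "\<And>i j. i < n \<Longrightarrow> j < n \<Longrightarrow> (\<lambda>w. A w $$ (i, j)) \<in> borel_measurable N"
    and z: "z \<in> borel_measurable N"
  shows "mat_measurable N n (\<lambda>w. resolvent (A w) (z w))"
proof -
  have H: "mat_measurable N n (\<lambda>w. shift_mat (A w) (z w))"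
    unfolding mat_measurable_def
  proof (intro conjI allI impI)
    show "shift_mat (A w) (z w) \<in> carrier_mat n n" for w by (rule shift_mat_carrier[OF A(1)])
    fix i j assume ij: "i < n" "j < n"
    have "shift_mat (A w) (z w) $$ (i, j) = complex_of_real (A w $$ (i, j)) - z w * of_bool (i = j)" for w
      using A(1)[of w] ij by (auto simp: shift_mat_def)
    then show "(\<lambda>w. shift_mat (A w) (z w) $$ (i, j)) \<in> borel_measurable N"
      using A(2)[OF ij] z by simp
  qed
  show ?thesis unfolding resolvent_def
    by (intro mat_measurable_smult mat_measurable_adj_mat[OF H] borel_measurable_divide
        mat_measurable_det[OF H]) auto
qed

section \<open>Symmetric arrays and the expansion in one entry\<close>

definition scaled_matrix :: "nat \<Rightarrow> (nat \<times> nat \<Rightarrow> real) \<Rightarrow> real mat" where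
  "scaled_matrix n a = (1 / sqrt (real n)) \<cdot>\<^sub>m arr_matrix n a"

text \<open>Only entries on or above the diagonal are read, so every \<open>b\<close> yields a
  symmetric matrix, and updating \<open>b\<close> at one upper pair changes both mirror positions at
  once.\<close>

definition sym_array :: "(nat \<times> nat \<Rightarrow> real) \<Rightarrow> nat \<times> nat \<Rightarrow> real" where
  "sym_array b = (\<lambda>(i, j). b (min i j, max i j))"

text \<open>Up to the factor \<open>\<pi>\<close>, the Poisson smoothing of the empirical spectral distribution, at
  \<open>Re z\<close> with width \<open>Im z\<close>.\<close>

definition poisson_trace :: "nat \<Rightarrow> complex \<Rightarrow> (nat \<times> nat \<Rightarrow> real) \<Rightarrow> real" where
  "poisson_trace n z a = Im (mat_trace (resolvent (scaled_matrix n a) z)) / real n"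

lemma scaled_matrix_carrier [simp]: "scaled_matrix n a \<in> carrier_mat n n"
  by (simp add: scaled_matrix_def arr_matrix_def)

lemma scaled_matrix_index:
  "i < n \<Longrightarrow> j < n \<Longrightarrow> scaled_matrix n a $$ (i, j) = a (Suc i, Suc j) / sqrt (real n)"
  by (simp add: scaled_matrix_def arr_matrix_def)

lemma sym_mat_scaled_matrix:
  assumes "\<And>i j. i \<in> {1..n} \<Longrightarrow> j \<in> {1..n} \<Longrightarrow> a (i, j) = a (j, i)"
  shows "sym_mat (scaled_matrix n a)"
  unfolding sym_mat_def
  by (rule eq_matI) (auto simp: scaled_matrix_index assms carrier_matD[OF scaled_matrix_carrier])

lemma sym_mat_sym_array: "sym_mat (scaled_matrix n (sym_array b))"
  by (intro sym_mat_scaled_matrix) (auto simp: sym_array_def min.commute max.commute)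

text \<open>This brings a one-entry update to the form of the resolvent expansion. The base point
  has 0 at \<open>(i, j)\<close>, so coefficients taken there do not depend on the entry being
  swapped. Arrays count from 1 and matrices from 0, hence \<open>i - 1\<close> and
  \<open>j - 1\<close>.\<close>

lemma shift_mat_update:
  assumes ij: "1 \<le> i" "i \<le> j" "j \<le> n"
  shows "shift_mat (scaled_matrix n (sym_array (b((i, j) := x)))) z =
    shift_mat (scaled_matrix n (sym_array (b((i, j) := 0)))) z
      + complex_of_real (x / sqrt (real n)) \<cdot>\<^sub>m sym_unit n (i - 1) (j - 1)"
proof (rule eq_matI)
  have d: "dim_row (scaled_matrix n a) = n" "dim_col (scaled_matrix n a) = n" for a
    using scaled_matrix_carrier[of n a] by (simp_all only: carrier_matD)
  fix k l
  assume "k < dim_row (shift_mat (scaled_matrix n (sym_array (b((i, j) := 0)))) z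
      + complex_of_real (x / sqrt (real n)) \<cdot>\<^sub>m sym_unit n (i - 1) (j - 1))"
    "l < dim_col (shift_mat (scaled_matrix n (sym_array (b((i, j) := 0)))) z
      + complex_of_real (x / sqrt (real n)) \<cdot>\<^sub>m sym_unit n (i - 1) (j - 1))"
  then have kl: "k < n" "l < n" by (auto simp: sym_unit_def)
  have "(min (Suc k) (Suc l) = i \<and> max (Suc k) (Suc l) = j) \<longleftrightarrow>
      (k = i - 1 \<and> l = j - 1) \<or> (k = j - 1 \<and> l = i - 1)"
    using ij by (auto simp: min_def max_def)
  then show "shift_mat (scaled_matrix n (sym_array (b((i, j) := x)))) z $$ (k, l) =
    (shift_mat (scaled_matrix n (sym_array (b((i, j) := 0)))) z
      + complex_of_real (x / sqrt (real n)) \<cdot>\<^sub>m sym_unit n (i - 1) (j - 1)) $$ (k, l)"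
    using kl by (auto simp: shift_mat_def d scaled_matrix_index sym_array_def sym_unit_def)
qed (auto simp: shift_mat_def sym_unit_def scaled_matrix_def arr_matrix_def)

text \<open>The coefficient of \<open>x\<close> when the entry at \<open>p\<close> goes from 0 to
  \<open>x\<close>: the matrix moves by \<open>x / sqrt n\<close>, the trace is divided by
  \<open>n\<close>, and the linear term of the expansion has a minus sign. Likewise
  \<open>poisson_d2\<close> is the full coefficient of the square, so no factor 1/2 appears.\<close>

definition poisson_d1 :: "nat \<Rightarrow> complex \<Rightarrow> nat \<times> nat \<Rightarrow> (nat \<times> nat \<Rightarrow> real) \<Rightarrow> real" where
  "poisson_d1 n z p a = (let R = resolvent (scaled_matrix n a) z; F = sym_unit n (fst p - 1) (snd p - 1) * R
     in - Im (mat_trace (R * F)) / (real n * sqrt (real n)))"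

definition poisson_d2 :: "nat \<Rightarrow> complex \<Rightarrow> nat \<times> nat \<Rightarrow> (nat \<times> nat \<Rightarrow> real) \<Rightarrow> real" where
  "poisson_d2 n z p a = (let R = resolvent (scaled_matrix n a) z; F = sym_unit n (fst p - 1) (snd p - 1) * R
     in Im (mat_trace (R * F * F)) / (real n)\<^sup>2)"

lemma poisson_trace_measurable:
  assumes a: "\<And>i j. i \<in> {1..n} \<Longrightarrow> j \<in> {1..n} \<Longrightarrow> (\<lambda>w. a w (i, j)) \<in> borel_measurable N"
    and z: "z \<in> borel_measurable N"
  shows "(\<lambda>w. poisson_trace n (z w) (a w)) \<in> borel_measurable N"
    and "(\<lambda>w. poisson_d1 n (z w) p (a w)) \<in> borel_measurable N"
    and "(\<lambda>w. poisson_d2 n (z w) p (a w)) \<in> borel_measurable N"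
proof -
  have R: "mat_measurable N n (\<lambda>w. resolvent (scaled_matrix n (a w)) (z w))"
    using z by (intro mat_measurable_resolvent) (auto simp: scaled_matrix_index intro!: a borel_measurable_divide)
  have E: "mat_measurable N n (\<lambda>w. sym_unit n (fst p - 1) (snd p - 1))"
    by (auto simp: mat_measurable_def)
  note F = mat_measurable_mult[OF E R]
  note T = mat_measurable_trace[OF R] mat_measurable_trace[OF mat_measurable_mult[OF R F]]
    mat_measurable_trace[OF mat_measurable_mult[OF mat_measurable_mult[OF R F] F]]
  have Im: "(\<lambda>w. Im (f w)) \<in> borel_measurable N" if "f \<in> borel_measurable N" for f
    using that by measurable
  show "(\<lambda>w. poisson_trace n (z w) (a w)) \<in> borel_measurable N"
    "(\<lambda>w. poisson_d1 n (z w) p (a w)) \<in> borel_measurable N"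
    "(\<lambda>w. poisson_d2 n (z w) p (a w)) \<in> borel_measurable N"
    unfolding poisson_trace_def poisson_d1_def poisson_d2_def Let_def
    by (intro borel_measurable_divide borel_measurable_uminus Im T borel_measurable_const)+
qed

lemma abs_poisson_trace_le:
  assumes "0 < n" "Im z > 0" "\<And>i j. i \<in> {1..n} \<Longrightarrow> j \<in> {1..n} \<Longrightarrow> a (i, j) = a (j, i)"
  shows "\<bar>poisson_trace n z a\<bar> \<le> 1 / Im z"
proof -
  let ?R = "resolvent (scaled_matrix n a) z"
  have b: "op_bounded n (1 / Im z) ?R"
    using assms by (intro op_bounded_resolvent sym_mat_scaled_matrix) auto
  then have "mat_trace ?R = (\<Sum>i<n. ?R $$ (i, i))" by (auto simp: op_bounded_def mat_trace_def)
  then have "\<bar>Im (mat_trace ?R)\<bar> \<le> cmod (\<Sum>i<n. ?R $$ (i, i))" by (metis abs_Im_le_cmod)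
  also have "\<dots> \<le> (\<Sum>i<n. cmod (?R $$ (i, i)))" by (rule norm_sum)
  also have "\<dots> \<le> (\<Sum>i<n. 1 / Im z)" using op_bounded_entry[OF b] by (intro sum_mono) auto
  finally show ?thesis using assms(1,2) by (simp add: poisson_trace_def field_simps)
qed

text \<open>From the threshold on the quadratic remainder bound is used, below it the cubic one,
  where \<open>|x| / sqrt n\<close> is at most \<open>\<tau>\<close>. Of the factor 1 / n^2, one
  power comes from the normalised trace and one from the square of
  \<open>x / sqrt n\<close>.\<close>

lemma poisson_trace_taylor:
  fixes b :: "nat \<times> nat \<Rightarrow> real"
  assumes ij: "1 \<le> i" "i \<le> j" "j \<le> n" and z: "Im z > 0" and \<tau>: "\<tau> > 0"
  defines "a \<equiv> sym_array (b((i, j) := 0))"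
  shows "\<bar>poisson_d1 n z (i, j) a\<bar> \<le> 2 / (real n * sqrt (real n) * Im z ^ 2)"
    and "\<bar>poisson_d2 n z (i, j) a\<bar> \<le> 2 / ((real n)\<^sup>2 * Im z ^ 3)"
    and "\<bar>poisson_trace n z (sym_array (b((i, j) := x))) - poisson_trace n z a
           - x * poisson_d1 n z (i, j) a - x\<^sup>2 * poisson_d2 n z (i, j) a\<bar>
         \<le> (2 * \<tau> / Im z ^ 4 * x\<^sup>2 + 4 / Im z ^ 3 * (x\<^sup>2 * of_bool (\<bar>x\<bar> \<ge> \<tau> * sqrt (real n)))) / (real n)\<^sup>2"
proof -
  have n: "0 < n" using ij by simp
  let ?t = "x / sqrt (real n)" and ?v = "Im z"
  let ?R = "resolvent (scaled_matrix n a) z" and ?S = "resolvent (scaled_matrix n (sym_array (b((i, j) := x)))) z"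
  let ?F = "sym_unit n (i - 1) (j - 1) * ?R"
  have ij': "i - 1 < n" "j - 1 < n" using ij by auto
  note T = resolvent_trace_taylor[OF scaled_matrix_carrier sym_mat_sym_array[of n "b((i, j) := 0)"]
      scaled_matrix_carrier sym_mat_sym_array[of n "b((i, j) := x)"] z ij' shift_mat_update[OF ij], folded a_def]
  show "\<bar>poisson_d1 n z (i, j) a\<bar> \<le> 2 / (real n * sqrt (real n) * ?v ^ 2)"
    using divide_right_mono[OF order.trans[OF abs_Im_le_cmod T(1)], of "real n * sqrt (real n)"] n
    by (simp add: poisson_d1_def Let_def abs_mult mult_ac)
  show "\<bar>poisson_d2 n z (i, j) a\<bar> \<le> 2 / ((real n)\<^sup>2 * ?v ^ 3)"
    using divide_right_mono[OF order.trans[OF abs_Im_le_cmod T(2)], of "(real n)\<^sup>2"] n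
    by (simp add: poisson_d2_def Let_def mult_ac)
  define W where "W = mat_trace ?S - mat_trace ?R + complex_of_real ?t * mat_trace (?R * ?F)
      - complex_of_real (?t\<^sup>2) * mat_trace (?R * ?F * ?F)"
  have t2: "?t\<^sup>2 = x\<^sup>2 / real n" using n by (simp add: power_divide)
  have "Im W = Im (mat_trace ?S) - Im (mat_trace ?R) + ?t * Im (mat_trace (?R * ?F)) - ?t\<^sup>2 * Im (mat_trace (?R * ?F * ?F))"
    unfolding W_def by (simp del: of_real_power of_real_divide)
  then have "poisson_trace n z (sym_array (b((i, j) := x))) - poisson_trace n z a
           - x * poisson_d1 n z (i, j) a - x\<^sup>2 * poisson_d2 n z (i, j) a = Im W / real n" (is "?D = _")
    unfolding t2 using n
    by (simp add: poisson_trace_def poisson_d1_def poisson_d2_def Let_def diff_divide_distrib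
        add_divide_distrib power2_eq_square mult_ac)
  then have D: "\<bar>?D\<bar> \<le> cmod W / real n" using n abs_Im_le_cmod[of W] by (simp add: divide_right_mono)
  have W2: "cmod W \<le> 4 * ?t\<^sup>2 / ?v ^ 3" and W3: "cmod W \<le> 2 * \<bar>?t\<bar> ^ 3 / ?v ^ 4"
    using T(3,4) unfolding W_def by auto
  show "\<bar>?D\<bar> \<le> (2 * \<tau> / ?v ^ 4 * x\<^sup>2 + 4 / ?v ^ 3 * (x\<^sup>2 * of_bool (\<bar>x\<bar> \<ge> \<tau> * sqrt (real n)))) / (real n)\<^sup>2"
  proof (cases "\<bar>x\<bar> \<ge> \<tau> * sqrt (real n)")
    case True
    have "\<bar>?D\<bar> \<le> (4 * (x\<^sup>2 / real n) / ?v ^ 3) / real n"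
      using D W2 n unfolding t2 by (meson divide_right_mono of_nat_0_le_iff order_trans)
    also have "\<dots> = 4 / ?v ^ 3 * x\<^sup>2 / (real n)\<^sup>2" by (simp add: power2_eq_square)
    also have "\<dots> \<le> (2 * \<tau> / ?v ^ 4 * x\<^sup>2 + 4 / ?v ^ 3 * x\<^sup>2) / (real n)\<^sup>2"
      using \<tau> z by (intro divide_right_mono) auto
    finally show ?thesis using True by simp
  next
    case False
    then have "\<bar>?t\<bar> \<le> \<tau>" using n by (simp add: field_simps)
    \<comment> \<open>One factor of the cube is spent on \<open>\<tau>\<close>, so that only a
      second moment remains.\<close>
    then have "\<bar>?t\<bar> ^ 3 \<le> \<tau> * (x\<^sup>2 / real n)"
      unfolding t2[symmetric] power3_eq_cube power2_eq_square
      using mult_right_mono[OF \<open>\<bar>?t\<bar> \<le> \<tau>\<close>, of "\<bar>?t\<bar> * \<bar>?t\<bar>"] by (simp add: mult_ac)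
    then have "2 * \<bar>?t\<bar> ^ 3 / ?v ^ 4 \<le> 2 * (\<tau> * (x\<^sup>2 / real n)) / ?v ^ 4"
      using z by (intro divide_right_mono) auto
    then have "\<bar>?D\<bar> \<le> (2 * (\<tau> * (x\<^sup>2 / real n)) / ?v ^ 4) / real n"
      using D W3 n by (meson divide_right_mono of_nat_0_le_iff order_trans)
    then show ?thesis using False by (simp add: power2_eq_square mult_ac)
  qed
qed

section \<open>Lindeberg replacement for balanced arrays\<close>

lemma integrable_bounded_mult:
  fixes f g :: "'a \<Rightarrow> real"
  assumes "integrable M f" "g \<in> borel_measurable M" "\<And>x. \<bar>g x\<bar> \<le> B"
  shows "integrable M (\<lambda>x. f x * g x)"
proof (rule Bochner_Integration.integrable_bound[of M "\<lambda>x. B * f x"])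
  show "AE x in M. norm (f x * g x) \<le> norm (B * f x)"
  proof (intro AE_I2)
    fix x
    have "0 \<le> B" using assms(3)[of x] by linarith
    then show "norm (f x * g x) \<le> norm (B * f x)"
      using mult_left_mono[OF assms(3)[of x], of "\<bar>f x\<bar>"] by (simp add: abs_mult mult.commute)
  qed
qed (use assms in auto)

text \<open>A nonintegrable function has integral 0 by convention, and any point of the nonempty
  space gives \<open>0 \<le> c\<close>; so that case is covered too, and inner integrals in Fubini
  arguments call for no separate integrability proof.\<close>

lemma (in prob_space) abs_expectation_le:
  fixes f :: "'a \<Rightarrow> real"
  assumes "\<And>x. x \<in> space M \<Longrightarrow> \<bar>f x\<bar> \<le> c"
  shows "\<bar>expectation f\<bar> \<le> c"
proof (cases "integrable M f")
  case True
  have "\<bar>expectation f\<bar> \<le> expectation (\<lambda>x. \<bar>f x\<bar>)" by (rule integral_abs_bound)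
  also have "\<dots> \<le> expectation (\<lambda>x. c)" using True assms by (intro integral_mono) auto
  finally show ?thesis by (simp add: prob_space)
next
  case False
  obtain x where "x \<in> space M" using not_empty by auto
  then show ?thesis using False assms[of x] by (simp add: not_integrable_integral_eq)
qed

lemma (in prob_space) indep_var_expectation_bound:
  fixes f :: "'b \<Rightarrow> 'b \<Rightarrow> real"
  assumes ind: "indep_var S U T V" and f: "case_prod f \<in> borel_measurable (S \<Otimes>\<^sub>M T)"
    and int: "integrable M (\<lambda>\<omega>. f (U \<omega>) (V \<omega>))"
  shows "(\<And>y. y \<in> space T \<Longrightarrow> \<bar>expectation (\<lambda>\<omega>. f (U \<omega>) y)\<bar> \<le> c) \<Longrightarrow> \<bar>expectation (\<lambda>\<omega>. f (U \<omega>) (V \<omega>))\<bar> \<le> c"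
    and "(\<And>x. x \<in> space S \<Longrightarrow> \<bar>expectation (\<lambda>\<omega>. f x (V \<omega>))\<bar> \<le> c) \<Longrightarrow> \<bar>expectation (\<lambda>\<omega>. f (U \<omega>) (V \<omega>))\<bar> \<le> c"
proof -
  have rv [measurable]: "random_variable S U" "random_variable T V"
    and eq: "distr M S U \<Otimes>\<^sub>M distr M T V = distr M (S \<Otimes>\<^sub>M T) (\<lambda>x. (U x, V x))"
    using ind unfolding indep_var_distribution_eq by auto
  interpret DU: prob_space "distr M S U" by (rule prob_space_distr) (rule rv)
  interpret DV: prob_space "distr M T V" by (rule prob_space_distr) (rule rv)
  interpret DD: pair_sigma_finite "distr M S U" "distr M T V" ..
  note [measurable] = f
  have E: "expectation (\<lambda>\<omega>. f (U \<omega>) (V \<omega>)) = (\<integral>w. case_prod f w \<partial>(distr M S U \<Otimes>\<^sub>M distr M T V))"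
    unfolding eq by (subst integral_distr) auto
  have i: "integrable (distr M S U \<Otimes>\<^sub>M distr M T V) (case_prod f)"
    unfolding eq using int by (subst integrable_distr_eq) auto
  show "\<bar>expectation (\<lambda>\<omega>. f (U \<omega>) (V \<omega>))\<bar> \<le> c"
    if *: "\<And>y. y \<in> space T \<Longrightarrow> \<bar>expectation (\<lambda>\<omega>. f (U \<omega>) y)\<bar> \<le> c"
  proof -
    have "(\<integral>w. case_prod f w \<partial>(distr M S U \<Otimes>\<^sub>M distr M T V)) = (\<integral>y. (\<integral>x. f x y \<partial>distr M S U) \<partial>distr M T V)"
      using DD.integral_snd[of f] i by simp
    also have "\<bar>\<dots>\<bar> \<le> c"
    proof (rule DV.abs_expectation_le)
      fix y assume "y \<in> space (distr M T V)"
      then have y: "y \<in> space T" by simp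
      then have "(\<integral>x. f x y \<partial>distr M S U) = expectation (\<lambda>\<omega>. f (U \<omega>) y)"
        by (intro integral_distr) auto
      then show "\<bar>\<integral>x. f x y \<partial>distr M S U\<bar> \<le> c" using *[OF y] by simp
    qed
    finally show ?thesis unfolding E .
  qed
  show "\<bar>expectation (\<lambda>\<omega>. f (U \<omega>) (V \<omega>))\<bar> \<le> c"
    if *: "\<And>x. x \<in> space S \<Longrightarrow> \<bar>expectation (\<lambda>\<omega>. f x (V \<omega>))\<bar> \<le> c"
  proof -
    have "(\<integral>w. case_prod f w \<partial>(distr M S U \<Otimes>\<^sub>M distr M T V)) = (\<integral>x. (\<integral>y. f x y \<partial>distr M T V) \<partial>distr M S U)"
      using DD.integral_fst'[OF i] by simp
    also have "\<bar>\<dots>\<bar> \<le> c"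
    proof (rule DU.abs_expectation_le)
      fix x assume "x \<in> space (distr M S U)"
      then have x: "x \<in> space S" by simp
      then have "(\<integral>y. f x y \<partial>distr M T V) = expectation (\<lambda>\<omega>. f x (V \<omega>))"
        by (intro integral_distr) auto
      then show "\<bar>\<integral>y. f x y \<partial>distr M T V\<bar> \<le> c" using *[OF x] by simp
    qed
    finally show ?thesis unfolding E .
  qed
qed

text \<open>Conditions (a) and (b) tested against bounded functions of the remaining entries:
  \<open>e\<close> plays the part of the mean absolute deviation of the conditional variance from
  \<open>s\<close>. In this weak form conditionally centred entries and independent ones look
  alike.\<close>

definition balanced_at ::
  "'a measure \<Rightarrow> 'i set \<Rightarrow> ('i \<Rightarrow> 'a \<Rightarrow> real) \<Rightarrow> 'i \<Rightarrow> real \<Rightarrow> real \<Rightarrow> bool" where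
  "balanced_at M P X q s e \<longleftrightarrow>
     (\<forall>g B. g \<in> borel_measurable (PiM (P - {q}) (\<lambda>_. borel)) \<longrightarrow> (\<forall>x. \<bar>g x\<bar> \<le> B) \<longrightarrow>
        (\<integral>\<omega>. X q \<omega> * g (restrict (\<lambda>r. X r \<omega>) (P - {q})) \<partial>M) = 0 \<and>
        \<bar>\<integral>\<omega>. ((X q \<omega>)\<^sup>2 - s) * g (restrict (\<lambda>r. X r \<omega>) (P - {q})) \<partial>M\<bar> \<le> B * e)"

text \<open>The two arrays enter symmetrically and share the variances \<open>s\<close>; this common
  value is what a swap cancels.\<close>

locale balanced_pair = prob_space M for M :: "'a measure" +
  fixes P :: "'i set" and X Y :: "'i \<Rightarrow> 'a \<Rightarrow> real" and s e :: "'i \<Rightarrow> real"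
  assumes finite_P: "finite P"
    and indep: "indep_var (PiM P (\<lambda>_. borel)) (\<lambda>\<omega>. restrict (\<lambda>q. X q \<omega>) P)
                 (PiM P (\<lambda>_. borel)) (\<lambda>\<omega>. restrict (\<lambda>q. Y q \<omega>) P)"
    and X_rv: "\<And>q. q \<in> P \<Longrightarrow> X q \<in> borel_measurable M"
    and Y_rv: "\<And>q. q \<in> P \<Longrightarrow> Y q \<in> borel_measurable M"
    and X_sq: "\<And>q. q \<in> P \<Longrightarrow> integrable M (\<lambda>\<omega>. (X q \<omega>)\<^sup>2)"
    and Y_sq: "\<And>q. q \<in> P \<Longrightarrow> integrable M (\<lambda>\<omega>. (Y q \<omega>)\<^sup>2)"
    and X_bal: "\<And>q. q \<in> P \<Longrightarrow> balanced_at M P X q (s q) (e q)"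
    and Y_bal: "\<And>q. q \<in> P \<Longrightarrow> balanced_at M P Y q (s q) (e q)"
begin

text \<open>The intermediate array of the replacement: the entries in \<open>T\<close> have been
  swapped already.\<close>

definition mix :: "'i set \<Rightarrow> ('i \<Rightarrow> real) \<Rightarrow> ('i \<Rightarrow> real) \<Rightarrow> 'i \<Rightarrow> real" where
  "mix T x y = (\<lambda>q\<in>P. if q \<in> T then y q else x q)"

abbreviation "XP \<omega> \<equiv> restrict (\<lambda>q. X q \<omega>) P"
abbreviation "YP \<omega> \<equiv> restrict (\<lambda>q. Y q \<omega>) P"
abbreviation "SP \<equiv> PiM P (\<lambda>_. borel :: real measure)"

text \<open>\<open>u\<close> and \<open>v\<close> may take values in arrays over smaller index sets,
  as long as these contain what the mixture reads once \<open>q\<close> is zeroed. With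
  \<open>Q = P - {q}\<close> this certifies that a coefficient depends on the other entries
  only.\<close>

lemma mix_measurable:
  assumes "u \<in> measurable N (PiM Q (\<lambda>_. borel :: real measure))" "v \<in> measurable N (PiM Q' (\<lambda>_. borel :: real measure))"
    "P - T - {q} \<subseteq> Q" "P \<inter> T - {q} \<subseteq> Q'" "q \<in> P"
  shows "(\<lambda>w. (mix T (u w) (v w))(q := 0)) \<in> measurable N SP"
proof -
  have eq: "(mix T (u w) (v w))(q := 0) = (\<lambda>r\<in>P. if r = q then 0 else if r \<in> T then v w r else u w r)" for w
    using assms(5) by (auto simp: mix_def)
  have "(\<lambda>w. if r = q then 0 else if r \<in> T then v w r else u w r) \<in> borel_measurable N" if "r \<in> P" for r
  proof -
    have "r \<in> Q" if "r \<noteq> q" "r \<notin> T" using that \<open>r \<in> P\<close> assms(3) by auto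
    moreover have "r \<in> Q'" if "r \<noteq> q" "r \<in> T" using that \<open>r \<in> P\<close> assms(4) by auto
    ultimately show ?thesis
      using measurable_compose[OF assms(1) measurable_component_singleton[of r Q "\<lambda>_. borel"]]
        measurable_compose[OF assms(2) measurable_component_singleton[of r Q' "\<lambda>_. borel"]]
      by (cases "r = q"; cases "r \<in> T") auto
  qed
  then show ?thesis unfolding eq by (intro measurable_restrict) auto
qed

lemma XP_rv: "XP \<in> measurable M SP" and YP_rv: "YP \<in> measurable M SP"
  using X_rv Y_rv by (auto intro!: measurable_restrict)

lemma X_int: "q \<in> P \<Longrightarrow> integrable M (X q)" and Y_int: "q \<in> P \<Longrightarrow> integrable M (Y q)"
  using square_integrable_imp_integrable[OF X_rv X_sq] square_integrable_imp_integrable[OF Y_rv Y_sq] by auto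

text \<open>With the array \<open>Y\<close> frozen, the coefficient \<open>h\<close> is a bounded
  measurable function of the entries of \<open>X\<close> other than \<open>q\<close>, exactly a test
  function of \<open>balanced_at\<close>; freezing \<open>X\<close> serves the entries of
  \<open>Y\<close>.\<close>

lemma swap_moments:
  assumes q: "q \<in> P" "q \<notin> T" and d: "d \<in> borel_measurable SP" "\<And>b. \<bar>d (b(q := 0))\<bar> \<le> C"
  defines "h \<equiv> \<lambda>\<omega>. d ((mix T (XP \<omega>) (YP \<omega>))(q := 0))"
  shows "h \<in> borel_measurable M"
    and "expectation (\<lambda>\<omega>. X q \<omega> * h \<omega>) = 0" "expectation (\<lambda>\<omega>. Y q \<omega> * h \<omega>) = 0"
    and "\<bar>expectation (\<lambda>\<omega>. ((X q \<omega>)\<^sup>2 - s q) * h \<omega>)\<bar> \<le> C * e q"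
    and "\<bar>expectation (\<lambda>\<omega>. ((Y q \<omega>)\<^sup>2 - s q) * h \<omega>)\<bar> \<le> C * e q"
proof -
  define H where "H = (\<lambda>w. d ((mix T (fst w) (snd w))(q := 0)))"
  have Hm: "H \<in> borel_measurable (SP \<Otimes>\<^sub>M SP)"
    unfolding H_def using q by (intro measurable_compose[OF mix_measurable d(1)] measurable_fst measurable_snd) auto
  have hH: "h \<omega> = H (XP \<omega>, YP \<omega>)" for \<omega> by (simp add: h_def H_def)
  show hm: "h \<in> borel_measurable M"
    unfolding h_def using q by (intro measurable_compose[OF mix_measurable[OF XP_rv YP_rv] d(1)]) auto
  have hb: "\<bar>h \<omega>\<bar> \<le> C" for \<omega> unfolding h_def by (rule d(2))
  have gX: "(\<lambda>x. H (x, y)) \<in> borel_measurable (PiM (P - {q}) (\<lambda>_. borel))" if "y \<in> space SP" for y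
    unfolding H_def using q that
    by (intro measurable_compose[OF mix_measurable[of _ _ "P - {q}" _ P] d(1)]) auto
  have gY: "(\<lambda>y. H (x, y)) \<in> borel_measurable (PiM (P - {q}) (\<lambda>_. borel))" if "x \<in> space SP" for x
    unfolding H_def using q that
    by (intro measurable_compose[OF mix_measurable[of _ _ P _ "P - {q}"] d(1)]) auto
  \<comment> \<open>The update at \<open>q\<close> hides that coordinate from \<open>H\<close>, so
    the array restricted to \<open>P - {q}\<close> gives the same value.\<close>
  have HX: "H (XP \<omega>, y) = H (restrict (\<lambda>r. X r \<omega>) (P - {q}), y)" for \<omega> y
    unfolding H_def by (rule arg_cong[of _ _ d]) (auto simp: mix_def)
  have HY: "H (x, YP \<omega>) = H (x, restrict (\<lambda>r. Y r \<omega>) (P - {q}))" for \<omega> x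
    unfolding H_def by (rule arg_cong[of _ _ d]) (auto simp: mix_def)
  have Hb: "\<bar>H w\<bar> \<le> C" for w unfolding H_def by (rule d(2))
  have comp: "(\<lambda>x. x q) \<in> borel_measurable SP" using q(1) by (rule measurable_component_singleton)
  \<comment> \<open>\<open>\<phi>\<close> will be the identity with \<open>c = 0\<close>, or the
    centred square \<open>x\<^sup>2 - s q\<close> with \<open>c = C * e q\<close>.\<close>
  have main: "\<bar>expectation (\<lambda>\<omega>. \<phi> (X q \<omega>) * h \<omega>)\<bar> \<le> c"
    if \<phi>: "\<phi> \<in> borel_measurable borel" "integrable M (\<lambda>\<omega>. \<phi> (X q \<omega>))"
      and c: "\<And>g. g \<in> borel_measurable (PiM (P - {q}) (\<lambda>_. borel)) \<Longrightarrow> (\<And>x. \<bar>g x\<bar> \<le> C) \<Longrightarrow>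
         \<bar>\<integral>\<omega>. \<phi> (X q \<omega>) * g (restrict (\<lambda>r. X r \<omega>) (P - {q})) \<partial>M\<bar> \<le> c" for \<phi> c
  proof -
    have fX: "\<phi> (XP \<omega> q) = \<phi> (X q \<omega>)" for \<omega> using q by simp
    have "\<bar>expectation (\<lambda>\<omega>. \<phi> (XP \<omega> q) * H (XP \<omega>, YP \<omega>))\<bar> \<le> c"
    proof (rule indep_var_expectation_bound(1)[OF indep, where f="\<lambda>x y. \<phi> (x q) * H (x, y)"])
      show "(\<lambda>(x, y). \<phi> (x q) * H (x, y)) \<in> borel_measurable (SP \<Otimes>\<^sub>M SP)"
        unfolding split_beta
        by (simp, intro borel_measurable_times Hm measurable_compose[OF _ \<phi>(1)] measurable_compose[OF measurable_fst comp])
      show "integrable M (\<lambda>\<omega>. \<phi> (XP \<omega> q) * H (XP \<omega>, YP \<omega>))"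
        unfolding fX using integrable_bounded_mult[OF \<phi>(2) hm hb] by (simp add: hH)
      fix y assume "y \<in> space SP"
      from c[OF gX[OF this] Hb] show "\<bar>expectation (\<lambda>\<omega>. \<phi> (XP \<omega> q) * H (XP \<omega>, y))\<bar> \<le> c"
        unfolding fX HX .
    qed
    then show ?thesis unfolding fX hH .
  qed
  have main': "\<bar>expectation (\<lambda>\<omega>. \<phi> (Y q \<omega>) * h \<omega>)\<bar> \<le> c"
    if \<phi>: "\<phi> \<in> borel_measurable borel" "integrable M (\<lambda>\<omega>. \<phi> (Y q \<omega>))"
      and c: "\<And>g. g \<in> borel_measurable (PiM (P - {q}) (\<lambda>_. borel)) \<Longrightarrow> (\<And>x. \<bar>g x\<bar> \<le> C) \<Longrightarrow>
         \<bar>\<integral>\<omega>. \<phi> (Y q \<omega>) * g (restrict (\<lambda>r. Y r \<omega>) (P - {q})) \<partial>M\<bar> \<le> c" for \<phi> c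
  proof -
    have fY: "\<phi> (YP \<omega> q) = \<phi> (Y q \<omega>)" for \<omega> using q by simp
    have "\<bar>expectation (\<lambda>\<omega>. \<phi> (YP \<omega> q) * H (XP \<omega>, YP \<omega>))\<bar> \<le> c"
    proof (rule indep_var_expectation_bound(2)[OF indep, where f="\<lambda>x y. \<phi> (y q) * H (x, y)"])
      show "(\<lambda>(x, y). \<phi> (y q) * H (x, y)) \<in> borel_measurable (SP \<Otimes>\<^sub>M SP)"
        unfolding split_beta
        by (simp, intro borel_measurable_times Hm measurable_compose[OF _ \<phi>(1)] measurable_compose[OF measurable_snd comp])
      show "integrable M (\<lambda>\<omega>. \<phi> (YP \<omega> q) * H (XP \<omega>, YP \<omega>))"
        unfolding fY using integrable_bounded_mult[OF \<phi>(2) hm hb] by (simp add: hH)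
      fix x assume "x \<in> space SP"
      from c[OF gY[OF this] Hb] show "\<bar>expectation (\<lambda>\<omega>. \<phi> (YP \<omega> q) * H (x, YP \<omega>))\<bar> \<le> c"
        unfolding fY HY .
    qed
    then show ?thesis unfolding fY hH .
  qed
  note BX = X_bal[OF q(1), unfolded balanced_at_def, rule_format]
    and BY = Y_bal[OF q(1), unfolded balanced_at_def, rule_format]
  show "expectation (\<lambda>\<omega>. X q \<omega> * h \<omega>) = 0"
    using main[of "\<lambda>x. x" 0] X_int[OF q(1)] conjunct1[OF BX] by auto
  show "expectation (\<lambda>\<omega>. Y q \<omega> * h \<omega>) = 0"
    using main'[of "\<lambda>x. x" 0] Y_int[OF q(1)] conjunct1[OF BY] by auto
  show "\<bar>expectation (\<lambda>\<omega>. ((X q \<omega>)\<^sup>2 - s q) * h \<omega>)\<bar> \<le> C * e q"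
    using X_sq[OF q(1)] conjunct2[OF BX] by (intro main) auto
  show "\<bar>expectation (\<lambda>\<omega>. ((Y q \<omega>)\<^sup>2 - s q) * h \<omega>)\<bar> \<le> C * e q"
    using Y_sq[OF q(1)] conjunct2[OF BY] by (intro main') auto
qed

text \<open>Before and after a swap the expectation lies near the same value
  \<open>expectation h0 + s q * expectation h2\<close>, because the linear terms vanish and the
  variances agree. The factor 2 of \<open>C2 * e q\<close> counts both arrays. \<open>C0\<close>,
  \<open>C1\<close> and \<open>K\<close> secure integrability.\<close>

lemma lindeberg_swap:
  fixes F :: "('i \<Rightarrow> real) \<Rightarrow> real" and d1 d2 :: "'i \<Rightarrow> ('i \<Rightarrow> real) \<Rightarrow> real" and r :: "real \<Rightarrow> real"
  assumes F: "F \<in> borel_measurable SP" "\<And>b. \<bar>F b\<bar> \<le> C0"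
    and d1: "\<And>q. d1 q \<in> borel_measurable SP" "\<And>q b. q \<in> P \<Longrightarrow> \<bar>d1 q (b(q := 0))\<bar> \<le> C1"
    and d2: "\<And>q. d2 q \<in> borel_measurable SP" "\<And>q b. q \<in> P \<Longrightarrow> \<bar>d2 q (b(q := 0))\<bar> \<le> C2"
    and r: "r \<in> borel_measurable borel" "\<And>x. r x \<le> K * x\<^sup>2"
    and taylor: "\<And>q b x. q \<in> P \<Longrightarrow> \<bar>F (b(q := x)) - F (b(q := 0)) - x * d1 q (b(q := 0)) - x\<^sup>2 * d2 q (b(q := 0))\<bar> \<le> r x"
  shows "\<bar>expectation (\<lambda>\<omega>. F (YP \<omega>)) - expectation (\<lambda>\<omega>. F (XP \<omega>))\<bar>
    \<le> (\<Sum>q\<in>P. 2 * C2 * e q + expectation (\<lambda>\<omega>. r (X q \<omega>)) + expectation (\<lambda>\<omega>. r (Y q \<omega>)))"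
proof -
  let ?E = "\<lambda>T. expectation (\<lambda>\<omega>. F (mix T (XP \<omega>) (YP \<omega>)))"
  let ?c = "\<lambda>q. 2 * C2 * e q + expectation (\<lambda>\<omega>. r (X q \<omega>)) + expectation (\<lambda>\<omega>. r (Y q \<omega>))"
  have step: "\<bar>?E (insert q T) - ?E T\<bar> \<le> ?c q" if q: "q \<in> P" "q \<notin> T" for q T
  proof -
    define b where "b = (\<lambda>\<omega>. (mix T (XP \<omega>) (YP \<omega>))(q := 0))"
    have bm: "b \<in> measurable M SP"
      unfolding b_def using q by (intro mix_measurable[OF XP_rv YP_rv]) auto
    define h0 h1 h2 where "h0 = (\<lambda>\<omega>. F (b \<omega>))" and "h1 = (\<lambda>\<omega>. d1 q (b \<omega>))" and "h2 = (\<lambda>\<omega>. d2 q (b \<omega>))"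
    have upd: "b \<omega> = (b \<omega>)(q := 0)" for \<omega> by (simp add: b_def)
    have FX: "F (mix T (XP \<omega>) (YP \<omega>)) = F ((b \<omega>)(q := X q \<omega>))" for \<omega>
      using q by (intro arg_cong[of _ _ F]) (auto simp: b_def mix_def)
    have FY: "F (mix (insert q T) (XP \<omega>) (YP \<omega>)) = F ((b \<omega>)(q := Y q \<omega>))" for \<omega>
      using q by (intro arg_cong[of _ _ F]) (auto simp: b_def mix_def)
    have h12: "d1 q ((mix T (XP \<omega>) (YP \<omega>))(q := 0)) = h1 \<omega>" "d2 q ((mix T (XP \<omega>) (YP \<omega>))(q := 0)) = h2 \<omega>" for \<omega>
      by (simp_all add: h1_def h2_def b_def)
    note m1 = swap_moments[OF q d1(1)[of q] d1(2)[OF q(1)], unfolded h12]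
    note m2 = swap_moments[OF q d2(1)[of q] d2(2)[OF q(1)], unfolded h12]
    have h0: "integrable M h0"
      using measurable_compose[OF bm F(1)] F(2) by (auto simp: h0_def intro!: integrable_const_bound[where B=C0])
    have h1b: "\<bar>h1 \<omega>\<bar> \<le> C1" and h2b: "\<bar>h2 \<omega>\<bar> \<le> C2" for \<omega>
      using d1(2)[OF q(1)] d2(2)[OF q(1)] by (simp_all only: h1_def h2_def b_def)
    have h2: "integrable M h2" using m2(1) h2b by (auto intro!: integrable_const_bound[where B=C2])
    have main: "\<bar>expectation (\<lambda>\<omega>. F ((b \<omega>)(q := Z \<omega>))) - expectation h0 - s q * expectation h2\<bar>
        \<le> C2 * e q + expectation (\<lambda>\<omega>. r (Z \<omega>))"
      if Z: "Z \<in> borel_measurable M" "integrable M (\<lambda>\<omega>. (Z \<omega>)\<^sup>2)"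
        and Z1: "expectation (\<lambda>\<omega>. Z \<omega> * h1 \<omega>) = 0"
        and Z2: "\<bar>expectation (\<lambda>\<omega>. ((Z \<omega>)\<^sup>2 - s q) * h2 \<omega>)\<bar> \<le> C2 * e q" for Z
    proof -
      \<comment> \<open>Nonnegativity of \<open>r\<close> is implicit in its dominating an absolute
        value.\<close>
      have r0: "0 \<le> r x" for x by (rule order.trans[OF abs_ge_zero taylor[OF q(1)]])
      have ir: "integrable M (\<lambda>\<omega>. r (Z \<omega>))"
      proof (rule Bochner_Integration.integrable_bound[of M "\<lambda>\<omega>. K * (Z \<omega>)\<^sup>2"])
        show "AE \<omega> in M. norm (r (Z \<omega>)) \<le> norm (K * (Z \<omega>)\<^sup>2)"
        proof (intro AE_I2)
          fix \<omega> show "norm (r (Z \<omega>)) \<le> norm (K * (Z \<omega>)\<^sup>2)"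
            using r0[of "Z \<omega>"] r(2)[of "Z \<omega>"] by simp
        qed
      qed (use Z r(1) in auto)
      have ub: "(\<lambda>\<omega>. (b \<omega>)(q := Z \<omega>)) \<in> measurable M SP"
      proof -
        have "(b \<omega>)(q := Z \<omega>) = (\<lambda>r\<in>P. if r = q then Z \<omega> else b \<omega> r)" for \<omega>
          using q by (auto simp: b_def mix_def)
        then show ?thesis
          using Z(1) measurable_compose[OF bm measurable_component_singleton[of _ P "\<lambda>_. borel"]]
          by (auto intro!: measurable_restrict)
      qed
      have iF: "integrable M (\<lambda>\<omega>. F ((b \<omega>)(q := Z \<omega>)))"
        using measurable_compose[OF ub F(1)] F(2) by (auto intro!: integrable_const_bound[where B=C0])
      have i1: "integrable M (\<lambda>\<omega>. Z \<omega> * h1 \<omega>)"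
        by (rule integrable_bounded_mult[OF square_integrable_imp_integrable[OF Z] m1(1) h1b])
      have i2: "integrable M (\<lambda>\<omega>. (Z \<omega>)\<^sup>2 * h2 \<omega>)"
        by (rule integrable_bounded_mult[OF Z(2) m2(1) h2b])
      let ?D = "\<lambda>\<omega>. F ((b \<omega>)(q := Z \<omega>)) - h0 \<omega> - Z \<omega> * h1 \<omega> - (Z \<omega>)\<^sup>2 * h2 \<omega>"
      have "\<bar>expectation ?D\<bar> \<le> expectation (\<lambda>\<omega>. \<bar>?D \<omega>\<bar>)" by (rule integral_abs_bound)
      also have "\<dots> \<le> expectation (\<lambda>\<omega>. r (Z \<omega>))"
      proof (rule integral_mono)
        show "integrable M (\<lambda>\<omega>. \<bar>?D \<omega>\<bar>)" using iF h0 i1 i2 by auto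
        show "\<bar>?D \<omega>\<bar> \<le> r (Z \<omega>)" for \<omega>
          using taylor[OF q(1), of "b \<omega>" "Z \<omega>"] upd[of \<omega>] by (simp add: h0_def h1_def h2_def)
      qed (rule ir)
      finally have D: "\<bar>expectation ?D\<bar> \<le> expectation (\<lambda>\<omega>. r (Z \<omega>))" .
      have "expectation ?D = expectation (\<lambda>\<omega>. F ((b \<omega>)(q := Z \<omega>))) - expectation h0
          - expectation (\<lambda>\<omega>. (Z \<omega>)\<^sup>2 * h2 \<omega>)"
        using iF h0 i1 i2 Z1 by simp
      moreover have "expectation (\<lambda>\<omega>. ((Z \<omega>)\<^sup>2 - s q) * h2 \<omega>) = expectation (\<lambda>\<omega>. (Z \<omega>)\<^sup>2 * h2 \<omega>) - s q * expectation h2"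
        using i2 h2 by (simp add: left_diff_distrib)
      ultimately show ?thesis using D Z2 by linarith
    qed
    note main[OF X_rv[OF q(1)] X_sq[OF q(1)] m1(2) m2(4)]
      main[OF Y_rv[OF q(1)] Y_sq[OF q(1)] m1(3) m2(5)]
    then show ?thesis unfolding FX FY by linarith
  qed
  \<comment> \<open>Telescoping over the set of swapped entries, which grows from the empty set to
    \<open>P\<close>.\<close>
  have "\<bar>?E T - ?E {}\<bar> \<le> (\<Sum>q\<in>T. ?c q)" if "finite T" "T \<subseteq> P" for T
    using that
  proof (induction T)
    case (insert q T)
    then have "\<bar>?E (insert q T) - ?E T\<bar> \<le> ?c q" "\<bar>?E T - ?E {}\<bar> \<le> (\<Sum>q\<in>T. ?c q)"
      by (blast intro: step, blast)
    moreover have "(\<Sum>q\<in>insert q T. ?c q) = ?c q + (\<Sum>q\<in>T. ?c q)" by (rule sum.insert[OF insert(1,2)])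
    ultimately show ?case by linarith
  qed simp
  from this[OF finite_P order.refl] have "\<bar>?E P - ?E {}\<bar> \<le> (\<Sum>q\<in>P. ?c q)" .
  moreover have "mix P (XP \<omega>) (YP \<omega>) = YP \<omega>" "mix {} (XP \<omega>) (YP \<omega>) = XP \<omega>" for \<omega>
    by (auto simp: mix_def)
  ultimately show ?thesis by (simp only:)
qed

end

section \<open>Replacement of a matrix with conditionally centred entries\<close>

lemma space_others_sigma [simp]: "space (others_sigma M X n i j) = space M"
  by (simp add: others_sigma_def space_measure_of_conv)

lemma others_sigma_measurable:
  assumes "1 \<le> k" "k \<le> l" "l \<le> n" "(k, l) \<noteq> (min i j, max i j)"
  shows "X k l \<in> borel_measurable (others_sigma M X n i j)"
proof (rule measurableI)
  fix A :: "real set" assume "A \<in> sets borel"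
  then have "X k l -` A \<inter> space M \<in> {X k l -` A \<inter> space M | k l A.
          1 \<le> k \<and> k \<le> l \<and> l \<le> n \<and> (k, l) \<noteq> (min i j, max i j) \<and> A \<in> sets borel}"
    using assms by blast
  moreover have "\<dots> \<subseteq> Pow (space M)" by blast
  ultimately have "X k l -` A \<inter> space M \<in> sets (others_sigma M X n i j)"
    unfolding others_sigma_def by (rule in_measure_of[rotated])
  then show "X k l -` A \<inter> space (others_sigma M X n i j) \<in> sets (others_sigma M X n i j)" by simp
qed simp

lemma subalgebra_others_sigma:
  assumes "\<And>k l. 1 \<le> k \<Longrightarrow> k \<le> l \<Longrightarrow> X k l \<in> borel_measurable M"
  shows "subalgebra M (others_sigma M X n i j)"
  unfolding subalgebra_def
proof
  let ?G = "{X k l -` A \<inter> space M | k l A.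
          1 \<le> k \<and> k \<le> l \<and> l \<le> n \<and> (k, l) \<noteq> (min i j, max i j) \<and> A \<in> sets borel}"
  have "?G \<subseteq> sets M" using assms by (auto intro: measurable_sets)
  moreover have "sets (others_sigma M X n i j) = sigma_sets (space M) ?G"
    unfolding others_sigma_def by (rule sets_measure_of) blast
  ultimately show "sets (others_sigma M X n i j) \<subseteq> sets M"
    using sets.sigma_sets_subset by simp
qed simp

definition upper_pairs :: "nat \<Rightarrow> (nat \<times> nat) set" where
  "upper_pairs n = {(i, j). 1 \<le> i \<and> i \<le> j \<and> j \<le> n}"

lemma upper_pairs_subset: "upper_pairs n \<subseteq> {1..n} \<times> {1..n}"
  by (auto simp: upper_pairs_def)

lemma finite_upper_pairs [simp]: "finite (upper_pairs n)"
  using upper_pairs_subset by (rule finite_subset) auto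

text \<open>The weight is a function of the other entries, hence measurable for the conditioning
  algebra, and can be pulled out of conditional expectations: the linear term becomes an integral of
  0, the centred square one of the weight times the conditional variance deviation, whose mean
  modulus is the term of (b).\<close>

lemma (in prob_space) balanced_at_cond_exp:
  fixes X :: "nat \<Rightarrow> nat \<Rightarrow> 'a \<Rightarrow> real"
  assumes rv: "\<And>k l. 1 \<le> k \<Longrightarrow> k \<le> l \<Longrightarrow> X k l \<in> borel_measurable M"
    and ij: "(i, j) \<in> upper_pairs n" and sq: "integrable M (\<lambda>\<omega>. (X i j \<omega>)\<^sup>2)"
    and a: "AE \<omega> in M. real_cond_exp M (others_sigma M X n i j) (X i j) \<omega> = 0"
  shows "balanced_at M (upper_pairs n) (\<lambda>q. X (fst q) (snd q)) (i, j) s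
     (expectation (\<lambda>\<omega>. \<bar>real_cond_exp M (others_sigma M X n i j) (\<lambda>\<omega>'. (X i j \<omega>')\<^sup>2) \<omega> - s\<bar>))"
  unfolding balanced_at_def
proof (intro allI impI)
  let ?F = "others_sigma M X n i j"
  fix g :: "(nat \<times> nat \<Rightarrow> real) \<Rightarrow> real" and B
  assume g: "g \<in> borel_measurable (PiM (upper_pairs n - {(i, j)}) (\<lambda>_. borel))" and gB: "\<forall>x. \<bar>g x\<bar> \<le> B"
  let ?h = "\<lambda>\<omega>. g (\<lambda>r\<in>upper_pairs n - {(i, j)}. X (fst r) (snd r) \<omega>)"
  have sub: "subalgebra M ?F" by (rule subalgebra_others_sigma[OF rv])
  interpret F: finite_measure_subalgebra M ?F by unfold_locales (rule sub)
  \<comment> \<open>For a pair with \<open>i \<le> j\<close> the index excluded by the symmetric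
    definition is \<open>(i, j)\<close> itself.\<close>
  have mm: "min i j = i" "max i j = j" using ij by (auto simp: upper_pairs_def)
  have hF: "?h \<in> borel_measurable ?F"
    by (rule measurable_compose[OF measurable_restrict g])
      (auto intro!: others_sigma_measurable simp: mm upper_pairs_def)
  have hM: "?h \<in> borel_measurable M" by (rule measurable_from_subalg[OF sub hF])
  have X: "X i j \<in> borel_measurable M" using rv ij by (auto simp: upper_pairs_def)
  have iX: "integrable M (X i j)" by (rule square_integrable_imp_integrable[OF X sq])
  have hB: "\<bar>?h \<omega>\<bar> \<le> B" for \<omega> using gB by blast
  have i1: "integrable M (\<lambda>\<omega>. ?h \<omega> * X i j \<omega>)" and i2: "integrable M (\<lambda>\<omega>. ?h \<omega> * (X i j \<omega>)\<^sup>2)"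
    using integrable_bounded_mult[OF iX hM hB] integrable_bounded_mult[OF sq hM hB] by (simp_all add: mult.commute)
  have ih: "integrable M ?h" using hM hB by (auto intro!: integrable_const_bound[where B=B])
  have "expectation (\<lambda>\<omega>. X i j \<omega> * ?h \<omega>) = expectation (\<lambda>\<omega>. ?h \<omega> * real_cond_exp M ?F (X i j) \<omega>)"
    using F.real_cond_exp_intg(2)[OF i1 hF X] by (simp add: mult.commute)
  also have "\<dots> = expectation (\<lambda>\<omega>. 0)" using a hM by (intro integral_cong_AE borel_measurable_times borel_measurable_cond_exp2) auto
  finally have 1: "expectation (\<lambda>\<omega>. X i j \<omega> * ?h \<omega>) = 0" by simp
  let ?c = "real_cond_exp M ?F (\<lambda>\<omega>'. (X i j \<omega>')\<^sup>2)"
  have X2: "(\<lambda>\<omega>. (X i j \<omega>)\<^sup>2) \<in> borel_measurable M" using X by measurable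
  have ic: "integrable M ?c" by (rule F.real_cond_exp_int(1)[OF sq])
  have ihc: "integrable M (\<lambda>\<omega>. ?h \<omega> * ?c \<omega>)" by (rule F.real_cond_exp_intg(1)[OF i2 hF X2])
  have "expectation (\<lambda>\<omega>. ((X i j \<omega>)\<^sup>2 - s) * ?h \<omega>) = expectation (\<lambda>\<omega>. ?h \<omega> * (X i j \<omega>)\<^sup>2) - s * expectation ?h"
    using i2 ih by (simp add: left_diff_distrib mult.commute[of "(X i j _)\<^sup>2"])
  also have "\<dots> = expectation (\<lambda>\<omega>. ?h \<omega> * ?c \<omega>) - s * expectation ?h"
    using F.real_cond_exp_intg(2)[OF i2 hF X2] by simp
  also have "\<dots> = expectation (\<lambda>\<omega>. ?h \<omega> * (?c \<omega> - s))"
    using ihc ih by (simp add: right_diff_distrib mult.commute[of _ s])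
  finally have eq: "expectation (\<lambda>\<omega>. ((X i j \<omega>)\<^sup>2 - s) * ?h \<omega>) = expectation (\<lambda>\<omega>. ?h \<omega> * (?c \<omega> - s))" .
  have "\<bar>expectation (\<lambda>\<omega>. ?h \<omega> * (?c \<omega> - s))\<bar> \<le> expectation (\<lambda>\<omega>. \<bar>?h \<omega> * (?c \<omega> - s)\<bar>)" by (rule integral_abs_bound)
  also have "\<dots> \<le> expectation (\<lambda>\<omega>. B * \<bar>?c \<omega> - s\<bar>)"
  proof (rule integral_mono)
    show "integrable M (\<lambda>\<omega>. \<bar>?h \<omega> * (?c \<omega> - s)\<bar>)"
      using ihc ih by (auto simp: right_diff_distrib)
    show "integrable M (\<lambda>\<omega>. B * \<bar>?c \<omega> - s\<bar>)" using ic by auto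
    show "\<bar>?h \<omega> * (?c \<omega> - s)\<bar> \<le> B * \<bar>?c \<omega> - s\<bar>" for \<omega>
      unfolding abs_mult by (rule mult_right_mono[OF hB]) simp
  qed
  finally have 2: "\<bar>expectation (\<lambda>\<omega>. ((X i j \<omega>)\<^sup>2 - s) * ?h \<omega>)\<bar> \<le> B * expectation (\<lambda>\<omega>. \<bar>?c \<omega> - s\<bar>)"
    unfolding eq by simp
  show "expectation (\<lambda>\<omega>. X (fst (i, j)) (snd (i, j)) \<omega> * ?h \<omega>) = 0 \<and>
       \<bar>expectation (\<lambda>\<omega>. ((X (fst (i, j)) (snd (i, j)) \<omega>)\<^sup>2 - s) * ?h \<omega>)\<bar> \<le> B * expectation (\<lambda>\<omega>. \<bar>?c \<omega> - s\<bar>)"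
    using 1 2 by simp
qed

text \<open>Independence factors both expectations and one factor is 0, so every
  \<open>e \<ge> 0\<close> is admissible; this lets \<open>Y\<close> share the defect
  \<open>e\<close> of \<open>X\<close>.\<close>

lemma (in prob_space) balanced_at_indep:
  fixes Y :: "'i \<Rightarrow> 'a \<Rightarrow> real"
  assumes ind: "indep_vars (\<lambda>_. borel) Y P" and q: "q \<in> P"
    and sq: "integrable M (\<lambda>\<omega>. (Y q \<omega>)\<^sup>2)" and mean: "expectation (Y q) = 0"
    and var: "expectation (\<lambda>\<omega>. (Y q \<omega>)\<^sup>2) = s" and e: "0 \<le> e"
  shows "balanced_at M P Y q s e"
  unfolding balanced_at_def
proof (intro allI impI)
  fix g :: "('i \<Rightarrow> real) \<Rightarrow> real" and B
  assume g: "g \<in> borel_measurable (PiM (P - {q}) (\<lambda>_. borel))" and gB: "\<forall>x. \<bar>g x\<bar> \<le> B"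
  let ?h = "\<lambda>\<omega>. g (\<lambda>r\<in>P - {q}. Y r \<omega>)"
  have Y: "Y q \<in> borel_measurable M" using ind q by (auto simp: indep_vars_def)
  have iY: "integrable M (Y q)" by (rule square_integrable_imp_integrable[OF Y sq])
  have i0: "indep_var (PiM {q} (\<lambda>_. borel)) (\<lambda>\<omega>. \<lambda>r\<in>{q}. Y r \<omega>)
      (PiM (P - {q}) (\<lambda>_. borel)) (\<lambda>\<omega>. \<lambda>r\<in>P - {q}. Y r \<omega>)"
    using q by (intro indep_var_restrict[OF ind]) auto
  have ind': "indep_var borel (\<lambda>\<omega>. \<phi> (Y q \<omega>)) borel ?h" if "\<phi> \<in> borel_measurable borel" for \<phi> :: "real \<Rightarrow> real"
    using indep_var_compose[OF i0 measurable_compose[OF measurable_component_singleton[of q "{q}" "\<lambda>_. borel"] that] g]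
    by (simp add: comp_def)
  have hM: "?h \<in> borel_measurable M" using indep_var_rv2[OF ind'[of "\<lambda>x. x"]] by simp
  have hB: "\<bar>?h \<omega>\<bar> \<le> B" for \<omega> using gB by blast
  have ih: "integrable M ?h" using hM hB by (auto intro!: integrable_const_bound[where B=B])
  have "expectation (\<lambda>\<omega>. Y q \<omega> * ?h \<omega>) = expectation (Y q) * expectation ?h"
    using ind'[of "\<lambda>x. x"] by (intro indep_var_lebesgue_integral iY ih) auto
  moreover have "expectation (\<lambda>\<omega>. ((Y q \<omega>)\<^sup>2 - s) * ?h \<omega>) = expectation (\<lambda>\<omega>. (Y q \<omega>)\<^sup>2 - s) * expectation ?h"
    using ind'[of "\<lambda>x. x\<^sup>2 - s"] sq by (intro indep_var_lebesgue_integral ih) auto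
  moreover have "expectation (\<lambda>\<omega>. (Y q \<omega>)\<^sup>2 - s) = 0" using sq var by (simp add: prob_space)
  moreover have "0 \<le> B * e" using e order.trans[OF abs_ge_zero hB] by simp
  ultimately show "expectation (\<lambda>\<omega>. Y q \<omega> * ?h \<omega>) = 0 \<and>
      \<bar>expectation (\<lambda>\<omega>. ((Y q \<omega>)\<^sup>2 - s) * ?h \<omega>)\<bar> \<le> B * e"
    using mean by simp
qed

locale matrix_pair = prob_space M for M :: "'a measure" +
  fixes X Y :: "nat \<Rightarrow> nat \<Rightarrow> 'a \<Rightarrow> real" and \<sigma> :: "nat \<Rightarrow> nat \<Rightarrow> real"
  assumes X_rv: "\<And>i j. 1 \<le> i \<Longrightarrow> i \<le> j \<Longrightarrow> X i j \<in> borel_measurable M"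
    and Y_rv: "\<And>i j. 1 \<le> i \<Longrightarrow> i \<le> j \<Longrightarrow> Y i j \<in> borel_measurable M"
    and X_sq_int: "\<And>i j. 1 \<le> i \<Longrightarrow> i \<le> j \<Longrightarrow> integrable M (\<lambda>\<omega>. (X i j \<omega>)\<^sup>2)"
    and Y_sq_int: "\<And>i j. 1 \<le> i \<Longrightarrow> i \<le> j \<Longrightarrow> integrable M (\<lambda>\<omega>. (Y i j \<omega>)\<^sup>2)"
    and Y_mean: "\<And>i j. 1 \<le> i \<Longrightarrow> i \<le> j \<Longrightarrow> (\<integral>\<omega>. Y i j \<omega> \<partial>M) = 0"
    and X_var: "\<And>i j. 1 \<le> i \<Longrightarrow> i \<le> j \<Longrightarrow> (\<integral>\<omega>. (X i j \<omega>)\<^sup>2 \<partial>M) = (\<sigma> i j)\<^sup>2"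
    and Y_var: "\<And>i j. 1 \<le> i \<Longrightarrow> i \<le> j \<Longrightarrow> (\<integral>\<omega>. (Y i j \<omega>)\<^sup>2 \<partial>M) = (\<sigma> i j)\<^sup>2"
    and X_sym: "\<And>i j. 1 \<le> i \<Longrightarrow> i < j \<Longrightarrow> X j i = X i j"
    and Y_sym: "\<And>i j. 1 \<le> i \<Longrightarrow> i < j \<Longrightarrow> Y j i = Y i j"
    and \<sigma>_sym: "\<And>i j. 1 \<le> i \<Longrightarrow> i < j \<Longrightarrow> \<sigma> j i = \<sigma> i j"
    and XY_indep: "\<And>n. indep_var
           (matrix_space n) (random_matrix X n) (matrix_space n) (random_matrix Y n)"
    and Y_indep: "\<And>n. indep_vars (\<lambda>_. borel) (\<lambda>(i, j). Y i j) {(i, j). 1 \<le> i \<and> i \<le> j \<and> j \<le> n}"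
    and cond_mean: "\<And>n i j. 1 \<le> i \<Longrightarrow> i \<le> j \<Longrightarrow> j \<le> n \<Longrightarrow>
           AE \<omega> in M. real_cond_exp M (others_sigma M X n i j) (X i j) \<omega> = 0"
begin

definition cond_var_dev :: "nat \<Rightarrow> nat \<Rightarrow> nat \<Rightarrow> real" where
  "cond_var_dev n i j =
     (\<integral>\<omega>. \<bar>real_cond_exp M (others_sigma M X n i j) (\<lambda>\<omega>'. (X i j \<omega>')\<^sup>2) \<omega> - (\<sigma> i j)\<^sup>2\<bar> \<partial>M)"

definition tail_moment :: "(nat \<Rightarrow> nat \<Rightarrow> 'a \<Rightarrow> real) \<Rightarrow> real \<Rightarrow> nat \<Rightarrow> nat \<Rightarrow> nat \<Rightarrow> real" where
  "tail_moment Z \<tau> n i j =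
     (\<integral>\<omega>. \<bar>Z i j \<omega>\<bar>\<^sup>2 * of_bool (\<bar>Z i j \<omega>\<bar> \<ge> \<tau> * sqrt (real n)) \<partial>M)"

lemma cond_var_dev_nonneg: "0 \<le> cond_var_dev n i j"
  by (simp add: cond_var_dev_def)

lemma tail_moment_nonneg: "0 \<le> tail_moment Z \<tau> n i j"
  by (simp add: tail_moment_def)

text \<open>Independence is given for full matrices; restriction to the upper pairs is measurable,
  and composing with it passes independence on to the arrays without repeated entries.\<close>

lemma upper_pairs_balanced:
  "balanced_pair M (upper_pairs n) (\<lambda>q. X (fst q) (snd q)) (\<lambda>q. Y (fst q) (snd q))
     (\<lambda>q. (\<sigma> (fst q) (snd q))\<^sup>2) (\<lambda>q. cond_var_dev n (fst q) (snd q))"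
proof unfold_locales
  have restr: "(\<lambda>x. restrict x (upper_pairs n)) \<in> measurable (matrix_space n) (PiM (upper_pairs n) (\<lambda>_. borel))"
    unfolding matrix_space_def by (rule measurable_restrict_subset[OF upper_pairs_subset])
  have "restrict (random_matrix Z n \<omega>) (upper_pairs n) = (\<lambda>q\<in>upper_pairs n. Z (fst q) (snd q) \<omega>)"
    for Z :: "nat \<Rightarrow> nat \<Rightarrow> 'a \<Rightarrow> real" and \<omega>
    using upper_pairs_subset[of n] by (auto simp: random_matrix_def restrict_def fun_eq_iff)
  then show "indep_var (PiM (upper_pairs n) (\<lambda>_. borel)) (\<lambda>\<omega>. \<lambda>q\<in>upper_pairs n. X (fst q) (snd q) \<omega>)
      (PiM (upper_pairs n) (\<lambda>_. borel)) (\<lambda>\<omega>. \<lambda>q\<in>upper_pairs n. Y (fst q) (snd q) \<omega>)"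
    using indep_var_compose[OF XY_indep[of n] restr restr] by (simp add: comp_def)
  fix q assume q: "q \<in> upper_pairs n"
  then have q': "1 \<le> fst q" "fst q \<le> snd q" "snd q \<le> n" by (auto simp: upper_pairs_def)
  show "X (fst q) (snd q) \<in> borel_measurable M" "Y (fst q) (snd q) \<in> borel_measurable M"
    "integrable M (\<lambda>\<omega>. (X (fst q) (snd q) \<omega>)\<^sup>2)" "integrable M (\<lambda>\<omega>. (Y (fst q) (snd q) \<omega>)\<^sup>2)"
    using q' X_rv Y_rv X_sq_int Y_sq_int by auto
  show "balanced_at M (upper_pairs n) (\<lambda>q. X (fst q) (snd q)) q ((\<sigma> (fst q) (snd q))\<^sup>2) (cond_var_dev n (fst q) (snd q))"
    using balanced_at_cond_exp[of X "fst q" "snd q" n "(\<sigma> (fst q) (snd q))\<^sup>2"] q q' X_rv X_sq_int cond_mean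
    by (simp add: cond_var_dev_def)
  show "balanced_at M (upper_pairs n) (\<lambda>q. Y (fst q) (snd q)) q ((\<sigma> (fst q) (snd q))\<^sup>2) (cond_var_dev n (fst q) (snd q))"
    using q q' Y_indep[of n] Y_sq_int Y_mean Y_var cond_var_dev_nonneg
    by (intro balanced_at_indep) (auto simp: upper_pairs_def case_prod_unfold)
qed simp

text \<open>Symmetry restores the lower triangle, so the traces of the triangular arrays used in the
  replacement are those of the given random matrices.\<close>

lemma scaled_matrix_random_matrix:
  assumes "\<And>i j. 1 \<le> i \<Longrightarrow> i < j \<Longrightarrow> Z j i = Z i j"
  shows "scaled_matrix n (sym_array (\<lambda>q\<in>upper_pairs n. Z (fst q) (snd q) \<omega>)) = scaled_matrix n (random_matrix Z n \<omega>)"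
proof -
  have "Z (min i j) (max i j) = Z i j" if "1 \<le> i" "1 \<le> j" for i j
    using assms[of i j] assms[of j i] that by (cases i j rule: linorder_cases) auto
  from this[of "Suc _" "Suc _"] have "Z (Suc (min i j)) (Suc (max i j)) = Z (Suc i) (Suc j)" for i j
    by simp
  then show ?thesis
    by (intro eq_matI) (auto simp: scaled_matrix_def arr_matrix_def sym_array_def random_matrix_def upper_pairs_def)
qed

text \<open>Origin of the constants, with v = \<open>Im z\<close> and up to 1 / n^2: the first 4 /
  v^3 is twice the bound 2 / v^3 for the second-order coefficient; 4 \<tau> / v^4 and the last 4 /
  v^3 collect the remainders of both arrays. The bound does not involve \<open>Re z\<close>, which
  is what allows integration in \<open>u\<close>.\<close>

lemma poisson_trace_diff:
  assumes n: "0 < n" and z: "Im z > 0" and \<tau>: "\<tau> > 0"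
  shows "\<bar>expectation (\<lambda>\<omega>. poisson_trace n z (random_matrix Y n \<omega>))
       - expectation (\<lambda>\<omega>. poisson_trace n z (random_matrix X n \<omega>))\<bar>
    \<le> 1 / (real n)\<^sup>2 * (\<Sum>i=1..n. \<Sum>j=1..n. 4 / Im z ^ 3 * cond_var_dev n i j + 4 * \<tau> / Im z ^ 4 * (\<sigma> i j)\<^sup>2
        + 4 / Im z ^ 3 * (tail_moment X \<tau> n i j + tail_moment Y \<tau> n i j))"
proof -
  let ?v = "Im z" and ?P = "upper_pairs n"
  define r where "r = (\<lambda>x. (2 * \<tau> / ?v ^ 4 * x\<^sup>2 + 4 / ?v ^ 3 * (x\<^sup>2 * of_bool (\<bar>x\<bar> \<ge> \<tau> * sqrt (real n)))) / (real n)\<^sup>2)"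
  note rv = X_rv Y_rv
  interpret balanced_pair M ?P "\<lambda>q. X (fst q) (snd q)" "\<lambda>q. Y (fst q) (snd q)"
    "\<lambda>q. (\<sigma> (fst q) (snd q))\<^sup>2" "\<lambda>q. cond_var_dev n (fst q) (snd q)" by (rule upper_pairs_balanced)
  have entry: "(\<lambda>w. sym_array w (i, j)) \<in> borel_measurable SP" if "i \<in> {1..n}" "j \<in> {1..n}" for i j
    unfolding sym_array_def using that
    by (auto simp: upper_pairs_def min_def max_def intro!: measurable_component_singleton)
  note meas = poisson_trace_measurable[where a=sym_array and N=SP, OF entry borel_measurable_const[of z]]
  have "\<bar>expectation (\<lambda>\<omega>. poisson_trace n z (sym_array (YP \<omega>)))
       - expectation (\<lambda>\<omega>. poisson_trace n z (sym_array (XP \<omega>)))\<bar>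
    \<le> (\<Sum>q\<in>?P. 2 * (2 / ((real n)\<^sup>2 * ?v ^ 3)) * cond_var_dev n (fst q) (snd q)
        + expectation (\<lambda>\<omega>. r (X (fst q) (snd q) \<omega>)) + expectation (\<lambda>\<omega>. r (Y (fst q) (snd q) \<omega>)))"
  proof (rule lindeberg_swap[where F="\<lambda>b. poisson_trace n z (sym_array b)"
        and ?d1.0="\<lambda>q b. poisson_d1 n z q (sym_array b)" and ?d2.0="\<lambda>q b. poisson_d2 n z q (sym_array b)"
        and ?C1.0="2 / (real n * sqrt (real n) * ?v ^ 2)" and ?C0.0="1 / ?v"
        and K="(2 * \<tau> / ?v ^ 4 + 4 / ?v ^ 3) / (real n)\<^sup>2"])
    show "\<bar>poisson_trace n z (sym_array b)\<bar> \<le> 1 / ?v" for b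
      by (rule abs_poisson_trace_le[OF n z]) (simp add: sym_array_def min.commute max.commute)
    show "r \<in> borel_measurable borel" unfolding r_def by measurable
    show "r x \<le> (2 * \<tau> / ?v ^ 4 + 4 / ?v ^ 3) / (real n)\<^sup>2 * x\<^sup>2" for x
    proof -
      have "2 * \<tau> / ?v ^ 4 * x\<^sup>2 + 4 / ?v ^ 3 * (x\<^sup>2 * of_bool (\<bar>x\<bar> \<ge> \<tau> * sqrt (real n)))
          \<le> 2 * \<tau> / ?v ^ 4 * x\<^sup>2 + 4 / ?v ^ 3 * (x\<^sup>2 * 1)"
        using z by (intro add_left_mono mult_left_mono) auto
      then show ?thesis unfolding r_def using divide_right_mono[of _ _ "(real n)\<^sup>2"] by (simp add: distrib_right)
    qed
    fix q :: "nat \<times> nat" and b :: "nat \<times> nat \<Rightarrow> real" and x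
    assume "q \<in> ?P"
    then obtain i j where q: "q = (i, j)" "1 \<le> i" "i \<le> j" "j \<le> n" by (auto simp: upper_pairs_def)
    note T = poisson_trace_taylor[OF q(2-4) z \<tau>, of b]
    show "\<bar>poisson_d1 n z q (sym_array (b(q := 0)))\<bar> \<le> 2 / (real n * sqrt (real n) * ?v ^ 2)"
      "\<bar>poisson_d2 n z q (sym_array (b(q := 0)))\<bar> \<le> 2 / ((real n)\<^sup>2 * ?v ^ 3)"
      "\<bar>poisson_trace n z (sym_array (b(q := x))) - poisson_trace n z (sym_array (b(q := 0)))
           - x * poisson_d1 n z q (sym_array (b(q := 0))) - x\<^sup>2 * poisson_d2 n z q (sym_array (b(q := 0)))\<bar> \<le> r x"
      using T unfolding q(1) r_def by auto
  qed (use meas in auto)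
  also have "\<dots> = (\<Sum>(i, j)\<in>?P. (4 / ?v ^ 3 * cond_var_dev n i j + 4 * \<tau> / ?v ^ 4 * (\<sigma> i j)\<^sup>2
        + 4 / ?v ^ 3 * (tail_moment X \<tau> n i j + tail_moment Y \<tau> n i j)) / (real n)\<^sup>2)"
  proof (intro sum.cong refl, clarify)
    fix i j assume q: "(i, j) \<in> ?P"
    then have ij: "1 \<le> i" "i \<le> j" by (auto simp: upper_pairs_def)
    have er: "expectation (\<lambda>\<omega>. r (Z i j \<omega>)) = (2 * \<tau> / ?v ^ 4 * (\<sigma> i j)\<^sup>2 + 4 / ?v ^ 3 * tail_moment Z \<tau> n i j) / (real n)\<^sup>2"
      if Z: "Z i j \<in> borel_measurable M" "integrable M (\<lambda>\<omega>. (Z i j \<omega>)\<^sup>2)" "expectation (\<lambda>\<omega>. (Z i j \<omega>)\<^sup>2) = (\<sigma> i j)\<^sup>2"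
      for Z :: "nat \<Rightarrow> nat \<Rightarrow> 'a \<Rightarrow> real"
    proof -
      have "integrable M (\<lambda>\<omega>. (Z i j \<omega>)\<^sup>2 * of_bool (\<bar>Z i j \<omega>\<bar> \<ge> \<tau> * sqrt (real n)))"
        using Z(1) by (intro integrable_bounded_mult[OF Z(2), where B=1]) auto
      then show ?thesis using Z(2,3) by (simp add: r_def tail_moment_def)
    qed
    show "2 * (2 / ((real n)\<^sup>2 * ?v ^ 3)) * cond_var_dev n (fst (i, j)) (snd (i, j))
        + expectation (\<lambda>\<omega>. r (X (fst (i, j)) (snd (i, j)) \<omega>)) + expectation (\<lambda>\<omega>. r (Y (fst (i, j)) (snd (i, j)) \<omega>))
      = (4 / ?v ^ 3 * cond_var_dev n i j + 4 * \<tau> / ?v ^ 4 * (\<sigma> i j)\<^sup>2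
        + 4 / ?v ^ 3 * (tail_moment X \<tau> n i j + tail_moment Y \<tau> n i j)) / (real n)\<^sup>2"
      using er[of X] er[of Y] ij rv X_sq_int Y_sq_int X_var Y_var
      by (simp add: add_divide_distrib distrib_left mult.commute[of "(real n)\<^sup>2"])
  qed
  \<comment> \<open>All terms are nonnegative, so the sum over upper pairs may be enlarged to the
    full square, over which the hypotheses are normalised.\<close>
  also have "\<dots> \<le> (\<Sum>(i, j)\<in>{1..n} \<times> {1..n}. (4 / ?v ^ 3 * cond_var_dev n i j + 4 * \<tau> / ?v ^ 4 * (\<sigma> i j)\<^sup>2
        + 4 / ?v ^ 3 * (tail_moment X \<tau> n i j + tail_moment Y \<tau> n i j)) / (real n)\<^sup>2)"
    using z \<tau> cond_var_dev_nonneg tail_moment_nonneg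
    by (intro sum_mono2 upper_pairs_subset) (auto intro!: divide_nonneg_nonneg add_nonneg_nonneg mult_nonneg_nonneg)
  also have "\<dots> = 1 / (real n)\<^sup>2 * (\<Sum>i=1..n. \<Sum>j=1..n. 4 / ?v ^ 3 * cond_var_dev n i j + 4 * \<tau> / ?v ^ 4 * (\<sigma> i j)\<^sup>2
        + 4 / ?v ^ 3 * (tail_moment X \<tau> n i j + tail_moment Y \<tau> n i j))"
    by (simp only: sum.cartesian_product[symmetric] sum_divide_distrib[symmetric] mult_1_left times_divide_eq_left)
  finally have "\<bar>expectation (\<lambda>\<omega>. poisson_trace n z (sym_array (YP \<omega>)))
       - expectation (\<lambda>\<omega>. poisson_trace n z (sym_array (XP \<omega>)))\<bar>
    \<le> 1 / (real n)\<^sup>2 * (\<Sum>i=1..n. \<Sum>j=1..n. 4 / ?v ^ 3 * cond_var_dev n i j + 4 * \<tau> / ?v ^ 4 * (\<sigma> i j)\<^sup>2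
        + 4 / ?v ^ 3 * (tail_moment X \<tau> n i j + tail_moment Y \<tau> n i j))" .
  moreover have "poisson_trace n z (sym_array (XP \<omega>)) = poisson_trace n z (random_matrix X n \<omega>)"
    "poisson_trace n z (sym_array (YP \<omega>)) = poisson_trace n z (random_matrix Y n \<omega>)" for \<omega>
    unfolding poisson_trace_def
    using scaled_matrix_random_matrix[of X n \<omega>] scaled_matrix_random_matrix[of Y n \<omega>] X_sym Y_sym by auto
  ultimately show ?thesis by (simp only:)
qed

end

section \<open>Cauchy smoothing of the mean spectral distribution\<close>

definition cauchy_cdf :: "real \<Rightarrow> real" where
  "cauchy_cdf t = 1 / 2 + arctan t / pi"

lemma cauchy_cdf_bounds: "0 \<le> cauchy_cdf t" "cauchy_cdf t \<le> 1"
  using arctan_bounded[of t] by (auto simp: cauchy_cdf_def field_simps)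

lemma cauchy_cdf_mono: "s \<le> t \<Longrightarrow> cauchy_cdf s \<le> cauchy_cdf t"
  by (auto simp: cauchy_cdf_def divide_right_mono arctan_le_iff)

lemma cauchy_cdf_minus: "cauchy_cdf (- t) = 1 - cauchy_cdf t"
  by (simp add: cauchy_cdf_def arctan_minus)

text \<open>The Cauchy density of scale \<open>v\<close> about \<open>y\<close>, left without its
  factor 1 / pi so that it is exactly the imaginary part of one term of the resolvent trace.\<close>

definition poisson_kernel :: "real \<Rightarrow> real \<Rightarrow> real \<Rightarrow> real" where
  "poisson_kernel v y u = v / ((y - u)\<^sup>2 + v\<^sup>2)"

lemma Im_inverse_shift: "v > 0 \<Longrightarrow> Im (1 / (complex_of_real y - Complex u v)) = poisson_kernel v y u"
  by (simp add: Im_divide poisson_kernel_def power2_eq_square)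

lemma has_bochner_integral_poisson_kernel:
  assumes "v > 0" "a \<le> b"
  shows "has_bochner_integral lborel (\<lambda>u. poisson_kernel v y u * indicator {a..b} u)
    (pi * (cauchy_cdf ((b - y) / v) - cauchy_cdf ((a - y) / v)))"
proof -
  have "((\<lambda>u. arctan ((u - y) / v)) has_real_derivative poisson_kernel v y u) (at u)" for u
    using assms(1) unfolding poisson_kernel_def
    by (auto intro!: derivative_eq_intros simp: field_simps power2_eq_square)
  moreover have "isCont (poisson_kernel v y) u" for u
  proof -
    have "(y - u)\<^sup>2 + v\<^sup>2 > 0" using assms(1) by (simp add: add_nonneg_pos)
    then show ?thesis unfolding poisson_kernel_def by (intro continuous_intros) auto
  qed
  ultimately have "has_bochner_integral lborel (\<lambda>u. poisson_kernel v y u * indicator {a..b} u)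
     (arctan ((b - y) / v) - arctan ((a - y) / v))"
    by (intro has_bochner_integral_FTC_Icc_real assms)
  then show ?thesis by (simp add: cauchy_cdf_def diff_divide_distrib[symmetric])
qed

text \<open>A Cauchy variable of scale \<open>v\<close> is within \<open>e\<close> of its centre up to probability \<open>2 \<eta>\<close>, where
  \<open>\<eta> = 1 - cauchy_cdf (e / v)\<close>.\<close>

lemma indicator_le_cauchy_increment:
  assumes "v > 0"
  shows "of_bool (y \<le> b - e) \<le> (cauchy_cdf ((b - y) / v) - cauchy_cdf ((a - y) / v))
     + 2 * (1 - cauchy_cdf (e / v)) + of_bool (y \<le> a + e)"
proof -
  have 1: "of_bool (y \<le> b - e) \<le> cauchy_cdf ((b - y) / v) + (1 - cauchy_cdf (e / v))"
    using cauchy_cdf_bounds[of "(b - y) / v"] cauchy_cdf_bounds[of "e / v"]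
      cauchy_cdf_mono[of "e / v" "(b - y) / v"] assms
    by (auto simp: divide_right_mono)
  have 2: "cauchy_cdf ((a - y) / v) \<le> of_bool (y \<le> a + e) + (1 - cauchy_cdf (e / v))"
    using cauchy_cdf_bounds[of "(a - y) / v"] cauchy_cdf_bounds[of "e / v"]
      cauchy_cdf_mono[of "(a - y) / v" "- (e / v)"] assms
    by (auto simp: cauchy_cdf_minus divide_le_eq simp flip: minus_divide_left)
  show ?thesis using 1 2 by (simp add: algebra_simps)
qed

text \<open>For \<open>y > b + e\<close> the first term is at most
  \<open>1 - cauchy_cdf (e / v)\<close>; otherwise the increment is at most 1. The subtracted term
  only helps, so one error suffices where the reverse inequality pays at both endpoints.\<close>

lemma cauchy_increment_le_indicator:
  assumes "v > 0"
  shows "cauchy_cdf ((b - y) / v) - cauchy_cdf ((a - y) / v) \<le> of_bool (y \<le> b + e) + (1 - cauchy_cdf (e / v))"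
  using cauchy_cdf_bounds[of "(b - y) / v"] cauchy_cdf_bounds[of "e / v"] cauchy_cdf_bounds[of "(a - y) / v"]
    cauchy_cdf_mono[of "(b - y) / v" "- (e / v)"] assms
  by (auto simp: cauchy_cdf_minus divide_le_eq simp flip: minus_divide_left)

lemma cauchy_cdf_at_top: "(cauchy_cdf \<longlongrightarrow> 1) at_top" and cauchy_cdf_at_bot: "(cauchy_cdf \<longlongrightarrow> 0) at_bot"
  using tendsto_add[OF tendsto_const tendsto_divide[OF tendsto_arctan_at_top tendsto_const], of pi "1/2"]
    tendsto_add[OF tendsto_const tendsto_divide[OF tendsto_arctan_at_bot tendsto_const], of pi "1/2"]
  by (simp_all add: cauchy_cdf_def[abs_def])

text \<open>The right endpoint exceeds \<open>x\<close> by 1 / m while the scale shrinks as 1 / m^2,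
  so at \<open>y = x\<close> the argument still tends to infinity and the limit is 1, as the closed
  condition \<open>y \<le> x\<close> demands. The left endpoint recedes with \<open>m\<close>. This
  makes the spectral distribution function a limit of smoothed increments.\<close>

lemma cauchy_increment_tendsto_indicator:
  "(\<lambda>m. cauchy_cdf ((x + 1 / real m - y) / (1 / (real m)\<^sup>2)) - cauchy_cdf ((- real m - y) / (1 / (real m)\<^sup>2)))
    \<longlonglongrightarrow> of_bool (y \<le> x)"
proof -
  have lower: "filterlim (\<lambda>m. (- real m - y) / (1 / (real m)\<^sup>2)) at_bot sequentially"
    by real_asymp
  have low: "(\<lambda>m. cauchy_cdf ((- real m - y) / (1 / (real m)\<^sup>2))) \<longlonglongrightarrow> 0"
    by (rule filterlim_compose[OF cauchy_cdf_at_bot lower])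
  define c where "c = x - y"
  have "(\<lambda>m. cauchy_cdf ((x + 1 / real m - y) / (1 / (real m)\<^sup>2))) \<longlonglongrightarrow> of_bool (y \<le> x)"
  proof (cases "y \<le> x")
    case True
    have "filterlim (\<lambda>m. (c + 1 / real m) / (1 / (real m)\<^sup>2)) at_top sequentially"
    \<comment> \<open>At \<open>c = 0\<close> the argument comes from the offset alone and equals
      \<open>m\<close>.\<close>
    proof (cases "c = 0")
      case True
      show ?thesis unfolding True by real_asymp
    next
      case False
      with \<open>y \<le> x\<close> have "c > 0" by (simp add: c_def)
      then show ?thesis by real_asymp
    qed
    then have "filterlim (\<lambda>m. (x + 1 / real m - y) / (1 / (real m)\<^sup>2)) at_top sequentially"
      by (simp add: c_def algebra_simps)
    then show ?thesis using filterlim_compose[OF cauchy_cdf_at_top] True by fastforce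
  next
    case False
    then have "c < 0" by (simp add: c_def)
    then have "filterlim (\<lambda>m. (c + 1 / real m) / (1 / (real m)\<^sup>2)) at_bot sequentially"
      by real_asymp
    then have "filterlim (\<lambda>m. (x + 1 / real m - y) / (1 / (real m)\<^sup>2)) at_bot sequentially"
      by (simp add: c_def algebra_simps)
    then show ?thesis using filterlim_compose[OF cauchy_cdf_at_bot] False by fastforce
  qed
  from tendsto_diff[OF this low] show ?thesis by simp
qed

text \<open>As a monotone linear functional of \<open>g\<close>, this carries pointwise inequalities
  between functions of one real variable over to spectral distributions.\<close>

definition lin_stat :: "nat \<Rightarrow> (nat \<times> nat \<Rightarrow> real) \<Rightarrow> (real \<Rightarrow> real) \<Rightarrow> real" where
  "lin_stat n a g = (\<Sum>i<n. g (sorted_eigenvalues (scaled_matrix n a) ! i)) / real n"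

lemma emp_spectral_cdf_lin_stat: "emp_spectral_cdf n a x = lin_stat n a (\<lambda>y. of_bool (y \<le> x))"
proof -
  have "(\<Sum>i=1..n. of_bool (f (i - 1) \<le> x)) = (\<Sum>i<n. of_bool (f i \<le> x) :: real)" for f :: "nat \<Rightarrow> real"
    by (rule sum.reindex_bij_witness[of _ Suc "\<lambda>i. i - 1"]) auto
  then show ?thesis
    by (simp add: emp_spectral_cdf_def lin_stat_def scaled_matrix_def Let_def)
qed

lemma lin_stat_mono: "(\<And>y. g y \<le> h y) \<Longrightarrow> lin_stat n a g \<le> lin_stat n a h"
  by (simp add: lin_stat_def divide_right_mono sum_mono)

lemma lin_stat_add: "lin_stat n a (\<lambda>y. g y + h y) = lin_stat n a g + lin_stat n a h"
  by (simp add: lin_stat_def sum.distrib add_divide_distrib)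

lemma lin_stat_const: "0 < n \<Longrightarrow> lin_stat n a (\<lambda>y. c) = c"
  by (simp add: lin_stat_def)

lemma lin_stat_cmult: "lin_stat n a (\<lambda>y. c * g y) = c * lin_stat n a g"
  by (simp add: lin_stat_def sum_distrib_left)

text \<open>Links the spectral second moment, which controls tails, to the moments of the entries.
  One factor 1 / n is the mean over eigenvalues, the other comes from the scaling of the
  matrix.\<close>

lemma lin_stat_square:
  assumes "\<And>i j. i \<in> {1..n} \<Longrightarrow> j \<in> {1..n} \<Longrightarrow> a (i, j) = a (j, i)"
  shows "lin_stat n a (\<lambda>y. y\<^sup>2) = 1 / (real n)\<^sup>2 * (\<Sum>i=1..n. \<Sum>j=1..n. (a (i, j))\<^sup>2)"
proof -
  have "(\<Sum>i<n. (sorted_eigenvalues (scaled_matrix n a) ! i)\<^sup>2) = (\<Sum>i<n. \<Sum>j<n. (scaled_matrix n a $$ (i, j))\<^sup>2)"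
    by (rule sum_sorted_eigenvalues_square[OF scaled_matrix_carrier sym_mat_scaled_matrix[of n a, OF assms]])
  also have "\<dots> = (\<Sum>i<n. \<Sum>j<n. (a (Suc i, Suc j))\<^sup>2 / real n)"
    by (intro sum.cong refl) (simp add: scaled_matrix_index power_divide)
  also have "\<dots> = (\<Sum>i=1..n. \<Sum>j=1..n. (a (i, j))\<^sup>2 / real n)"
    by (simp only: One_nat_def lessThan_atLeast0 sum.atLeast_Suc_atMost_Suc_shift sum.shift_bounds_Suc_ivl
        atLeastLessThanSuc_atLeastAtMost[symmetric] comp_def)
  finally show ?thesis by (simp add: lin_stat_def power2_eq_square flip: sum_divide_distrib)
qed

lemma poisson_trace_lin_stat:
  assumes v: "v > 0" and "\<And>i j. i \<in> {1..n} \<Longrightarrow> j \<in> {1..n} \<Longrightarrow> a (i, j) = a (j, i)"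
  shows "poisson_trace n (Complex u v) a = lin_stat n a (\<lambda>y. poisson_kernel v y u)"
  using trace_resolvent_eigenvalues[OF scaled_matrix_carrier sym_mat_scaled_matrix[of n a, OF assms(2)], of "Complex u v"] v
  by (simp add: poisson_trace_def lin_stat_def Im_inverse_shift del: Im_divide)

lemma has_bochner_integral_poisson_trace:
  assumes v: "v > 0" "a \<le> b" and sym: "\<And>i j. i \<in> {1..n} \<Longrightarrow> j \<in> {1..n} \<Longrightarrow> A (i, j) = A (j, i)"
  shows "has_bochner_integral lborel (\<lambda>u. poisson_trace n (Complex u v) A * indicator {a..b} u)
    (pi * lin_stat n A (\<lambda>y. cauchy_cdf ((b - y) / v) - cauchy_cdf ((a - y) / v)))"
proof -
  let ?y = "\<lambda>i. sorted_eigenvalues (scaled_matrix n A) ! i"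
  have "has_bochner_integral lborel (\<lambda>u. (\<Sum>i<n. poisson_kernel v (?y i) u * indicator {a..b} u) / real n)
    ((\<Sum>i<n. pi * (cauchy_cdf ((b - ?y i) / v) - cauchy_cdf ((a - ?y i) / v))) / real n)"
    by (intro has_bochner_integral_divide_zero has_bochner_integral_sum has_bochner_integral_poisson_kernel v)
  moreover have "poisson_trace n (Complex u v) A = lin_stat n A (\<lambda>y. poisson_kernel v y u)" for u
    by (rule poisson_trace_lin_stat[OF v(1)]) (rule sym)
  ultimately show ?thesis
    by (simp only: lin_stat_def sum_distrib_left sum_distrib_right times_divide_eq_left times_divide_eq_right)
qed

section \<open>Mean spectral distribution of one random symmetric matrix\<close>

locale random_sym_matrix = prob_space M for M :: "'a measure" +
  fixes n :: nat and A :: "'a \<Rightarrow> nat \<times> nat \<Rightarrow> real"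
  assumes n: "0 < n"
    and sym: "\<And>\<omega> i j. i \<in> {1..n} \<Longrightarrow> j \<in> {1..n} \<Longrightarrow> A \<omega> (i, j) = A \<omega> (j, i)"
    and rv: "\<And>i j. i \<in> {1..n} \<Longrightarrow> j \<in> {1..n} \<Longrightarrow> (\<lambda>\<omega>. A \<omega> (i, j)) \<in> borel_measurable M"
    and sq: "\<And>i j. i \<in> {1..n} \<Longrightarrow> j \<in> {1..n} \<Longrightarrow> integrable M (\<lambda>\<omega>. (A \<omega> (i, j))\<^sup>2)"
begin

definition mean_cdf :: "real \<Rightarrow> real" where
  "mean_cdf x = expectation (\<lambda>\<omega>. emp_spectral_cdf n (A \<omega>) x)"

text \<open>For \<open>a \<le> b\<close>, the mass that the mean spectral distribution, convolved
  with the Cauchy law of scale \<open>v\<close>, gives to the interval from \<open>a\<close> to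
  \<open>b\<close>. The interval is bounded because a bound uniform in \<open>u\<close> integrates
  to something finite only there.\<close>

definition smoothed :: "real \<Rightarrow> real \<Rightarrow> real \<Rightarrow> real" where
  "smoothed v a b = expectation (\<lambda>\<omega>. lin_stat n (A \<omega>) (\<lambda>y. cauchy_cdf ((b - y) / v) - cauchy_cdf ((a - y) / v)))"

lemma poisson_trace_joint_measurable:
  "(\<lambda>(\<omega>, u). poisson_trace n (Complex u v) (A \<omega>)) \<in> borel_measurable (M \<Otimes>\<^sub>M lborel)"
  unfolding split_beta
proof (rule poisson_trace_measurable(1))
  show "(\<lambda>w. A (fst w) (i, j)) \<in> borel_measurable (M \<Otimes>\<^sub>M lborel)" if "i \<in> {1..n}" "j \<in> {1..n}" for i j
    by (rule measurable_compose[OF measurable_fst rv[OF that]])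
  have "(\<lambda>w. complex_of_real (snd w) + complex_of_real v * \<i>) \<in> borel_measurable (M \<Otimes>\<^sub>M lborel)" by measurable
  then show "(\<lambda>w. Complex (snd w) v) \<in> borel_measurable (M \<Otimes>\<^sub>M lborel)"
    by (simp add: Complex_eq mult.commute)
qed

text \<open>Individual eigenvalues are not shown measurable: up to the factor pi, the increment is
  the \<open>u\<close>-integral of the jointly measurable Poisson trace.\<close>

lemma increment_measurable:
  assumes "v > 0" "a \<le> b"
  shows "(\<lambda>\<omega>. lin_stat n (A \<omega>) (\<lambda>y. cauchy_cdf ((b - y) / v) - cauchy_cdf ((a - y) / v))) \<in> borel_measurable M"
proof -
  note [measurable] = poisson_trace_joint_measurable[of v]
  have "(\<lambda>\<omega>. \<integral>u. poisson_trace n (Complex u v) (A \<omega>) * indicator {a..b} u \<partial>lborel) \<in> borel_measurable M"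
    by measurable
  moreover have "(\<integral>u. poisson_trace n (Complex u v) (A \<omega>) * indicator {a..b} u \<partial>lborel)
      = pi * lin_stat n (A \<omega>) (\<lambda>y. cauchy_cdf ((b - y) / v) - cauchy_cdf ((a - y) / v))" for \<omega>
    using has_bochner_integral_poisson_trace[OF assms, of n "A \<omega>"] sym by (auto dest: has_bochner_integral_integral_eq)
  ultimately have "(\<lambda>\<omega>. pi * lin_stat n (A \<omega>) (\<lambda>y. cauchy_cdf ((b - y) / v) - cauchy_cdf ((a - y) / v)) / pi) \<in> borel_measurable M"
    by (intro borel_measurable_divide) auto
  then show ?thesis by simp
qed

text \<open>Fubini, licensed by the bound 1 / v for the Poisson trace and the finite length of the
  interval. The integrability statement permits subtracting two such integrals when the matrices are
  compared.\<close>

lemma smoothed_eq_integral: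
  assumes "v > 0" "a \<le> b"
  shows "smoothed v a b = (\<integral>u. expectation (\<lambda>\<omega>. poisson_trace n (Complex u v) (A \<omega>)) * indicator {a..b} u \<partial>lborel) / pi"
    and "integrable lborel (\<lambda>u. expectation (\<lambda>\<omega>. poisson_trace n (Complex u v) (A \<omega>)) * indicator {a..b} u)"
proof -
  interpret P: pair_sigma_finite M lborel ..
  let ?f = "\<lambda>\<omega> u. poisson_trace n (Complex u v) (A \<omega>) * indicator {a..b} u"
  note [measurable] = poisson_trace_joint_measurable[of v]
  have m: "case_prod ?f \<in> borel_measurable (M \<Otimes>\<^sub>M lborel)" by measurable
  have bound: "\<bar>?f \<omega> u\<bar> \<le> 1 / v * indicator {a..b} u" for \<omega> u
    using abs_poisson_trace_le[OF n, of "Complex u v" "A \<omega>"] assms(1) sym by (auto simp: indicator_def)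
  have int: "integrable (M \<Otimes>\<^sub>M lborel) (case_prod ?f)"
  proof (rule P.Fubini_integrable[OF m])
    show "AE \<omega> in M. integrable lborel (\<lambda>u. case_prod ?f (\<omega>, u))"
      using has_bochner_integral_poisson_trace[OF assms, of n] sym
      by (auto simp: has_bochner_integral_iff)
    have "(\<integral>u. norm (?f \<omega> u) \<partial>lborel) \<le> 1 / v * (b - a)" for \<omega>
    proof -
      have "(\<integral>u. norm (?f \<omega> u) \<partial>lborel) \<le> (\<integral>u. 1 / v * indicator {a..b} u \<partial>lborel)"
        using has_bochner_integral_poisson_trace[OF assms, of n "A \<omega>"] sym bound assms
        by (intro integral_mono) (auto simp: has_bochner_integral_iff simp del: times_divide_eq_left)
      then show ?thesis using assms by simp
    qed
    then show "integrable M (\<lambda>\<omega>. \<integral>u. norm (case_prod ?f (\<omega>, u)) \<partial>lborel)"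
      by (intro integrable_const_bound[where B="1 / v * (b - a)"]) auto
  qed
  have "pi * smoothed v a b = expectation (\<lambda>\<omega>. \<integral>u. ?f \<omega> u \<partial>lborel)"
  proof -
    have "(\<integral>u. ?f \<omega> u \<partial>lborel) = pi * lin_stat n (A \<omega>) (\<lambda>y. cauchy_cdf ((b - y) / v) - cauchy_cdf ((a - y) / v))" for \<omega>
      using has_bochner_integral_poisson_trace[OF assms, of n "A \<omega>"] sym
      by (auto dest: has_bochner_integral_integral_eq)
    then show ?thesis unfolding smoothed_def by (simp only: integral_mult_right_zero)
  qed
  also have "\<dots> = (\<integral>u. expectation (\<lambda>\<omega>. ?f \<omega> u) \<partial>lborel)"
    by (rule P.Fubini_integral[symmetric, OF int])
  finally show "smoothed v a b = (\<integral>u. expectation (\<lambda>\<omega>. poisson_trace n (Complex u v) (A \<omega>)) * indicator {a..b} u \<partial>lborel) / pi"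
    by (simp add: field_simps)
  show "integrable lborel (\<lambda>u. expectation (\<lambda>\<omega>. poisson_trace n (Complex u v) (A \<omega>)) * indicator {a..b} u)"
    using P.integrable_snd[OF int] by simp
qed

lemma lin_stat_bounds:
  assumes "\<And>y. l \<le> g y" "\<And>y. g y \<le> h"
  shows "l \<le> lin_stat n (A \<omega>) g" "lin_stat n (A \<omega>) g \<le> h"
  using lin_stat_mono[of "\<lambda>y. l" g n "A \<omega>"] lin_stat_mono[of g "\<lambda>y. h" n "A \<omega>"] assms n
  by (auto simp: lin_stat_const)

lemma emp_cdf_measurable: "(\<lambda>\<omega>. emp_spectral_cdf n (A \<omega>) x) \<in> borel_measurable M"
proof (rule borel_measurable_LIMSEQ_metric)
  \<comment> \<open>Starting the sequence at \<open>N\<close> keeps the left endpoint below the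
    right one and the scale positive from the first term on.\<close>
  define N where "N = Suc (nat \<lceil>\<bar>x\<bar>\<rceil>)"
  let ?g = "\<lambda>m y. cauchy_cdf ((x + 1 / real m - y) / (1 / (real m)\<^sup>2)) - cauchy_cdf ((- real m - y) / (1 / (real m)\<^sup>2))"
  show "(\<lambda>\<omega>. lin_stat n (A \<omega>) (?g (m + N))) \<in> borel_measurable M" for m
  proof (rule increment_measurable)
    have "\<bar>x\<bar> \<le> real (m + N)" unfolding N_def by linarith
    moreover have "0 \<le> 1 / real (m + N)" by simp
    ultimately show "- real (m + N) \<le> x + 1 / real (m + N)" by linarith
    have "0 < m + N" by (simp add: N_def)
    then show "0 < 1 / (real (m + N))\<^sup>2" by (simp del: of_nat_add)
  qed
  show "(\<lambda>m. lin_stat n (A \<omega>) (?g (m + N))) \<longlonglongrightarrow> emp_spectral_cdf n (A \<omega>) x" for \<omega>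
    unfolding emp_spectral_cdf_lin_stat lin_stat_def
    by (rule LIMSEQ_ignore_initial_segment)
      (intro tendsto_divide tendsto_sum cauchy_increment_tendsto_indicator tendsto_const, use n in simp)
qed

lemma emp_cdf_bounds: "0 \<le> emp_spectral_cdf n (A \<omega>) x" "emp_spectral_cdf n (A \<omega>) x \<le> 1"
  unfolding emp_spectral_cdf_lin_stat by (auto intro!: lin_stat_bounds)

lemma emp_cdf_integrable: "integrable M (\<lambda>\<omega>. emp_spectral_cdf n (A \<omega>) x)"
  using emp_cdf_measurable emp_cdf_bounds by (intro integrable_const_bound[where B=1]) auto

lemma mean_cdf_bounds: "0 \<le> mean_cdf x" "mean_cdf x \<le> 1"
  using emp_cdf_bounds integral_mono[OF emp_cdf_integrable, of "\<lambda>_. 1" x]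
  by (auto simp: mean_cdf_def prob_space)

lemma mean_cdf_mono: "x \<le> y \<Longrightarrow> mean_cdf x \<le> mean_cdf y"
  unfolding mean_cdf_def emp_spectral_cdf_lin_stat
  using emp_cdf_integrable unfolding emp_spectral_cdf_lin_stat
  by (intro integral_mono lin_stat_mono) auto

lemma increment_integrable:
  assumes "v > 0" "a \<le> b"
  shows "integrable M (\<lambda>\<omega>. lin_stat n (A \<omega>) (\<lambda>y. cauchy_cdf ((b - y) / v) - cauchy_cdf ((a - y) / v)))"
proof (rule integrable_const_bound[where B=1])
  have "-1 \<le> cauchy_cdf s - cauchy_cdf t" "cauchy_cdf s - cauchy_cdf t \<le> 1" for s t
    using cauchy_cdf_bounds[of s] cauchy_cdf_bounds[of t] by linarith+
  then have "-1 \<le> lin_stat n (A \<omega>) (\<lambda>y. cauchy_cdf ((b - y) / v) - cauchy_cdf ((a - y) / v))"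
    "lin_stat n (A \<omega>) (\<lambda>y. cauchy_cdf ((b - y) / v) - cauchy_cdf ((a - y) / v)) \<le> 1" for \<omega>
    by (auto intro!: lin_stat_bounds)
  then show "AE \<omega> in M. norm (lin_stat n (A \<omega>) (\<lambda>y. cauchy_cdf ((b - y) / v) - cauchy_cdf ((a - y) / v))) \<le> 1"
    by (auto simp: abs_le_iff minus_le_iff)
qed (rule increment_measurable[OF assms])

lemma mean_cdf_le_smoothed:
  assumes "v > 0" "a \<le> b"
  shows "mean_cdf (b - e) \<le> smoothed v a b + 2 * (1 - cauchy_cdf (e / v)) + mean_cdf (a + e)"
proof -
  let ?I = "\<lambda>\<omega>. lin_stat n (A \<omega>) (\<lambda>y. cauchy_cdf ((b - y) / v) - cauchy_cdf ((a - y) / v))"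
  have "emp_spectral_cdf n (A \<omega>) (b - e) \<le> ?I \<omega> + 2 * (1 - cauchy_cdf (e / v)) + emp_spectral_cdf n (A \<omega>) (a + e)" for \<omega>
    using lin_stat_mono[OF indicator_le_cauchy_increment[OF assms(1), where b=b and a=a and e=e], of n "A \<omega>"]
    by (simp add: emp_spectral_cdf_lin_stat lin_stat_add lin_stat_const[OF n])
  then have "mean_cdf (b - e) \<le> expectation (\<lambda>\<omega>. ?I \<omega> + 2 * (1 - cauchy_cdf (e / v)) + emp_spectral_cdf n (A \<omega>) (a + e))"
    unfolding mean_cdf_def using increment_integrable[OF assms] emp_cdf_integrable
    by (intro integral_mono) auto
  then show ?thesis
    using increment_integrable[OF assms] emp_cdf_integrable
    by (simp add: mean_cdf_def smoothed_def prob_space)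
qed

lemma smoothed_le_mean_cdf:
  assumes "v > 0" "a \<le> b"
  shows "smoothed v a b \<le> mean_cdf (b + e) + (1 - cauchy_cdf (e / v))"
proof -
  let ?I = "\<lambda>\<omega>. lin_stat n (A \<omega>) (\<lambda>y. cauchy_cdf ((b - y) / v) - cauchy_cdf ((a - y) / v))"
  have "?I \<omega> \<le> emp_spectral_cdf n (A \<omega>) (b + e) + (1 - cauchy_cdf (e / v))" for \<omega>
    using lin_stat_mono[OF cauchy_increment_le_indicator[OF assms(1), where b=b and a=a and e=e], of n "A \<omega>"]
    by (simp add: emp_spectral_cdf_lin_stat lin_stat_add lin_stat_const[OF n])
  then have "smoothed v a b \<le> expectation (\<lambda>\<omega>. emp_spectral_cdf n (A \<omega>) (b + e) + (1 - cauchy_cdf (e / v)))"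
    unfolding smoothed_def using increment_integrable[OF assms] emp_cdf_integrable
    by (intro integral_mono) auto
  then show ?thesis using emp_cdf_integrable by (simp add: mean_cdf_def prob_space)
qed

text \<open>Chebyshev's inequality for the mean spectral distribution, with \<open>S\<close> its
  second moment.\<close>

lemma mean_cdf_tails:
  assumes "K > 0"
  defines "S \<equiv> 1 / (real n)\<^sup>2 * (\<Sum>i=1..n. \<Sum>j=1..n. expectation (\<lambda>\<omega>. (A \<omega> (i, j))\<^sup>2))"
  shows "mean_cdf (- K) \<le> S / K\<^sup>2" "1 - mean_cdf K \<le> S / K\<^sup>2"
proof -
  let ?Q = "\<lambda>\<omega>. lin_stat n (A \<omega>) (\<lambda>y. y\<^sup>2)"
  have Q: "?Q \<omega> = 1 / (real n)\<^sup>2 * (\<Sum>i=1..n. \<Sum>j=1..n. (A \<omega> (i, j))\<^sup>2)" for \<omega>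
    by (rule lin_stat_square[of n "A \<omega>", OF sym])
  have iQ: "integrable M ?Q" unfolding Q
    by (intro Bochner_Integration.integrable_sum Bochner_Integration.integrable_mult_right sq)
  have "expectation ?Q = 1 / (real n)\<^sup>2 * (\<Sum>i=1..n. expectation (\<lambda>\<omega>. \<Sum>j=1..n. (A \<omega> (i, j))\<^sup>2))"
    unfolding Q by (subst Bochner_Integration.integral_mult_right_zero, subst Bochner_Integration.integral_sum)
      (auto intro!: Bochner_Integration.integrable_sum sq)
  also have "\<dots> = S" unfolding S_def
    by (intro arg_cong2[of _ _ _ _ times] sum.cong refl Bochner_Integration.integral_sum sq) auto
  finally have EQ: "expectation ?Q = S" .
  have K2: "1 \<le> y\<^sup>2 / K\<^sup>2" if "\<bar>y\<bar> \<ge> K" for y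
    using that assms(1) power_mono[of K "\<bar>y\<bar>" 2] by (simp add: field_simps)
  have 1: "of_bool (y \<le> - K) \<le> 1 / K\<^sup>2 * y\<^sup>2" for y using K2[of y] by auto
  have 2: "1 \<le> 1 / K\<^sup>2 * y\<^sup>2 + of_bool (y \<le> K)" for y using K2[of y] by auto
  have "emp_spectral_cdf n (A \<omega>) (- K) \<le> 1 / K\<^sup>2 * ?Q \<omega>" for \<omega>
    unfolding emp_spectral_cdf_lin_stat lin_stat_cmult[symmetric] by (rule lin_stat_mono[OF 1])
  then have "mean_cdf (- K) \<le> expectation (\<lambda>\<omega>. 1 / K\<^sup>2 * ?Q \<omega>)"
    unfolding mean_cdf_def using emp_cdf_integrable iQ by (intro integral_mono) auto
  then show "mean_cdf (- K) \<le> S / K\<^sup>2" by (simp add: EQ)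
  have "1 \<le> 1 / K\<^sup>2 * ?Q \<omega> + emp_spectral_cdf n (A \<omega>) K" for \<omega>
    unfolding emp_spectral_cdf_lin_stat lin_stat_cmult[symmetric] lin_stat_add[symmetric]
    using lin_stat_mono[of "\<lambda>_. 1" _ n "A \<omega>", OF 2] by (simp only: lin_stat_const[OF n])
  then have "expectation (\<lambda>\<omega>. 1) \<le> expectation (\<lambda>\<omega>. 1 / K\<^sup>2 * ?Q \<omega> + emp_spectral_cdf n (A \<omega>) K)"
    using emp_cdf_integrable iQ by (intro integral_mono) auto
  then show "1 - mean_cdf K \<le> S / K\<^sup>2"
    using emp_cdf_integrable iQ by (simp add: EQ mean_cdf_def prob_space)
qed

end

section \<open>Levy distance\<close>

text \<open>The two hypotheses are one-sided and symmetric in \<open>F\<close> and \<open>G\<close>;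
  shifting the second by \<open>\<epsilon>\<close> gives the upper half of the Levy condition. The
  witness also makes the set nonempty, so that its infimum is meaningful.\<close>

lemma levy_dist_le:
  assumes "\<epsilon> > 0" "\<And>x. F (x - \<epsilon>) \<le> G x + \<epsilon>" "\<And>x. G (x - \<epsilon>) \<le> F x + \<epsilon>"
  shows "0 \<le> levy_dist F G" "levy_dist F G \<le> \<epsilon>"
proof -
  let ?S = "{\<epsilon>. \<epsilon> > 0 \<and> (\<forall>x. F (x - \<epsilon>) - \<epsilon> \<le> G x \<and> G x \<le> F (x + \<epsilon>) + \<epsilon>)}"
  have "F (x - \<epsilon>) - \<epsilon> \<le> G x \<and> G x \<le> F (x + \<epsilon>) + \<epsilon>" for x
    using assms(2)[of x] assms(3)[of "x + \<epsilon>"] by simp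
  then have "\<epsilon> \<in> ?S" using assms(1) by simp
  moreover have "bdd_below ?S" by (intro bdd_belowI[of _ 0]) auto
  ultimately show "levy_dist F G \<le> \<epsilon>" unfolding levy_dist_def by (rule cInf_lower)
  show "0 \<le> levy_dist F G" unfolding levy_dist_def
    using \<open>\<epsilon> \<in> ?S\<close> by (intro cInf_greatest) auto
qed

text \<open>\<open>I\<close> and \<open>J\<close> are the smoothed masses belonging to
  \<open>F\<close> and \<open>G\<close>. For \<open>x\<close> between \<open>- K\<close> and
  \<open>K\<close> both are taken over an interval of length at most \<open>2 * K\<close>; elsewhere
  the tail bounds decide alone. Of the three \<open>\<eta>\<close>, two pay for removing the
  smoothing from \<open>F\<close> and one for \<open>G\<close>.\<close>

lemma cdf_le_of_smoothed_close:
  fixes F G :: "real \<Rightarrow> real"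
  assumes F: "mono F" "\<And>x. F x \<le> 1" and G: "mono G" "\<And>x. 0 \<le> G x"
    and FI: "\<And>a b. a \<le> b \<Longrightarrow> F (b - e) \<le> I a b + 2 * \<eta> + F (a + e)"
    and JG: "\<And>a b. a \<le> b \<Longrightarrow> J a b \<le> G (b + e) + \<eta>"
    and IJ: "\<And>a b. a \<le> b \<Longrightarrow> I a b \<le> J a b + (b - a) * \<kappa>"
    and tails: "F (- K) \<le> t" "1 - G K \<le> t"
    and nn: "0 \<le> \<eta>" "0 \<le> e" "0 \<le> \<kappa>" "0 \<le> K" "0 \<le> t"
  shows "F (x - 2 * e) \<le> G x + (3 * \<eta> + t + 2 * K * \<kappa>)"
proof -
  have K\<kappa>: "0 \<le> 2 * K * \<kappa>" using nn by simp
  consider "x < - K" | "K < x" | "- K \<le> x" "x \<le> K" by linarith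
  then show ?thesis
  proof cases
    case 1
    then have "F (x - 2 * e) \<le> F (- K)" using nn by (intro monoD[OF F(1)]) auto
    then show ?thesis using tails(1) G(2)[of x] nn K\<kappa> by linarith
  next
    case 2
    then have "G K \<le> G x" by (intro monoD[OF G(1)]) auto
    then show ?thesis using tails(2) F(2)[of "x - 2 * e"] nn K\<kappa> by linarith
  next
    case 3
    \<comment> \<open>Chosen so that \<open>?b - e\<close> is \<open>x - 2 * e\<close>,
      \<open>?a + e\<close> is \<open>- K\<close> and \<open>?b + e\<close> is
      \<open>x\<close>.\<close>
    let ?a = "- K - e" and ?b = "x - e"
    have ab: "?a \<le> ?b" using 3 by simp
    have "(?b - ?a) * \<kappa> \<le> 2 * K * \<kappa>" using 3 nn by (intro mult_right_mono) auto
    then show ?thesis using FI[OF ab] JG[OF ab] IJ[OF ab] tails(1) by simp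
  qed
qed

section \<open>Comparison of the two mean spectral distributions\<close>

context matrix_pair
begin

lemma random_sym_matrix_X: "0 < n \<Longrightarrow> random_sym_matrix M n (random_matrix X n)"
  and random_sym_matrix_Y: "0 < n \<Longrightarrow> random_sym_matrix M n (random_matrix Y n)"
proof -
  have *: "random_sym_matrix M n (random_matrix Z n)"
    if "0 < n" and Z: "\<And>i j. 1 \<le> i \<Longrightarrow> i \<le> j \<Longrightarrow> Z i j \<in> borel_measurable M"
      "\<And>i j. 1 \<le> i \<Longrightarrow> i \<le> j \<Longrightarrow> integrable M (\<lambda>\<omega>. (Z i j \<omega>)\<^sup>2)"
      "\<And>i j. 1 \<le> i \<Longrightarrow> i < j \<Longrightarrow> Z j i = Z i j" for Z
  proof unfold_locales
    have s: "Z i j = Z j i" if "i \<in> {1..n}" "j \<in> {1..n}" for i j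
      using Z(3)[of i j] Z(3)[of j i] that by (cases i j rule: linorder_cases) auto
    fix i j assume ij: "i \<in> {1..n}" "j \<in> {1..n}"
    show "random_matrix Z n \<omega> (i, j) = random_matrix Z n \<omega> (j, i)" for \<omega>
      using ij s by (simp add: random_matrix_def)
    show "(\<lambda>\<omega>. random_matrix Z n \<omega> (i, j)) \<in> borel_measurable M"
      "integrable M (\<lambda>\<omega>. (random_matrix Z n \<omega> (i, j))\<^sup>2)"
      using ij s[OF ij] Z(1)[of i j] Z(1)[of j i] Z(2)[of i j] Z(2)[of j i]
      by (cases "i \<le> j"; simp add: random_matrix_def)+
  qed (rule that(1))
  show "0 < n \<Longrightarrow> random_sym_matrix M n (random_matrix X n)" by (intro * X_rv X_sq_int X_sym)
  show "0 < n \<Longrightarrow> random_sym_matrix M n (random_matrix Y n)" by (intro * Y_rv Y_sq_int Y_sym)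
qed

text \<open>The average over \<open>i\<close> of the quantities B_i^2 in (d); it is also the second
  moment of both mean spectral distributions.\<close>

definition mean_variance :: "nat \<Rightarrow> real" where
  "mean_variance n = 1 / (real n)\<^sup>2 * (\<Sum>i=1..n. \<Sum>j=1..n. (\<sigma> i j)\<^sup>2)"

lemma second_moments:
  "1 / (real n)\<^sup>2 * (\<Sum>i=1..n. \<Sum>j=1..n. expectation (\<lambda>\<omega>. (random_matrix X n \<omega> (i, j))\<^sup>2)) = mean_variance n"
  "1 / (real n)\<^sup>2 * (\<Sum>i=1..n. \<Sum>j=1..n. expectation (\<lambda>\<omega>. (random_matrix Y n \<omega> (i, j))\<^sup>2)) = mean_variance n"
proof -
  have "expectation (\<lambda>\<omega>. (X i j \<omega>)\<^sup>2) = (\<sigma> i j)\<^sup>2" "expectation (\<lambda>\<omega>. (Y i j \<omega>)\<^sup>2) = (\<sigma> i j)\<^sup>2"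
    if "1 \<le> i" "1 \<le> j" for i j
    using that X_var[of i j] X_var[of j i] Y_var[of i j] Y_var[of j i] X_sym[of j i] Y_sym[of j i] \<sigma>_sym[of j i]
    by (cases i j rule: linorder_cases; simp)+
  then show
    "1 / (real n)\<^sup>2 * (\<Sum>i=1..n. \<Sum>j=1..n. expectation (\<lambda>\<omega>. (random_matrix X n \<omega> (i, j))\<^sup>2)) = mean_variance n"
    "1 / (real n)\<^sup>2 * (\<Sum>i=1..n. \<Sum>j=1..n. expectation (\<lambda>\<omega>. (random_matrix Y n \<omega> (i, j))\<^sup>2)) = mean_variance n"
    unfolding mean_variance_def random_matrix_def by auto
qed

text \<open>An average deviates from 1 by at most the average deviation.\<close>

lemma mean_variance_tendsto:
  assumes "(\<lambda>n. 1 / real n * (\<Sum>i=1..n. \<bar>1 / real n * (\<Sum>j=1..n. (\<sigma> i j)\<^sup>2) - 1\<bar>)) \<longlonglongrightarrow> 0"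
  shows "mean_variance \<longlonglongrightarrow> 1"
proof -
  have "\<bar>mean_variance n - 1\<bar> \<le> 1 / real n * (\<Sum>i=1..n. \<bar>1 / real n * (\<Sum>j=1..n. (\<sigma> i j)\<^sup>2) - 1\<bar>)"
    if "0 < n" for n
  proof -
    have "mean_variance n - 1 = 1 / real n * (\<Sum>i=1..n. 1 / real n * (\<Sum>j=1..n. (\<sigma> i j)\<^sup>2) - 1)"
      using that by (simp add: mean_variance_def sum_subtractf power2_eq_square field_simps flip: sum_divide_distrib)
    then show ?thesis
      using sum_abs[of "\<lambda>i. 1 / real n * (\<Sum>j=1..n. (\<sigma> i j)\<^sup>2) - 1" "{1..n}"] that
      by (simp add: abs_mult divide_right_mono)
  qed
  then have "(\<lambda>n. mean_variance n - 1) \<longlonglongrightarrow> 0"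
    by (intro Lim_null_comparison[OF _ assms] eventually_mono[OF eventually_gt_at_top[of 0]]) auto
  then show ?thesis by (simp add: LIM_zero_iff)
qed

definition poisson_gap :: "real \<Rightarrow> real \<Rightarrow> nat \<Rightarrow> real" where
  "poisson_gap v \<tau> n = 1 / (real n)\<^sup>2 * (\<Sum>i=1..n. \<Sum>j=1..n.
     4 / v ^ 3 * cond_var_dev n i j + 4 * \<tau> / v ^ 4 * (\<sigma> i j)\<^sup>2
      + 4 / v ^ 3 * (tail_moment X \<tau> n i j + tail_moment Y \<tau> n i j))"

text \<open>The three parts of \<open>err\<close> are the cost of undoing the Cauchy smoothing, the
  mass beyond \<open>K\<close> by Chebyshev, and the uniform gap integrated over an interval of
  length at most \<open>2 * K\<close>.\<close>

lemma mean_spectral_cdf_compare: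
  assumes n: "0 < n" and v: "v > 0" and \<tau>: "\<tau> > 0" and e: "e > 0" and K: "K > 0"
  defines "err \<equiv> 3 * (1 - cauchy_cdf (e / v)) + mean_variance n / K\<^sup>2 + 2 * K * poisson_gap v \<tau> n"
  shows "mean_spectral_cdf M X n (x - 2 * e) \<le> mean_spectral_cdf M Y n x + err"
    and "mean_spectral_cdf M Y n (x - 2 * e) \<le> mean_spectral_cdf M X n x + err"
proof -
  interpret AX: random_sym_matrix M n "random_matrix X n" by (rule random_sym_matrix_X[OF n])
  interpret AY: random_sym_matrix M n "random_matrix Y n" by (rule random_sym_matrix_Y[OF n])
  have cdf: "mean_spectral_cdf M X n = AX.mean_cdf" "mean_spectral_cdf M Y n = AY.mean_cdf"
    by (auto simp: mean_spectral_cdf_def AX.mean_cdf_def AY.mean_cdf_def)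
  have gap: "\<bar>AX.smoothed v a b - AY.smoothed v a b\<bar> \<le> (b - a) * poisson_gap v \<tau> n" if ab: "a \<le> b" for a b
  proof -
    let ?gX = "\<lambda>u. expectation (\<lambda>\<omega>. poisson_trace n (Complex u v) (random_matrix X n \<omega>))"
    let ?gY = "\<lambda>u. expectation (\<lambda>\<omega>. poisson_trace n (Complex u v) (random_matrix Y n \<omega>))"
    have d: "\<bar>?gX u - ?gY u\<bar> \<le> poisson_gap v \<tau> n" for u
      using poisson_trace_diff[OF n _ \<tau>, of "Complex u v"] v by (simp add: poisson_gap_def abs_minus_commute)
    note i = AX.smoothed_eq_integral(2)[OF v ab] AY.smoothed_eq_integral(2)[OF v ab]
    have "pi * (AX.smoothed v a b - AY.smoothed v a b)
        = (\<integral>u. ?gX u * indicator {a..b} u - ?gY u * indicator {a..b} u \<partial>lborel)"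
      using i by (simp add: AX.smoothed_eq_integral(1)[OF v ab] AY.smoothed_eq_integral(1)[OF v ab] field_simps)
    then have "pi * \<bar>AX.smoothed v a b - AY.smoothed v a b\<bar>
        = \<bar>\<integral>u. ?gX u * indicator {a..b} u - ?gY u * indicator {a..b} u \<partial>lborel\<bar>"
      by (metis abs_mult abs_of_pos pi_gt_zero)
    also have "\<dots> \<le> (\<integral>u. \<bar>?gX u * indicator {a..b} u - ?gY u * indicator {a..b} u\<bar> \<partial>lborel)"
      by (rule integral_abs_bound)
    also have "\<dots> \<le> (\<integral>u. poisson_gap v \<tau> n * indicator {a..b} u \<partial>lborel)"
    proof (rule integral_mono)
      show "integrable lborel (\<lambda>u. poisson_gap v \<tau> n * indicator {a..b} u)" using ab by simp
    qed (use i d in \<open>auto simp: indicator_def\<close>)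
    also have "\<dots> = (b - a) * poisson_gap v \<tau> n" using ab by simp
    finally have "pi * \<bar>AX.smoothed v a b - AY.smoothed v a b\<bar> \<le> (b - a) * poisson_gap v \<tau> n" .
    \<comment> \<open>The factor 1 / pi is discarded, as pi exceeds 1.\<close>
    then show ?thesis
      using mult_right_mono[of 1 pi "\<bar>AX.smoothed v a b - AY.smoothed v a b\<bar>"] pi_ge_two by simp
  qed
  \<comment> \<open>The estimate over the interval from 0 to 1 already forces nonnegativity.\<close>
  have gap0: "0 \<le> poisson_gap v \<tau> n"
    using order.trans[OF abs_ge_zero gap[of 0 1]] by simp
  have eta0: "0 \<le> 1 - cauchy_cdf (e / v)" using cauchy_cdf_bounds by simp
  have s0: "0 \<le> mean_variance n / K\<^sup>2" by (simp add: mean_variance_def sum_nonneg)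
  note tX = AX.mean_cdf_tails[OF K, unfolded second_moments] and tY = AY.mean_cdf_tails[OF K, unfolded second_moments]
  have XY: "AX.smoothed v a b \<le> AY.smoothed v a b + (b - a) * poisson_gap v \<tau> n"
    and YX: "AY.smoothed v a b \<le> AX.smoothed v a b + (b - a) * poisson_gap v \<tau> n" if "a \<le> b" for a b
    using gap[OF that] by linarith+
  show "mean_spectral_cdf M X n (x - 2 * e) \<le> mean_spectral_cdf M Y n x + err"
    unfolding cdf err_def using e K
    by (intro cdf_le_of_smoothed_close[where I="AX.smoothed v" and J="AY.smoothed v"]
        AX.mean_cdf_bounds AY.mean_cdf_bounds AX.mean_cdf_le_smoothed AY.smoothed_le_mean_cdf
        XY tX tY gap0 eta0 s0 v monoI AX.mean_cdf_mono AY.mean_cdf_mono) auto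
  show "mean_spectral_cdf M Y n (x - 2 * e) \<le> mean_spectral_cdf M X n x + err"
    unfolding cdf err_def using e K
    by (intro cdf_le_of_smoothed_close[where I="AY.smoothed v" and J="AX.smoothed v"]
        AX.mean_cdf_bounds AY.mean_cdf_bounds AY.mean_cdf_le_smoothed AX.smoothed_le_mean_cdf
        YX tX tY gap0 eta0 s0 v monoI AX.mean_cdf_mono AY.mean_cdf_mono) auto
qed

text \<open>For fixed \<open>\<tau>\<close> the limit is not 0: the cubic remainder keeps a multiple
  of \<open>\<tau>\<close> times the mean variance, which tends to 1. It is made small through
  \<open>\<tau>\<close>, chosen after \<open>v\<close>.\<close>

lemma poisson_gap_tendsto:
  assumes b: "(\<lambda>n. 1 / (real n)\<^sup>2 * (\<Sum>i=1..n. \<Sum>j=1..n. cond_var_dev n i j)) \<longlonglongrightarrow> 0"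
    and c: "(\<lambda>n. 1 / (real n)\<^sup>2 * (\<Sum>i=1..n. \<Sum>j=1..n. tail_moment X \<tau> n i j)) \<longlonglongrightarrow> 0"
      "(\<lambda>n. 1 / (real n)\<^sup>2 * (\<Sum>i=1..n. \<Sum>j=1..n. tail_moment Y \<tau> n i j)) \<longlonglongrightarrow> 0"
    and m: "mean_variance \<longlonglongrightarrow> 1"
  shows "poisson_gap v \<tau> \<longlonglongrightarrow> 4 * \<tau> / v ^ 4"
proof -
  have "poisson_gap v \<tau> = (\<lambda>n. 4 / v ^ 3 * (1 / (real n)\<^sup>2 * (\<Sum>i=1..n. \<Sum>j=1..n. cond_var_dev n i j))
      + 4 * \<tau> / v ^ 4 * mean_variance n
      + 4 / v ^ 3 * (1 / (real n)\<^sup>2 * (\<Sum>i=1..n. \<Sum>j=1..n. tail_moment X \<tau> n i j)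
          + 1 / (real n)\<^sup>2 * (\<Sum>i=1..n. \<Sum>j=1..n. tail_moment Y \<tau> n i j)))"
    unfolding poisson_gap_def[abs_def] mean_variance_def
    by (simp only: sum.distrib distrib_left sum_distrib_left mult_ac)
  moreover have "\<dots> \<longlonglongrightarrow> 4 / v ^ 3 * 0 + 4 * \<tau> / v ^ 4 * 1 + 4 / v ^ 3 * (0 + 0)"
    by (intro tendsto_add tendsto_mult tendsto_const b c m)
  ultimately show ?thesis by simp
qed

lemma levy_dist_tendsto:
  assumes b: "(\<lambda>n. 1 / (real n)\<^sup>2 * (\<Sum>i=1..n. \<Sum>j=1..n. cond_var_dev n i j)) \<longlonglongrightarrow> 0"
    and c: "\<And>\<tau>. \<tau> > 0 \<Longrightarrow> (\<lambda>n. 1 / (real n)\<^sup>2 * (\<Sum>i=1..n. \<Sum>j=1..n. tail_moment X \<tau> n i j)) \<longlonglongrightarrow> 0"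
      "\<And>\<tau>. \<tau> > 0 \<Longrightarrow> (\<lambda>n. 1 / (real n)\<^sup>2 * (\<Sum>i=1..n. \<Sum>j=1..n. tail_moment Y \<tau> n i j)) \<longlonglongrightarrow> 0"
    and m: "mean_variance \<longlonglongrightarrow> 1"
  shows "(\<lambda>n. levy_dist (mean_spectral_cdf M X n) (mean_spectral_cdf M Y n)) \<longlonglongrightarrow> 0"
proof (rule LIMSEQ_I)
  fix r :: real assume r: "r > 0"
  \<comment> \<open>Halving leaves room for the strict inequality.\<close>
  define \<epsilon> where "\<epsilon> = r / 2"
  have \<epsilon>: "\<epsilon> > 0" "\<epsilon> < r" using r by (auto simp: \<epsilon>_def)
  have "eventually (\<lambda>t. 1 - \<epsilon> / 8 < cauchy_cdf t) at_top"
    using order_tendstoD(1)[OF cauchy_cdf_at_top, of "1 - \<epsilon> / 8"] \<epsilon> by simp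
  then have "eventually (\<lambda>t. 1 - \<epsilon> / 8 < cauchy_cdf t \<and> 0 < t) at_top"
    using eventually_gt_at_top[of 0] by (rule eventually_conj)
  then obtain t where t: "1 - \<epsilon> / 8 < cauchy_cdf t" "0 < t"
    using eventually_happens'[OF trivial_limit_at_top_linorder] by blast
  \<comment> \<open>Each choice uses only earlier ones: \<open>2 * e\<close> is the shift allowed in
    the Levy condition, \<open>e / v = t\<close> puts the smoothing error below \<epsilon> / 8, K^2
    = 16 / \<epsilon> makes the tail at most \<epsilon> / 8 once the mean variance is below 2,
    \<kappa> gives 2 K \<kappa> = \<epsilon> / 8, and \<tau> makes the limit of the gap equal to
    \<kappa> / 2.\<close>
  define e v K \<kappa> \<tau> where "e = \<epsilon> / 2" and "v = e / t" and "K = 4 / sqrt \<epsilon>" and "\<kappa> = \<epsilon> / (16 * K)"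
    and "\<tau> = \<kappa> * v ^ 4 / 8"
  have pos: "e > 0" "v > 0" "K > 0" "\<kappa> > 0" "\<tau> > 0"
    using \<epsilon> t by (auto simp: e_def v_def K_def \<kappa>_def \<tau>_def)
  have ev: "e / v = t" using pos t by (simp add: v_def)
  have K2: "K\<^sup>2 = 16 / \<epsilon>" using \<epsilon> by (simp add: K_def power_divide)
  have lim: "poisson_gap v \<tau> \<longlonglongrightarrow> \<kappa> / 2"
    using poisson_gap_tendsto[OF b c[OF pos(5)] m, of v] pos(2) unfolding \<tau>_def by simp
  have "eventually (\<lambda>n. poisson_gap v \<tau> n < \<kappa>) sequentially"
    by (rule order_tendstoD(2)[OF lim]) (use pos in simp)
  moreover have "eventually (\<lambda>n. mean_variance n < 2) sequentially"
    by (rule order_tendstoD(2)[OF m]) simp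
  ultimately have "eventually (\<lambda>n. poisson_gap v \<tau> n < \<kappa> \<and> mean_variance n < 2 \<and> 0 < n) sequentially"
    using eventually_gt_at_top[of 0] by eventually_elim auto
  then obtain N where N: "\<And>n. n \<ge> N \<Longrightarrow> poisson_gap v \<tau> n < \<kappa> \<and> mean_variance n < 2 \<and> 0 < n"
    unfolding eventually_sequentially by blast
  show "\<exists>N. \<forall>n\<ge>N. norm (levy_dist (mean_spectral_cdf M X n) (mean_spectral_cdf M Y n) - 0) < r"
  proof (intro exI allI impI)
    fix n assume "N \<le> n"
    then have n: "poisson_gap v \<tau> n < \<kappa>" "mean_variance n < 2" "0 < n" using N by auto
    have "mean_variance n / K\<^sup>2 \<le> 2 / K\<^sup>2" using n by (intro divide_right_mono) auto
    also have "\<dots> = \<epsilon> / 8" using \<epsilon> by (simp add: K2)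
    finally have 1: "mean_variance n / K\<^sup>2 \<le> \<epsilon> / 8" .
    have "2 * K * poisson_gap v \<tau> n \<le> 2 * K * \<kappa>" using n pos by (intro mult_left_mono) auto
    also have "\<dots> = \<epsilon> / 8" using pos by (simp add: \<kappa>_def)
    finally have 2: "2 * K * poisson_gap v \<tau> n \<le> \<epsilon> / 8" .
    \<comment> \<open>Three smoothing errors, the tail and the integrated gap add up to at most 5
      \<epsilon> / 8.\<close>
    have "3 * (1 - c) + A + B \<le> \<epsilon>" if "1 - \<epsilon> / 8 < c" "A \<le> \<epsilon> / 8" "B \<le> \<epsilon> / 8" for A B c
      using that \<epsilon>(1) by (simp add: field_simps)
    from this[OF t(1) 1 2] have "3 * (1 - cauchy_cdf (e / v)) + mean_variance n / K\<^sup>2 + 2 * K * poisson_gap v \<tau> n \<le> \<epsilon>"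
      unfolding ev .
    moreover have "2 * e = \<epsilon>" by (simp add: e_def)
    ultimately have "mean_spectral_cdf M X n (x - \<epsilon>) \<le> mean_spectral_cdf M Y n x + \<epsilon>"
      "mean_spectral_cdf M Y n (x - \<epsilon>) \<le> mean_spectral_cdf M X n x + \<epsilon>" for x
      using mean_spectral_cdf_compare[OF n(3) pos(2,5,1,3), of x] by auto
    note L = levy_dist_le[OF \<epsilon>(1), of "mean_spectral_cdf M X n" "mean_spectral_cdf M Y n", OF this]
    show "norm (levy_dist (mean_spectral_cdf M X n) (mean_spectral_cdf M Y n) - 0) < r"
      using L \<epsilon>(2) by simp
  qed
qed

end

theorem theorem1p3:
  fixes M :: "'a measure"
    and X Y :: "nat \<Rightarrow> nat \<Rightarrow> 'a \<Rightarrow> real"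
    and \<sigma> :: "nat \<Rightarrow> nat \<Rightarrow> real"
  assumes prob: "prob_space M"
    and X_rv: "\<And>i j. 1 \<le> i \<Longrightarrow> i \<le> j \<Longrightarrow> X i j \<in> borel_measurable M"
    and Y_rv: "\<And>i j. 1 \<le> i \<Longrightarrow> i \<le> j \<Longrightarrow> Y i j \<in> borel_measurable M"
    and X_sq_int: "\<And>i j. 1 \<le> i \<Longrightarrow> i \<le> j \<Longrightarrow> integrable M (\<lambda>\<omega>. (X i j \<omega>)\<^sup>2)"
    and Y_sq_int: "\<And>i j. 1 \<le> i \<Longrightarrow> i \<le> j \<Longrightarrow> integrable M (\<lambda>\<omega>. (Y i j \<omega>)\<^sup>2)"
    and X_mean: "\<And>i j. 1 \<le> i \<Longrightarrow> i \<le> j \<Longrightarrow> (\<integral>\<omega>. X i j \<omega> \<partial>M) = 0"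
    and Y_mean: "\<And>i j. 1 \<le> i \<Longrightarrow> i \<le> j \<Longrightarrow> (\<integral>\<omega>. Y i j \<omega> \<partial>M) = 0"
    and X_var: "\<And>i j. 1 \<le> i \<Longrightarrow> i \<le> j \<Longrightarrow> (\<integral>\<omega>. (X i j \<omega>)\<^sup>2 \<partial>M) = (\<sigma> i j)\<^sup>2"
    and Y_var: "\<And>i j. 1 \<le> i \<Longrightarrow> i \<le> j \<Longrightarrow> (\<integral>\<omega>. (Y i j \<omega>)\<^sup>2 \<partial>M) = (\<sigma> i j)\<^sup>2"
    and X_sym: "\<And>i j. 1 \<le> i \<Longrightarrow> i < j \<Longrightarrow> X j i = X i j"
    and Y_sym: "\<And>i j. 1 \<le> i \<Longrightarrow> i < j \<Longrightarrow> Y j i = Y i j"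
    and \<sigma>_sym: "\<And>i j. 1 \<le> i \<Longrightarrow> i < j \<Longrightarrow> \<sigma> j i = \<sigma> i j"
    and XY_indep: "\<And>n. prob_space.indep_var M
           (matrix_space n) (random_matrix X n) (matrix_space n) (random_matrix Y n)"
    and Y_indep: "\<And>n. prob_space.indep_vars M (\<lambda>_. borel) (\<lambda>(i, j). Y i j)
           {(i, j). 1 \<le> i \<and> i \<le> j \<and> j \<le> n}"
    and Y_gauss: "\<And>i j. 1 \<le> i \<Longrightarrow> i \<le> j \<Longrightarrow> gaussian_rv M (Y i j)"
    and a: "\<And>n i j. 1 \<le> i \<Longrightarrow> i \<le> j \<Longrightarrow> j \<le> n \<Longrightarrow>
           AE \<omega> in M. real_cond_exp M (others_sigma M X n i j) (X i j) \<omega> = 0"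
    and b: "(\<lambda>n. 1 / (real n)\<^sup>2 * (\<Sum>i=1..n. \<Sum>j=1..n.
           \<integral>\<omega>. \<bar>real_cond_exp M (others_sigma M X n i j) (\<lambda>\<omega>'. (X i j \<omega>')\<^sup>2) \<omega> - (\<sigma> i j)\<^sup>2\<bar> \<partial>M))
           \<longlonglongrightarrow> 0"
    and c_X: "\<And>\<tau>::real. \<tau> > 0 \<Longrightarrow> (\<lambda>n. 1 / (real n)\<^sup>2 * (\<Sum>i=1..n. \<Sum>j=1..n.
           \<integral>\<omega>. \<bar>X i j \<omega>\<bar>\<^sup>2 * of_bool (\<bar>X i j \<omega>\<bar> \<ge> \<tau> * sqrt (real n)) \<partial>M)) \<longlonglongrightarrow> 0"
    and c_Y: "\<And>\<tau>::real. \<tau> > 0 \<Longrightarrow> (\<lambda>n. 1 / (real n)\<^sup>2 * (\<Sum>i=1..n. \<Sum>j=1..n.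
           \<integral>\<omega>. \<bar>Y i j \<omega>\<bar>\<^sup>2 * of_bool (\<bar>Y i j \<omega>\<bar> \<ge> \<tau> * sqrt (real n)) \<partial>M)) \<longlonglongrightarrow> 0"
    and d: "(\<lambda>n. 1 / real n * (\<Sum>i=1..n. \<bar>1 / real n * (\<Sum>j=1..n. (\<sigma> i j)\<^sup>2) - 1\<bar>)) \<longlonglongrightarrow> 0"
  shows "(\<lambda>n. levy_dist (mean_spectral_cdf M X n) (mean_spectral_cdf M Y n)) \<longlonglongrightarrow> 0"
proof -
  interpret prob_space M by (rule prob)
  interpret matrix_pair M X Y \<sigma>
    by unfold_locales (fact X_rv Y_rv X_sq_int Y_sq_int Y_mean X_var Y_var X_sym Y_sym \<sigma>_sym XY_indep Y_indep a)+
  show ?thesis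
    using b c_X c_Y mean_variance_tendsto[OF d]
    by (intro levy_dist_tendsto) (auto simp: cond_var_dev_def tail_moment_def)
qed

end
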